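(* Let $\pi(\boldsymbol\vartheta\mid\mathbf y)$, $\boldsymbol\vartheta\in\mathbb R^m$, be the posterior density of the parameters of a linear Gaussian structural equation model based on $n$ independent observations, as described in the context. Let $\boldsymbol\vartheta^*$ be its mode, $\mathbf H=-\nabla^2\log\pi(\boldsymbol\vartheta\mid\mathbf y)\big|_{\boldsymbol\vartheta=\boldsymbol\vartheta^*}\succ\mathbf 0$, $\boldsymbol\Omega=\mathbf H^{-1}$, and let $$\hat{\boldsymbol\delta}=\operatorname*{arg\,max}_{\boldsymbol\delta\in\mathbb R^m}\ \operatorname{E}_{\boldsymbol\vartheta\sim \mathrm N_m(\boldsymbol\vartheta^*+\boldsymbol\delta,\boldsymbol\Omega)}\{\log\pi(\boldsymbol\vartheta\mid\mathbf y)\}$$ be the variational Bayes mean correction. For $j=1,\dots,m$ let $$h_j(t)=\log\pi(\boldsymbol\vartheta^*+t\,\mathbf v_j\mid\mathbf y)+t\,\gamma_j',\qquad \mathbf v_j=\boldsymbol\Omega_{\cdot j}/\sqrt{\Omega_{jj}},$$ be the unnormalised volume-corrected log-marginal along the scan direction $\mathbf v_j$ (with the volume slope $\gamma_j'$ defined in the context), and let $\bar\vartheta_j$ be the marginal mean under $p_j(t)\propto\exp\{h_j(t)\}$ on the scale of $\vartheta_j$, that is, $\bar\vartheta_j=\vartheta_j^*+\sqrt{\Omega_{jj}}\,\operatorname{E}_{p_j}(t)$. Under the standard regularity conditions for Laplace's method (Tierney and Kadane, 1986), namely a unique interior mode, local smoothness, and exponential tail decay, as $n\to\infty$ with $m$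 fixed, $$\bar\vartheta_j=\vartheta_j^*+\hat\delta_j+O(n^{-2}),\qquad j=1,\dots,m,$$ where $\hat\delta_j$ is the $j$th component of $\hat{\boldsymbol\delta}$.
   Context: Model: the data $\mathbf y=(\mathbf y_1^\top,\dots,\mathbf y_n^\top)^\top$ consist of $n$ independent vectors $\mathbf y_s\in\mathbb R^p$. After the latent variables are integrated out analytically, the likelihood is $\pi(\mathbf y\mid\boldsymbol\vartheta)=\prod_{s=1}^n\phi_p(\mathbf y_s;\boldsymbol\mu(\boldsymbol\vartheta),\boldsymbol\Sigma(\boldsymbol\vartheta))$, where $\phi_p(\cdot;\boldsymbol\mu,\boldsymbol\Sigma)$ is the $p$-variate normal density and $$\boldsymbol\mu(\boldsymbol\vartheta)=\boldsymbol\nu+\boldsymbol\Lambda(\mathbf I-\mathbf B)^{-1}\boldsymbol\alpha,\qquad \boldsymbol\Sigma(\boldsymbol\vartheta)=\boldsymbol\Lambda(\mathbf I-\mathbf B)^{-1}\boldsymbol\Psi(\mathbf I-\mathbf B)^{-\top}\boldsymbol\Lambda^\top+\boldsymbol\Theta.$$ Here $\boldsymbol\nu\in\mathbb R^p$ (intercepts), $\boldsymbol\Lambda$ ($p\times q$ loadings), $\boldsymbol\Theta$ ($p\times p$ error covariance), $\boldsymbol\alpha\in\mathbb R^q$ (latent intercepts), $\mathbf B$ ($q\times q$ regression coefficients with zero diagonal, permutable to strictly triangular form, so that $\mathbf I-\mathbf B$ is invertible) and $\boldsymbol\Psi$ ($q\times q$ disturbance covariance) have their free entries collected in $\boldsymbol\vartheta\in\mathbb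 R^m$, parameters subject to positivity or boundedness constraints being mapped to $\mathbb R$ by differentiable transformations (e.g. log for variances, Fisher transformation for correlations). With prior $\pi(\boldsymbol\vartheta)$, the posterior is $\pi(\boldsymbol\vartheta\mid\mathbf y)\propto\pi(\mathbf y\mid\boldsymbol\vartheta)\,\pi(\boldsymbol\vartheta)$. Notation: $\mathrm N_m(\boldsymbol\mu,\boldsymbol\Omega)$ is the $m$-variate normal distribution; $\boldsymbol\Omega_{\cdot j}$ is the $j$th column of $\boldsymbol\Omega$ and $\Omega_{jj}$ its $j$th diagonal entry. Maximising the displayed objective over $\boldsymbol\delta$ is equivalent to minimising the Kullback–Leibler divergence $D_{\mathrm{KL}}(\mathrm N_m(\boldsymbol\vartheta^*+\boldsymbol\delta,\boldsymbol\Omega)\,\Vert\,\pi(\cdot\mid\mathbf y))$, the covariance being held fixed. Along $\boldsymbol\vartheta(t)=\boldsymbol\vartheta^*+t\,\mathbf v_j$ the $j$th coordinate is $\vartheta_j(t)=\vartheta_j^*+\sqrt{\Omega_{jj}}\,t$. Volume slope: with $\mathbf H(t)=-\nabla^2\log\pi(\boldsymbol\vartheta\mid\mathbf y)\big|_{\boldsymbol\vartheta=\boldsymbol\vartheta^*+t\mathbf v_j}$ and $\mathbf H_{-j}(t)$ the $(m-1)\times(m-1)$ submatrix of $\mathbf H(t)$ with the $j$th row and column removed, set $\gamma_j(t)=-\tfrac12\log|\mathbf H_{-j}(t)|$ and $\gamma_j'=\frac{d}{dt}\gamma_j(t)\big|_{t=0}$. Regularity conditions: these are the conditions under which Laplace's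 method applied to an integral with the large-sample representation $I_n=\int g(y,x)\exp\{nL(y,x)\}\,dx$, $L(y,x)=\frac1n\log f_n(y,x)$, has relative error $O(n^{-1})$: a unique interior mode, local smoothness, and exponential tail decay. *)

theory Defs
  imports "HOL-Analysis.Analysis" "HOL-Library.Landau_Symbols"
begin

section \<open>Matrices\<close>

definition pos_semidef :: "real^'n^'n \<Rightarrow> bool" where
  "pos_semidef A \<longleftrightarrow> transpose A = A \<and> (\<forall>u. 0 \<le> u \<bullet> (A *v u))"

definition pos_def :: "real^'n^'n \<Rightarrow> bool" where
  "pos_def A \<longleftrightarrow> transpose A = A \<and> (\<forall>u. u \<noteq> 0 \<longrightarrow> 0 < u \<bullet> (A *v u))"

text \<open>Determinant of the submatrix with rows and columns in \<open>S\<close>: the defining formula of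
  \<^const>\<open>det\<close> over the index set \<open>S\<close>, since the submatrix has no index type of its own.
  It is 1 for \<open>S = {}\<close>.\<close>

definition submatrix_det :: "real^'n^'n \<Rightarrow> 'n set \<Rightarrow> real" where
  "submatrix_det A S =
     (\<Sum>p | p permutes S. of_int (sign p) * (\<Prod>i\<in>S. A $ i $ p i))"


section \<open>Partial derivatives\<close>

definition partial :: "'m::finite \<Rightarrow> (real^'m \<Rightarrow> real) \<Rightarrow> real^'m \<Rightarrow> real" where
  "partial i f = (\<lambda>x. frechet_derivative f (at x) (axis i 1))"

abbreviation partials :: "'m::finite list \<Rightarrow> (real^'m \<Rightarrow> real) \<Rightarrow> real^'m \<Rightarrow> real" where
  "partials is f \<equiv> foldr partial is f"

definition hessian :: "(real^'m \<Rightarrow> real) \<Rightarrow> real^'m \<Rightarrow> real^'m^'m" where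
  "hessian f x = (\<chi> i j. partials [i, j] f x)"

text \<open>\<open>f\<close> is of class \<open>C\<^sup>k\<close> on the open set \<open>U\<close>, with partial derivatives of orders
  \<open>1, \<dots>, k\<close> bounded by \<open>M\<close>.\<close>

definition bounded_derivs_on ::
    "nat \<Rightarrow> real \<Rightarrow> (real^'m) set \<Rightarrow> (real^'m \<Rightarrow> real) \<Rightarrow> bool" where
  "bounded_derivs_on k M U f \<longleftrightarrow>
     (\<forall>is. length is < k \<longrightarrow> (\<forall>x\<in>U. partials is f differentiable (at x))) \<and>
     (\<forall>is. length is \<le> k \<longrightarrow> continuous_on U (partials is f)) \<and>
     (\<forall>is. is \<noteq> [] \<and> length is \<le> k \<longrightarrow> (\<forall>x\<in>U. \<bar>partials is f x\<bar> \<le> M))"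


section \<open>The multivariate normal distribution\<close>

definition mvn_density :: "real^'n \<Rightarrow> real^'n^'n \<Rightarrow> real^'n \<Rightarrow> real" where
  "mvn_density \<mu> \<Sigma> x =
     exp (- (1/2) * ((x - \<mu>) \<bullet> (matrix_inv \<Sigma> *v (x - \<mu>))))
       / sqrt ((2 * pi) ^ CARD('n) * det \<Sigma>)"

definition mvn :: "real^'n \<Rightarrow> real^'n^'n \<Rightarrow> (real^'n) measure" where
  "mvn \<mu> \<Sigma> = density lborel (\<lambda>x. ennreal (mvn_density \<mu> \<Sigma> x))"


section \<open>Linear Gaussian structural equation models\<close>

text \<open>All model matrices are functions of the unconstrained parameter vector in \<open>\<real>\<^sup>m\<close>:
  fixed entries are constant functions, and a free entry is the composition of the relevant
  coordinates with its transformation (for instance \<open>exp (\<theta>\<^sub>k)\<close> for a variance, or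
  \<open>tanh (\<theta>\<^sub>k) * exp ((\<theta>\<^sub>a + \<theta>\<^sub>b) / 2)\<close> for a covariance).\<close>

record ('m::finite, 'p::finite, 'q::finite) sem =
  intercepts :: "real^'m \<Rightarrow> real^'p"
  loadings :: "real^'m \<Rightarrow> real^'q^'p"
  error_cov :: "real^'m \<Rightarrow> real^'p^'p"
  latent_intercepts :: "real^'m \<Rightarrow> real^'q"
  regression :: "real^'m \<Rightarrow> real^'q^'q"
  disturbance_cov :: "real^'m \<Rightarrow> real^'q^'q"

definition sem_mean :: "('m::finite, 'p::finite, 'q::finite) sem \<Rightarrow> real^'m \<Rightarrow> real^'p" where
  "sem_mean S \<theta> =
     intercepts S \<theta> + loadings S \<theta> *v (matrix_inv (mat 1 - regression S \<theta>) *v latent_intercepts S \<theta>)"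

definition sem_cov :: "('m::finite, 'p::finite, 'q::finite) sem \<Rightarrow> real^'m \<Rightarrow> real^'p^'p" where
  "sem_cov S \<theta> =
     loadings S \<theta> ** matrix_inv (mat 1 - regression S \<theta>) ** disturbance_cov S \<theta>
       ** transpose (matrix_inv (mat 1 - regression S \<theta>)) ** transpose (loadings S \<theta>)
     + error_cov S \<theta>"

text \<open>The condition on \<open>regression\<close> says that one simultaneous reordering of rows and columns
  makes it strictly triangular for every parameter value; \<open>a = b\<close> gives the zero diagonal.\<close>

definition valid_sem :: "('m::finite, 'p::finite, 'q::finite) sem \<Rightarrow> bool" where
  "valid_sem S \<longleftrightarrow>
     intercepts S differentiable_on UNIV \<and>
     loadings S differentiable_on UNIV \<and>
     error_cov S differentiable_on UNIV \<and>
     latent_intercepts S differentiable_on UNIV \<and>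
     regression S differentiable_on UNIV \<and>
     disturbance_cov S differentiable_on UNIV \<and>
     (\<exists>rank :: 'q \<Rightarrow> nat. inj rank \<and>
        (\<forall>\<theta> a b. rank a \<le> rank b \<longrightarrow> regression S \<theta> $ a $ b = 0)) \<and>
     (\<forall>\<theta>. pos_semidef (error_cov S \<theta>)) \<and>
     (\<forall>\<theta>. pos_semidef (disturbance_cov S \<theta>)) \<and>
     (\<forall>\<theta>. pos_def (sem_cov S \<theta>))"

text \<open>The observations are \<open>y 0, \<dots>, y (n - 1)\<close>.\<close>

definition sem_likelihood ::
    "('m::finite, 'p::finite, 'q::finite) sem \<Rightarrow> (nat \<Rightarrow> real^'p) \<Rightarrow> nat \<Rightarrow> real^'m \<Rightarrow> real" where
  "sem_likelihood S y n \<theta> = (\<Prod>s<n. mvn_density (sem_mean S \<theta>) (sem_cov S \<theta>) (y s))"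

definition sem_posterior ::
    "('m::finite, 'p::finite, 'q::finite) sem \<Rightarrow> (real^'m \<Rightarrow> real) \<Rightarrow> (nat \<Rightarrow> real^'p) \<Rightarrow> nat \<Rightarrow>
     real^'m \<Rightarrow> real" where
  "sem_posterior S prior y n \<theta> =
     sem_likelihood S y n \<theta> * prior \<theta> / (\<integral>t. sem_likelihood S y n t * prior t \<partial>lborel)"


section \<open>Variational mean correction and volume-corrected marginals\<close>

text \<open>In this section \<open>post\<close> is a posterior density and \<open>mode\<close> its mode.\<close>

definition neg_log_hessian :: "(real^'m \<Rightarrow> real) \<Rightarrow> real^'m \<Rightarrow> real^'m^'m" where
  "neg_log_hessian post \<theta> = - hessian (\<lambda>x. ln (post x)) \<theta>"

definition laplace_cov :: "(real^'m \<Rightarrow> real) \<Rightarrow> real^'m \<Rightarrow> real^'m^'m" where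
  "laplace_cov post mode = matrix_inv (neg_log_hessian post mode)"

definition vb_objective :: "(real^'m \<Rightarrow> real) \<Rightarrow> real^'m \<Rightarrow> real^'m \<Rightarrow> real" where
  "vb_objective post mode d =
     (\<integral>\<theta>. ln (post \<theta>) \<partial>(mvn (mode + d) (laplace_cov post mode)))"

text \<open>As \<open>ln (post \<theta>)\<close> is bounded above by its value at the mode, the expectation is \<open>-\<infinity>\<close>
  whenever \<open>ln (post \<theta>)\<close> fails to be integrable, whereas the Bochner integral is then 0 by
  convention. Such \<open>d\<close> are therefore excluded from the maximisation.\<close>

definition is_vb_correction :: "(real^'m \<Rightarrow> real) \<Rightarrow> real^'m \<Rightarrow> real^'m \<Rightarrow> bool" where
  "is_vb_correction post mode d \<longleftrightarrow>
     is_arg_max (vb_objective post mode)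
       (\<lambda>d. integrable (mvn (mode + d) (laplace_cov post mode)) (\<lambda>\<theta>. ln (post \<theta>))) d"

definition scan_direction :: "(real^'m \<Rightarrow> real) \<Rightarrow> real^'m \<Rightarrow> 'm::finite \<Rightarrow> real^'m" where
  "scan_direction post mode j =
     (1 / sqrt (laplace_cov post mode $ j $ j)) *\<^sub>R column j (laplace_cov post mode)"

definition log_volume :: "(real^'m \<Rightarrow> real) \<Rightarrow> real^'m \<Rightarrow> 'm::finite \<Rightarrow> real \<Rightarrow> real" where
  "log_volume post mode j t =
     - (1/2) * ln (submatrix_det (neg_log_hessian post (mode + t *\<^sub>R scan_direction post mode j)) (- {j}))"

definition volume_slope :: "(real^'m \<Rightarrow> real) \<Rightarrow> real^'m \<Rightarrow> 'm::finite \<Rightarrow> real" where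
  "volume_slope post mode j = deriv (log_volume post mode j) 0"

definition scan_log_marginal :: "(real^'m \<Rightarrow> real) \<Rightarrow> real^'m \<Rightarrow> 'm::finite \<Rightarrow> real \<Rightarrow> real" where
  "scan_log_marginal post mode j t =
     ln (post (mode + t *\<^sub>R scan_direction post mode j)) + t * volume_slope post mode j"

definition scan_marginal_mean :: "(real^'m \<Rightarrow> real) \<Rightarrow> real^'m \<Rightarrow> 'm::finite \<Rightarrow> real" where
  "scan_marginal_mean post mode j =
     mode $ j + sqrt (laplace_cov post mode $ j $ j) *
       ((\<integral>t. t * exp (scan_log_marginal post mode j t) \<partial>lborel)
        / (\<integral>t. exp (scan_log_marginal post mode j t) \<partial>lborel))"


section \<open>Regularity conditions for Laplace's method\<close>

text \<open>The integrals are \<open>I\<^sub>n = \<integral> g\<^sub>n(x) f\<^sub>n(x) dx = \<integral> g\<^sub>n(x) exp (n L\<^sub>n(x)) dx\<close> with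
  \<open>L\<^sub>n = (1/n) log f\<^sub>n\<close>, and \<open>xh n\<close> is the mode of \<open>L\<^sub>n\<close>. All conditions are uniform in \<open>n\<close>,
  for large \<open>n\<close>.\<close>

definition avg_log :: "(nat \<Rightarrow> 'a \<Rightarrow> real) \<Rightarrow> nat \<Rightarrow> 'a \<Rightarrow> real" where
  "avg_log f n x = ln (f n x) / real n"

text \<open>The mode is unique, in the uniform sense that values away from it are bounded away from the
  maximum, and it is nondegenerate. It is interior because the domain is the whole space.\<close>

definition unique_mode_cond :: "(nat \<Rightarrow> real^'m \<Rightarrow> real) \<Rightarrow> (nat \<Rightarrow> real^'m) \<Rightarrow> bool" where
  "unique_mode_cond f xh \<longleftrightarrow>
     (\<forall>\<epsilon>>0. \<exists>c>0. \<forall>\<^sub>F n in sequentially. \<forall>x. \<epsilon> \<le> dist x (xh n) \<longrightarrow>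
        avg_log f n x \<le> avg_log f n (xh n) - c) \<and>
     (\<exists>c>0. \<forall>\<^sub>F n in sequentially. \<forall>u.
        c * (u \<bullet> u) \<le> u \<bullet> (- hessian (avg_log f n) (xh n) *v u))"

text \<open>Five bounded derivatives: the \<open>O(n\<^sup>-\<^sup>2)\<close> term of a posterior mean involves the fifth.\<close>

definition local_smoothness_cond :: "(nat \<Rightarrow> real^'m \<Rightarrow> real) \<Rightarrow> (nat \<Rightarrow> real^'m) \<Rightarrow> bool" where
  "local_smoothness_cond f xh \<longleftrightarrow>
     (\<exists>\<epsilon>>0. \<exists>M. \<forall>\<^sub>F n in sequentially. bounded_derivs_on 5 M (ball (xh n) \<epsilon>) (avg_log f n))"

text \<open>The part of the integral away from the mode is exponentially small in \<open>n\<close>, relative to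
  \<open>f\<^sub>n (xh n)\<close>. Here \<open>f n x / f n (xh n)\<close> is \<open>exp (n (L\<^sub>n(x) - L\<^sub>n(xh n)))\<close>.\<close>

definition tail_decay_cond ::
    "(nat \<Rightarrow> 'a \<Rightarrow> real) \<Rightarrow> (nat \<Rightarrow> 'a \<Rightarrow> real) \<Rightarrow> (nat \<Rightarrow> 'a::euclidean_space) \<Rightarrow> bool" where
  "tail_decay_cond g f xh \<longleftrightarrow>
     (\<forall>\<epsilon>>0. \<exists>C>0. \<exists>c>0. \<forall>\<^sub>F n in sequentially.
        set_integrable lborel (- ball (xh n) \<epsilon>) (\<lambda>x. \<bar>g n x\<bar> * (f n x / f n (xh n))) \<and>
        (LINT x:- ball (xh n) \<epsilon>|lborel. \<bar>g n x\<bar> * (f n x / f n (xh n))) \<le> C * exp (- c * real n))"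

text \<open>Laplace's method is applied to the posterior (\<open>g = 1\<close>), to the numerator and denominator of
  the scan-marginal means, and to the Gaussian expectations of the log-posterior. The mode and
  smoothness conditions are those of the posterior; the last two kinds of integral have tails that
  the posterior integral does not control, so tail decay is required of them too.
  The scan integrals are taken in the variable \<open>x = \<vartheta>\<^sub>j - \<vartheta>\<^sub>j\<^sup>* = sqrt \<Omega>\<^sub>j\<^sub>j t\<close>, in which
  the large-sample representation holds. The Gaussian integrals are required to be well behaved only
  for mean shifts \<open>d n\<close> tending to 0.\<close>

definition laplace_regular :: "(nat \<Rightarrow> real^'m \<Rightarrow> real) \<Rightarrow> (nat \<Rightarrow> real^'m) \<Rightarrow> bool" where
  "laplace_regular post mode \<longleftrightarrow>
     unique_mode_cond post mode \<and>
     local_smoothness_cond post mode \<and>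
     tail_decay_cond (\<lambda>n x. 1) post mode \<and>
     (\<forall>j. \<forall>k\<in>{0, 1}. tail_decay_cond (\<lambda>n x. x ^ k)
        (\<lambda>n x. exp (scan_log_marginal (post n) (mode n) j
                      (x / sqrt (laplace_cov (post n) (mode n) $ j $ j))))
        (\<lambda>n. 0)) \<and>
     (\<forall>d. d \<longlonglongrightarrow> 0 \<longrightarrow> tail_decay_cond (\<lambda>n x. ln (post n x))
        (\<lambda>n. mvn_density (mode n + d n) (laplace_cov (post n) (mode n)))
        (\<lambda>n. mode n + d n))"

end

theory Submission
  imports Defs "HOL-Probability.Distributions" "HOL-Real_Asymp.Real_Asymp"
begin

text \<open>Write \<open>f = log \<pi>\<close>, \<open>T\<close> for its third derivatives at the mode and
  \<open>\<tau>\<^sub>i = \<Sum>\<^sub>k\<^sub>l T\<^sub>k\<^sub>l\<^sub>i \<Omega>\<^sub>k\<^sub>l\<close>. The shift of the scan mean and the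
  variational correction both equal \<open>\<Omega> \<tau> / 2\<close> up to \<open>O(n\<^sup>-\<^sup>2)\<close>.

  Scan: with \<open>x = \<vartheta>\<^sub>j - \<vartheta>\<^sub>j\<^sup>*\<close> and \<open>w = \<Omega>\<^sub>\<cdot>\<^sub>j / \<Omega>\<^sub>j\<^sub>j\<close>, the log-marginal has derivative
  \<open>h' = - x / \<Omega>\<^sub>j\<^sub>j + \<beta> + p x\<^sup>2 + q x\<^sup>3 + O(n x\<^sup>4)\<close>, where \<open>2 p = T[w,w,w]\<close> and \<open>\<beta>\<close> is the volume
  slope. Integrating \<open>(x\<^sup>k exp h)'\<close> over a small interval for \<open>k \<le> 3\<close> yields the moments of \<open>x\<close>, and in
  particular the mean \<open>\<beta> \<Omega>\<^sub>j\<^sub>j + p \<Omega>\<^sub>j\<^sub>j\<^sup>2\<close>, without any Gaussian integral. Jacobi's formula gives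
  \<open>2 \<beta> = \<Sum>\<^sub>a\<^sub>b P\<^sub>a\<^sub>b T[w]\<^sub>a\<^sub>b\<close> with \<open>P = \<Omega> - \<Omega>\<^sub>j\<^sub>j w w\<^sup>T\<close>, so the terms in \<open>T[w,w,w]\<close> cancel.

  Variational correction: comparing \<open>\<delta>\<close> with a zero shift shows \<open>\<delta> \<longrightarrow> 0\<close>. Comparing it with
  \<open>d = \<Omega> \<tau> / 2\<close>, strong concavity of \<open>f\<close> near the mode bounds \<open>n |\<delta> - d|\<^sup>2\<close> by \<open>|\<delta> - d|\<close> times the
  expected gradient at \<open>d\<close>, which is \<open>O(n\<^sup>-\<^sup>1)\<close>; hence \<open>|\<delta> - d| = O(n\<^sup>-\<^sup>2)\<close> and nothing has to be
  differentiated under the integral sign.\<close>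

section \<open>Taylor expansion in terms of partial derivatives\<close>

text \<open>The estimates are proved for one fixed sample size, with explicit constants built only
  from uniform data such as \<open>\<kappa>\<close>, \<open>M\<close>, \<open>\<epsilon>\<close> and
  the dimension. The asymptotic statements can therefore fix their constants before \<open>n\<close>
  is chosen. Tails shape the rest. Tail decay is given relative to the value at the centre, whereas
  the estimates are relative to the total mass, which may shrink like a power of \<open>n\<close>.
  Crude lower bounds on a cube or interval of length about \<open>1 / n\<close> suffice, because
  exponential decay beats every power. For the variational correction there is a second obstacle:
  tail decay is available only along shifts that tend to 0, and nothing is known about the maximiser
  beforehand. The proof that it tends to 0 may thus use only the maximality of the mode at the
  maximiser, and tail decay at the zero shift. Maximality, moreover, is only against shifts with an
  integrable log posterior; both competitors, 0 and \<open>dstar\<close>, are admissible because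
  they tend to 0.\<close>

lemma bounded_derivs_onD:
  assumes "bounded_derivs_on k M U f"
  shows "length is < k \<Longrightarrow> x \<in> U \<Longrightarrow> partials is f differentiable (at x)"
    and "length is \<le> k \<Longrightarrow> continuous_on U (partials is f)"
    and "is \<noteq> [] \<Longrightarrow> length is \<le> k \<Longrightarrow> x \<in> U \<Longrightarrow> \<bar>partials is f x\<bar> \<le> M"
  using assms unfolding bounded_derivs_on_def by blast+

lemma bounded_derivs_on_partial:
  assumes "bounded_derivs_on (Suc k) M U f"
  shows "bounded_derivs_on k M U (partial i f)"
proof -
  have eq: "partials is (partial i f) = partials (is @ [i]) f" for "is"
    by simp
  show ?thesis
    unfolding bounded_derivs_on_def eq
    by (intro conjI allI impI ballI; rule bounded_derivs_onD[OF assms]; simp)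
qed

lemma bounded_derivs_on_mono:
  assumes "bounded_derivs_on k M U f" "l \<le> k" "V \<subseteq> U"
  shows "bounded_derivs_on l M V f"
proof -
  have "continuous_on V (partials is f)" if "length is \<le> l" for "is"
    using bounded_derivs_onD(2)[OF assms(1), of "is"] assms(2,3) that
    by (auto intro: continuous_on_subset)
  then show ?thesis
    using assms unfolding bounded_derivs_on_def
    by (meson order.strict_trans2 order_trans subsetD)
qed

text \<open>An outer partial derivative sees its argument on a neighbourhood, so the induction runs
  over all points of an open set. This turns the smoothness of \<open>avg_log\<close> into that of
  the log posterior, which is \<open>n\<close> times as large.\<close>

lemma partials_cmult:
  assumes f: "bounded_derivs_on k M U f" and "open U" "x \<in> U" "length is \<le> k"
  shows "partials is (\<lambda>x. c * f x) x = c * partials is f x"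
  using assms(3,4)
proof (induction "is" arbitrary: x)
  case Nil
  then show ?case by simp
next
  case (Cons i "is")
  have d: "partials is f differentiable (at x)"
    using Cons.prems by (intro bounded_derivs_onD(1)[OF f]) auto
  then have "((\<lambda>y. c * partials is f y) has_derivative
      (\<lambda>v. c * frechet_derivative (partials is f) (at x) v)) (at x)"
    by (intro derivative_intros) (simp flip: frechet_derivative_works)
  then have "((\<lambda>y. partials is (\<lambda>x. c * f x) y) has_derivative
      (\<lambda>v. c * frechet_derivative (partials is f) (at x) v)) (at x)"
    by (rule has_derivative_transform_within_open[OF _ \<open>open U\<close>]) (use Cons in auto)
  from frechet_derivative_at[OF this, symmetric]
  show ?case by (simp add: partial_def [of i])
qed

lemma differentiable_transform_open:
  assumes "f differentiable (at x)" "open U" "x \<in> U" "\<And>y. y \<in> U \<Longrightarrow> f y = g y"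
  shows "g differentiable (at x)"
  using assms has_derivative_transform_within_open unfolding differentiable_def by blast

lemma bounded_derivs_on_cmult:
  assumes f: "bounded_derivs_on k M U f" and "open U" "0 \<le> c"
  shows "bounded_derivs_on k (c * M) U (\<lambda>x. c * f x)"
proof -
  note eq = partials_cmult[OF f \<open>open U\<close>]
  have "partials is (\<lambda>x. c * f x) differentiable (at x)" if "length is < k" "x \<in> U" for "is" x
    by (rule differentiable_transform_open[OF _ \<open>open U\<close> \<open>x \<in> U\<close>, of "\<lambda>x. c * partials is f x"])
      (use that in \<open>auto intro!: derivative_intros bounded_derivs_onD(1)[OF f] eq[symmetric]\<close>)
  moreover have "continuous_on U (partials is (\<lambda>x. c * f x))" if "length is \<le> k" for "is"
    using bounded_derivs_onD(2)[OF f that] that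
    by (subst continuous_on_cong[OF refl eq]) (auto intro!: continuous_intros)
  moreover have "\<bar>partials is (\<lambda>x. c * f x) x\<bar> \<le> c * M"
    if "is \<noteq> []" "length is \<le> k" "x \<in> U" for "is" x
    using bounded_derivs_onD(3)[OF f that] that \<open>0 \<le> c\<close>
    by (simp add: eq abs_mult mult_left_mono)
  ultimately show ?thesis
    unfolding bounded_derivs_on_def by blast
qed

section \<open>Directional derivatives and Taylor's formula along a segment\<close>

lemma has_derivative_partials:
  fixes f :: "real^'m \<Rightarrow> real"
  assumes "f differentiable (at x)"
  shows "(f has_derivative (\<lambda>v. \<Sum>i\<in>UNIV. v $ i * partial i f x)) (at x)"
proof -
  let ?D = "frechet_derivative f (at x)"
  have D: "(f has_derivative ?D) (at x)"
    using assms by (simp add: frechet_derivative_works)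
  then have l: "linear ?D"
    by (rule has_derivative_linear)
  have "?D v = (\<Sum>i\<in>UNIV. v $ i * partial i f x)" for v
  proof -
    have "?D v = ?D (\<Sum>i\<in>UNIV. v $ i *\<^sub>R axis i 1)"
      by (simp add: basis_expansion flip: scalar_mult_eq_scaleR)
    also have "\<dots> = (\<Sum>i\<in>UNIV. v $ i * partial i f x)"
      using l by (simp add: linear_sum linear_scale partial_def)
    finally show ?thesis .
  qed
  then show ?thesis
    using D by (metis (no_types, lifting) ext)
qed

text \<open>The form of \<open>k\<close>-th derivatives evaluated at \<open>(u, ..., u)\<close>,
  i.e. the \<open>k\<close>-th derivative along the line through \<open>x\<close> in direction
  \<open>u\<close>. Recursing on the gradient components lets each induction step pass to
  \<open>partial i f\<close>, which is in the smoothness class with one order less.\<close>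

primrec dir_deriv :: "nat \<Rightarrow> real^'m \<Rightarrow> (real^'m \<Rightarrow> real) \<Rightarrow> real^'m \<Rightarrow> real" where
  "dir_deriv 0 u f x = f x"
| "dir_deriv (Suc k) u f x = (\<Sum>i\<in>UNIV. u $ i * dir_deriv k u (partial i f) x)"

lemma dir_deriv_has_derivative:
  assumes "bounded_derivs_on (Suc k) M U f" "x + s *\<^sub>R u \<in> U"
  shows "((\<lambda>s. dir_deriv k u f (x + s *\<^sub>R u)) has_real_derivative
           dir_deriv (Suc k) u f (x + s *\<^sub>R u)) (at s)"
  using assms
proof (induction k arbitrary: f)
  case 0
  have "f differentiable (at (x + s *\<^sub>R u))"
    using bounded_derivs_onD(1)[OF 0(1), of "[]"] 0(2) by simp
  note D = has_derivative_partials[OF this]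
  have "((\<lambda>s. x + s *\<^sub>R u) has_derivative (\<lambda>h. h *\<^sub>R u)) (at s)"
    by (auto intro!: derivative_eq_intros)
  from has_derivative_compose[OF this D]
  show ?case
    by (simp add: has_field_derivative_def mult_ac mult_commute_abs flip: sum_distrib_left)
next
  case (Suc k)
  show ?case
    unfolding dir_deriv.simps(2)[of "Suc k"] dir_deriv.simps(2)[of k u f]
    by (intro DERIV_sum DERIV_cmult Suc.IH bounded_derivs_on_partial Suc.prems)
qed

lemma dir_deriv_bound:
  assumes "bounded_derivs_on k M U f" "x \<in> U" "k \<noteq> 0"
  shows "\<bar>dir_deriv k u f x\<bar> \<le> M * (\<Sum>i\<in>UNIV. \<bar>u $ i\<bar>) ^ k"
proof -
  define s where "s = (\<Sum>i\<in>UNIV. \<bar>u $ i\<bar>)"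
  \<comment> \<open>The induction is over iterated partials of \<open>f\<close>: at
    \<open>k = 0\<close> it needs a bound on the function itself, which
    \<open>bounded_derivs_on\<close> supplies only for proper derivatives, hence for nonempty
    \<open>js\<close>.\<close>
  have M: "\<bar>dir_deriv k u (partials js f) x\<bar> \<le> M * s ^ k"
    if "bounded_derivs_on (k + length js) M U f" "js \<noteq> [] \<or> k \<noteq> 0" for k js
    using that
  proof (induction k arbitrary: js)
    case 0
    then show ?case using bounded_derivs_onD(3)[OF 0(1), of js x] \<open>x \<in> U\<close> by simp
  next
    case (Suc k)
    have "\<bar>dir_deriv k u (partial i (partials js f)) x\<bar> \<le> M * s ^ k" for i
      using Suc.IH[of "i # js"] Suc.prems by simp
    then have "\<bar>u $ i * dir_deriv k u (partial i (partials js f)) x\<bar> \<le> \<bar>u $ i\<bar> * (M * s ^ k)" for i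
      by (simp add: abs_mult mult_left_mono)
    then have "\<bar>dir_deriv (Suc k) u (partials js f) x\<bar> \<le> (\<Sum>i\<in>UNIV. \<bar>u $ i\<bar> * (M * s ^ k))"
      unfolding dir_deriv.simps by (intro order.trans[OF sum_abs] sum_mono)
    also have "\<dots> = M * s ^ Suc k"
      by (simp add: s_def sum_distrib_left sum_distrib_right mult_ac)
    finally show ?case .
  qed
  show ?thesis
    using M[of k "[]"] assms by (simp add: s_def)
qed

lemma taylor_dir_deriv:
  assumes f: "bounded_derivs_on k M U f" and "convex U" "x \<in> U" "x + u \<in> U" "0 < k"
  obtains t where "0 < t" "t < 1" "x + t *\<^sub>R u \<in> U"
    "f (x + u) = (\<Sum>l<k. dir_deriv l u f x / fact l) + dir_deriv k u f (x + t *\<^sub>R u) / fact k"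
proof -
  have in_U: "x + t *\<^sub>R u \<in> U" if "0 \<le> t" "t \<le> 1" for t
    using convexD_alt[OF \<open>convex U\<close> \<open>x \<in> U\<close> \<open>x + u \<in> U\<close> that] by (simp add: algebra_simps)
  define diff where "diff l s = dir_deriv l u f (x + s *\<^sub>R u)" for l s
  have "DERIV (diff l) t :> diff (Suc l) t" if "l < k" "0 \<le> t" "t \<le> 1" for l t
    unfolding diff_def
    by (rule dir_deriv_has_derivative[OF bounded_derivs_on_mono[OF f _ order_refl]])
      (use that in_U in auto)
  then obtain t where t: "0 < t" "t < 1"
    "diff 0 1 = (\<Sum>l<k. diff l 0 / fact l * 1 ^ l) + diff k t / fact k * 1 ^ k"
    using Maclaurin[of 1 k diff "diff 0"] \<open>0 < k\<close> by auto
  show ?thesis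
    by (rule that[of t]) (use t in_U in \<open>auto simp: diff_def\<close>)
qed

lemma taylor_dir_deriv_bound:
  assumes f: "bounded_derivs_on k M U f" and "convex U" "x \<in> U" "x + u \<in> U" "0 < k"
  shows "\<bar>f (x + u) - (\<Sum>l<k. dir_deriv l u f x / fact l)\<bar> \<le> M * (\<Sum>i\<in>UNIV. \<bar>u $ i\<bar>) ^ k / fact k"
proof -
  obtain t where t: "x + t *\<^sub>R u \<in> U"
    "f (x + u) = (\<Sum>l<k. dir_deriv l u f x / fact l) + dir_deriv k u f (x + t *\<^sub>R u) / fact k"
    using taylor_dir_deriv[OF assms] .
  show ?thesis
    using dir_deriv_bound[OF f t(1), of u] \<open>0 < k\<close> t(2) by (simp add: divide_right_mono)
qed

lemma sum_abs_le_card_norm: "(\<Sum>i\<in>UNIV. \<bar>(u :: real^'m) $ i\<bar>) \<le> CARD('m) * norm u"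
  using sum_mono[of UNIV "\<lambda>i. \<bar>u $ i\<bar>" "\<lambda>_. norm u"] by (simp add: component_le_norm_cart)

section \<open>Symmetry of second partial derivatives\<close>

lemma partial_commute:
  fixes f :: "real^'m \<Rightarrow> real"
  assumes f: "bounded_derivs_on 2 M U f" and U: "open U" "x \<in> U"
  shows "partial i (partial j f) x = partial j (partial i f) x"
proof -
  obtain e where e: "e > 0" "ball x e \<subseteq> U"
    using U openE by blast
  have line: "((\<lambda>s. g (y + s *\<^sub>R axis k 1)) has_real_derivative partial k g (y + s *\<^sub>R axis k 1)) (at s)"
    if "bounded_derivs_on 1 M U g" "y + s *\<^sub>R axis k 1 \<in> U" for g y s and k :: 'm
    using dir_deriv_has_derivative[of 0 M U g y s "axis k 1"] that
    by (simp add: axis_def if_distrib[of "\<lambda>a. a * _"] cong: if_cong)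
  have f1: "bounded_derivs_on 1 M U f"
    using f by (rule bounded_derivs_on_mono) auto
  have f2: "bounded_derivs_on 1 M U (partial k f)" for k
    using f by (intro bounded_derivs_on_partial) (simp add: numeral_2_eq_2)
  \<comment> \<open>The second difference is \<open>h\<^sup>2\<close> times either mixed derivative at some nearby point.\<close>
  have ex: "\<exists>y. dist y x \<le> 2 * h \<and>
      f (x + h *\<^sub>R axis i 1 + h *\<^sub>R axis j 1) - f (x + h *\<^sub>R axis i 1) - f (x + h *\<^sub>R axis j 1) + f x
        = h\<^sup>2 * partial j (partial i f) y" if h: "0 < h" "2 * h < e" for h and i j :: 'm
  proof -
    have near: "dist (x + s *\<^sub>R axis i 1 + t *\<^sub>R axis j 1) x \<le> 2 * h"
      if "0 \<le> s" "s \<le> h" "0 \<le> t" "t \<le> h" for s t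
    proof -
      have "norm (s *\<^sub>R axis i 1 + t *\<^sub>R axis j (1::real)) \<le> s + t"
        using that by (intro order.trans[OF norm_triangle_ineq]) (simp add: norm_axis_1)
      then show ?thesis using that by (simp add: dist_norm algebra_simps)
    qed
    have inU: "x + s *\<^sub>R axis i 1 + t *\<^sub>R axis j 1 \<in> U"
      if "0 \<le> s" "s \<le> h" "0 \<le> t" "t \<le> h" for s t
      using near[OF that] h e(2) by (auto simp: dist_commute)
    define \<phi> where "\<phi> s = f (x + h *\<^sub>R axis j 1 + s *\<^sub>R axis i 1) - f (x + s *\<^sub>R axis i 1)" for s
    have "(\<phi> has_real_derivative partial i f (x + h *\<^sub>R axis j 1 + s *\<^sub>R axis i 1)
        - partial i f (x + s *\<^sub>R axis i 1)) (at s)" if "0 \<le> s" "s \<le> h" for s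
      unfolding \<phi>_def using inU[OF that, of h] inU[OF that, of 0] h
      by (intro DERIV_diff line f1) (simp_all add: algebra_simps)
    from MVT2[OF h(1) this] obtain s where s: "0 < s" "s < h"
      "\<phi> h - \<phi> 0 = h * (partial i f (x + h *\<^sub>R axis j 1 + s *\<^sub>R axis i 1) - partial i f (x + s *\<^sub>R axis i 1))"
      by auto
    have "((\<lambda>t. partial i f (x + s *\<^sub>R axis i 1 + t *\<^sub>R axis j 1)) has_real_derivative
        partial j (partial i f) (x + s *\<^sub>R axis i 1 + t *\<^sub>R axis j 1)) (at t)"
      if "0 \<le> t" "t \<le> h" for t
      by (intro line f2 inU) (use s that in auto)
    from MVT2[OF h(1) this] obtain t where t: "0 < t" "t < h"
      "partial i f (x + s *\<^sub>R axis i 1 + h *\<^sub>R axis j 1) - partial i f (x + s *\<^sub>R axis i 1)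
        = h * partial j (partial i f) (x + s *\<^sub>R axis i 1 + t *\<^sub>R axis j 1)"
      by auto
    have "\<phi> h - \<phi> 0 = h\<^sup>2 * partial j (partial i f) (x + s *\<^sub>R axis i 1 + t *\<^sub>R axis j 1)"
      using s(3) t(3) by (simp add: power2_eq_square add_ac)
    moreover have "\<phi> h - \<phi> 0 = f (x + h *\<^sub>R axis i 1 + h *\<^sub>R axis j 1) - f (x + h *\<^sub>R axis i 1)
        - f (x + h *\<^sub>R axis j 1) + f x"
      by (simp add: \<phi>_def add_ac)
    ultimately show ?thesis
      using near[of s t] s t by (intro exI[of _ "x + s *\<^sub>R axis i 1 + t *\<^sub>R axis j 1"]) auto
  qed
  define h where "h n = e / 4 * inverse (real (Suc n))" for n
  have h: "0 < h n" "2 * h n < e" for n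
  proof -
    have "inverse (real (Suc n)) \<le> 1"
      by (simp add: inverse_le_1_iff)
    then have "e / 4 * inverse (real (Suc n)) \<le> e / 4 * 1"
      using e by (intro mult_left_mono) auto
    then show "0 < h n" "2 * h n < e" using e(1) by (simp_all add: h_def)
  qed
  have "\<forall>n. \<exists>y. dist y x \<le> 2 * h n \<and>
      f (x + h n *\<^sub>R axis i 1 + h n *\<^sub>R axis j 1) - f (x + h n *\<^sub>R axis i 1) - f (x + h n *\<^sub>R axis j 1) + f x
        = (h n)\<^sup>2 * partial j (partial i f) y"
    using ex[OF h] by blast
  then obtain y where y: "\<And>n. dist (y n) x \<le> 2 * h n"
    "\<And>n. f (x + h n *\<^sub>R axis i 1 + h n *\<^sub>R axis j 1) - f (x + h n *\<^sub>R axis i 1) - f (x + h n *\<^sub>R axis j 1) + f x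
        = (h n)\<^sup>2 * partial j (partial i f) (y n)"
    by metis
  have "\<forall>n. \<exists>y. dist y x \<le> 2 * h n \<and>
      f (x + h n *\<^sub>R axis j 1 + h n *\<^sub>R axis i 1) - f (x + h n *\<^sub>R axis j 1) - f (x + h n *\<^sub>R axis i 1) + f x
        = (h n)\<^sup>2 * partial i (partial j f) y"
    using ex[OF h] by blast
  then obtain z where z: "\<And>n. dist (z n) x \<le> 2 * h n"
    "\<And>n. f (x + h n *\<^sub>R axis j 1 + h n *\<^sub>R axis i 1) - f (x + h n *\<^sub>R axis j 1) - f (x + h n *\<^sub>R axis i 1) + f x
        = (h n)\<^sup>2 * partial i (partial j f) (z n)"
    by metis
  \<comment> \<open>Both sides come from the same second difference. As \<open>h n\<close> tends to
    0, the points \<open>y n\<close> and \<open>z n\<close> are forced to \<open>x\<close>, where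
    continuity finishes the proof.\<close>
  have eq: "partial j (partial i f) (y n) = partial i (partial j f) (z n)" for n
  proof -
    have "(h n)\<^sup>2 * partial j (partial i f) (y n) = (h n)\<^sup>2 * partial i (partial j f) (z n)"
      using y(2)[of n] z(2)[of n]
      unfolding add.assoc add.commute[of "h n *\<^sub>R axis j 1" "h n *\<^sub>R axis i 1"] by linarith
    then show ?thesis using h[of n] by simp
  qed
  have "(\<lambda>n. 2 * h n) = (\<lambda>n. e / 2 * inverse (real (Suc n)))"
    by (simp add: h_def)
  moreover have "(\<lambda>n. e / 2 * inverse (real (Suc n))) \<longlonglongrightarrow> e / 2 * 0"
    by (intro tendsto_intros LIMSEQ_inverse_real_of_nat)
  ultimately have h0: "(\<lambda>n. 2 * h n) \<longlonglongrightarrow> 0"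
    by simp
  have lim: "w \<longlonglongrightarrow> x" if "\<And>n. dist (w n) x \<le> 2 * h n" for w
    unfolding tendsto_dist_iff[of w]
    by (rule tendsto_sandwich[OF _ _ tendsto_const h0]) (use that in auto)
  have cont: "(\<lambda>n. partial k (partial l f) (w n)) \<longlonglongrightarrow> partial k (partial l f) x" if "w \<longlonglongrightarrow> x" for w k l
  proof -
    have "continuous_on U (partial k (partial l f))"
      using bounded_derivs_onD(2)[OF f, of "[k, l]"] by simp
    then have "isCont (partial k (partial l f)) x"
      using U continuous_on_eq_continuous_at by blast
    then show ?thesis using that isCont_tendsto_compose by blast
  qed
  show ?thesis
    using cont[OF lim[OF y(1)], of j i] cont[OF lim[OF z(1)], of i j] LIMSEQ_unique eq by auto
qed

section \<open>Laplace's method in one variable\<close>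

text \<open>The density proportional to \<open>exp h\<close> on a compact interval around 0. There
  every continuous function has an expectation \<open>E\<close>, so the moment argument needs no
  integrability conditions; what lies outside is added back in \<open>laplace_mean\<close>.\<close>

locale log_density_interval =
  fixes h h' :: "real \<Rightarrow> real" and e :: real
  assumes e_pos: "0 < e"
    and h_deriv: "\<And>x. \<bar>x\<bar> \<le> e \<Longrightarrow> (h has_real_derivative h' x) (at x)"
    and h'_cont: "\<And>x. \<bar>x\<bar> \<le> e \<Longrightarrow> isCont h' x"
begin

abbreviation I :: "real set" where "I \<equiv> {-e..e}"

definition mass :: real where
  "mass = (LINT x:I|lborel. exp (h x))"

definition E :: "(real \<Rightarrow> real) \<Rightarrow> real" where
  "E f = (LINT x:I|lborel. f x * exp (h x)) / mass"

lemma cont_h: "continuous_on I h"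
  using h_deriv by (intro DERIV_atLeastAtMost_imp_continuous_on) (metis abs_le_iff minus_le_iff)

lemma cont_h': "continuous_on I h'"
  using h'_cont by (intro continuous_at_imp_continuous_on) (auto simp: abs_le_iff)

lemma integrable: "continuous_on I f \<Longrightarrow> set_integrable lborel I (\<lambda>x. f x * exp (h x))"
  using cont_h by (intro borel_integrable_atLeastAtMost' continuous_intros)

text \<open>Applied twice: \<open>d = e\<close> shows that the mass is positive, and
  \<open>d = e / n\<close> bounds it from below by a multiple of \<open>exp (h 0) / n\<close>,
  against which the tails are negligible.\<close>

lemma mass_lower: "0 \<le> d \<Longrightarrow> d \<le> e \<Longrightarrow> (\<And>x. 0 \<le> x \<Longrightarrow> x \<le> d \<Longrightarrow> c \<le> exp (h x)) \<Longrightarrow> c * d \<le> mass"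
proof -
  assume d: "0 \<le> d" "d \<le> e" and c: "\<And>x. 0 \<le> x \<Longrightarrow> x \<le> d \<Longrightarrow> c \<le> exp (h x)"
  have int: "set_integrable lborel I (\<lambda>x. exp (h x))"
    using integrable[of "\<lambda>_. 1"] by simp
  have "c * d = (LINT x:{0..d}|lborel. c)"
    using d by (simp add: set_integral_const)
  also have "\<dots> \<le> (LINT x:{0..d}|lborel. exp (h x))"
    using d c by (intro set_integral_mono set_integrable_subset[OF int])
      (auto simp: set_integrable_def)
  also have "\<dots> \<le> mass"
    unfolding mass_def set_lebesgue_integral_def
    using d int set_integrable_subset[OF int, of "{0..d}"]
    by (intro integral_mono) (auto simp: set_integrable_def indicator_def)
  finally show ?thesis .
qed

lemma mass_pos: "0 < mass"
proof -
  obtain x0 where x0: "x0 \<in> I" "\<And>x. x \<in> I \<Longrightarrow> h x0 \<le> h x"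
    using continuous_attains_inf[OF compact_Icc _ cont_h] e_pos by auto
  have "exp (h x0) * e \<le> mass"
    by (rule mass_lower) (use e_pos x0 in auto)
  moreover have "0 < exp (h x0) * e" using e_pos by simp
  ultimately show ?thesis by linarith
qed

lemma E_add: "continuous_on I f \<Longrightarrow> continuous_on I g \<Longrightarrow> E (\<lambda>x. f x + g x) = E f + E g"
  unfolding E_def using integrable by (simp add: distrib_right set_integral_add add_divide_distrib)

lemma E_cmult: "E (\<lambda>x. c * f x) = c * E f"
  unfolding E_def by (simp add: mult.assoc)

lemma E_const: "E (\<lambda>x. c) = c"
  unfolding E_def using mass_pos by (simp add: mass_def)

lemma E_affine: "continuous_on I f \<Longrightarrow> E (\<lambda>x. c * f x + d) = c * E f + d"
  using E_add[of "\<lambda>x. c * f x" "\<lambda>_. d"] by (simp only: E_cmult E_const continuous_intros)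

lemma E_lin: "continuous_on I f \<Longrightarrow> continuous_on I g \<Longrightarrow> E (\<lambda>x. c * f x + d * g x) = c * E f + d * E g"
  using E_add[of "\<lambda>x. c * f x" "\<lambda>x. d * g x"] by (simp only: E_cmult continuous_intros)

lemma E_mono: "continuous_on I f \<Longrightarrow> continuous_on I g \<Longrightarrow> (\<And>x. \<bar>x\<bar> \<le> e \<Longrightarrow> f x \<le> g x) \<Longrightarrow> E f \<le> E g"
  unfolding E_def using integrable mass_pos
  by (intro divide_right_mono set_integral_mono mult_right_mono) (auto simp: abs_le_iff)

lemma E_abs_diff:
  assumes "continuous_on I f" "continuous_on I g" "continuous_on I k"
    "\<And>x. \<bar>x\<bar> \<le> e \<Longrightarrow> \<bar>f x - g x\<bar> \<le> k x"
  shows "\<bar>E f - E g\<bar> \<le> E k"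
proof -
  have "E f \<le> E (\<lambda>x. g x + k x)" "E g \<le> E (\<lambda>x. f x + k x)"
    by (rule E_mono; use assms in \<open>force intro!: continuous_intros simp: abs_le_iff\<close>)+
  then show ?thesis using assms by (simp add: E_add abs_le_iff)
qed

text \<open>Stein's identity for \<open>exp h\<close>, from the fundamental theorem of calculus
  applied to \<open>f * exp h\<close>; truncation leaves the endpoint term.\<close>

lemma E_by_parts:
  assumes "\<And>x. \<bar>x\<bar> \<le> e \<Longrightarrow> (f has_real_derivative f' x) (at x)" "continuous_on I f'"
  shows "E (\<lambda>x. f x * h' x) = (f e * exp (h e) - f (-e) * exp (h (-e))) / mass - E f'"
proof -
  have cf: "continuous_on I f"
    using assms(1) by (intro DERIV_atLeastAtMost_imp_continuous_on) (metis abs_le_iff minus_le_iff)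
  have "(LINT x:I|lborel. (f' x + f x * h' x) * exp (h x)) = f e * exp (h e) - f (-e) * exp (h (-e))"
    unfolding set_lebesgue_integral_def
  proof (rule integral_FTC_Icc)
    fix x assume "- e \<le> x" "x \<le> e"
    then have "((\<lambda>x. f x * exp (h x)) has_real_derivative (f' x + f x * h' x) * exp (h x)) (at x within I)"
      using assms(1)[of x] h_deriv[of x]
      by (auto intro!: derivative_eq_intros simp: abs_le_iff algebra_simps intro: has_field_derivative_at_within)
    then show "((\<lambda>x. f x * exp (h x)) has_vector_derivative (f' x + f x * h' x) * exp (h x)) (at x within I)"
      by (simp add: has_real_derivative_iff_has_vector_derivative)
  qed (use e_pos in \<open>auto intro!: continuous_intros assms cf cont_h cont_h'\<close>)
  then have "E (\<lambda>x. f' x + f x * h' x) = (f e * exp (h e) - f (-e) * exp (h (-e))) / mass"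
    unfolding E_def by simp
  then show ?thesis
    using E_add[of f' "\<lambda>x. f x * h' x"] assms cf cont_h' by (simp add: continuous_intros)
qed

lemma young: "0 < s \<Longrightarrow> K * \<bar>x\<bar> \<le> s * x\<^sup>2 + K\<^sup>2 / (4 * s)" for K x s :: real
proof -
  assume "0 < s"
  have "0 \<le> (2 * s * \<bar>x\<bar> - K)\<^sup>2" by simp
  then have "K * \<bar>x\<bar> * (4 * s) \<le> (s * x\<^sup>2 + K\<^sup>2 / (4 * s)) * (4 * s)"
    using \<open>0 < s\<close> by (simp add: power2_eq_square algebra_simps)
  then show ?thesis using \<open>0 < s\<close> by (subst (asm) mult_le_cancel_right) auto
qed

section \<open>Stein relations between the moments\<close>

definition m :: "nat \<Rightarrow> real" where "m k = E (\<lambda>x. x ^ k)"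

lemma m_0: "m 0 = 1"
  by (simp add: m_def E_const)

definition bdry :: real where "bdry = (exp (h e) + exp (h (-e))) / mass"

lemma bdry_nonneg: "0 \<le> bdry"
  using mass_pos by (simp add: bdry_def)

lemma m_stein:
  "E (\<lambda>x. x ^ k * h' x) = (e ^ k * exp (h e) - (-e) ^ k * exp (h (-e))) / mass - real k * m (k - 1)"
proof -
  have "((\<lambda>x. x ^ k) has_real_derivative real k * x ^ (k - 1)) (at x)" for x :: real
    using DERIV_pow[of k x UNIV] by simp
  from E_by_parts[OF this] show ?thesis
    by (simp add: m_def E_cmult continuous_on_mult_left continuous_on_power continuous_on_id)
qed

text \<open>For odd \<open>k\<close> the two endpoint contributions have the same sign. The endpoint
  term is then nonnegative and on the favourable side of the estimates: it is dropped for
  \<open>k = 1\<close>, and for \<open>k = 3\<close> it is itself bounded.\<close>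

lemma m_stein_odd: "odd k \<Longrightarrow> E (\<lambda>x. x ^ k * h' x) = e ^ k * bdry - real k * m (k - 1)"
  by (simp add: m_stein bdry_def distrib_left)

lemma m_stein_abs:
  assumes "e \<le> 1"
  shows "\<bar>E (\<lambda>x. x ^ k * h' x) + real k * m (k - 1)\<bar> \<le> bdry"
proof -
  have "\<bar>e ^ k * exp (h e) - (-e) ^ k * exp (h (-e))\<bar> \<le> exp (h e) + exp (h (-e))"
  proof (rule order.trans[OF abs_triangle_ineq4], rule add_mono)
    have "e ^ k \<le> 1" using e_pos assms by (simp add: power_le_one)
    then show "\<bar>e ^ k * exp (h e)\<bar> \<le> exp (h e)" "\<bar>(- e) ^ k * exp (h (- e))\<bar> \<le> exp (h (- e))"
      using e_pos by (simp_all add: abs_mult power_abs)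
  qed
  then show ?thesis
    using mass_pos by (simp add: m_stein bdry_def divide_right_mono abs_divide)
qed

section \<open>Moment bounds for a nearly quadratic log-density\<close>

context
  fixes N \<kappa> K a b p q :: real
  assumes pos: "0 < \<kappa>" "0 \<le> K" "1 \<le> N" and e_le: "e \<le> 1" "6 * K * e \<le> \<kappa>"
    and a: "\<kappa> * N \<le> a" and b: "\<bar>b\<bar> \<le> K" and p: "\<bar>p\<bar> \<le> K * N" and q: "\<bar>q\<bar> \<le> K * N"
    and h': "\<And>x. \<bar>x\<bar> \<le> e \<Longrightarrow> \<bar>h' x - (- a * x + b + p * x\<^sup>2 + q * x ^ 3)\<bar> \<le> K * N * x ^ 4"
begin

text \<open>Bounds on \<open>N * m 2\<close>, \<open>N\<^sup>2 * m 4\<close> and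
  \<open>N * bdry\<close>, as the Stein relations for \<open>k = 1\<close> and \<open>k = 3\<close>
  yield them once the linear part of \<open>drift\<close> is absorbed. The rate \<open>1 / N\<close>
  for the endpoint term suffices because the final relations are divided by \<open>a\<close>, which
  is at least \<open>\<kappa> * N\<close>.\<close>

definition "C2 = 4 * (1 + K\<^sup>2 / \<kappa>) / \<kappa>"
definition "C4 = 4 * (3 + K\<^sup>2 / \<kappa>) * C2 / \<kappa>"
definition "CB = (3 + K\<^sup>2 / \<kappa>) * C2 / e ^ 3"

text \<open>The cubic term, the quartic term and the remainder of \<open>x * h' x\<close> are each
  at most \<open>K * N * e * x\<^sup>2\<close> on the interval. By
  \<open>6 * K * e \<le> \<kappa>\<close> the three together use up at most half of the
  curvature.\<close>

lemma drift: "\<bar>x\<bar> \<le> e \<Longrightarrow> x * h' x \<le> - (\<kappa> / 2 * N) * x\<^sup>2 + K * \<bar>x\<bar>"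
proof -
  assume x: "\<bar>x\<bar> \<le> e"
  have KN: "0 \<le> K * N" using pos by simp
  have le1: "\<bar>x\<bar> \<le> 1" using x e_le by simp
  have "x * h' x \<le> x * (- a * x + b + p * x\<^sup>2 + q * x ^ 3) + \<bar>x\<bar> * (K * N * x ^ 4)"
  proof -
    have "x * (h' x - (- a * x + b + p * x\<^sup>2 + q * x ^ 3)) \<le> \<bar>x\<bar> * (K * N * x ^ 4)"
      using h'[OF x] by - (rule abs_le_D1, simp add: abs_mult mult_left_mono)
    then show ?thesis by (simp add: algebra_simps)
  qed
  also have "x * (- a * x + b + p * x\<^sup>2 + q * x ^ 3) = - (a * x\<^sup>2) + b * x + p * x ^ 3 + q * x ^ 4"
    by (simp add: algebra_simps power2_eq_square power3_eq_cube power4_eq_xxxx)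
  also have "\<dots> + \<bar>x\<bar> * (K * N * x ^ 4) \<le> - (\<kappa> * N * x\<^sup>2) + K * \<bar>x\<bar> + K * N * e * x\<^sup>2 + K * N * e * x\<^sup>2 + K * N * e * x\<^sup>2"
  proof (intro add_mono)
    show "- (a * x\<^sup>2) \<le> - (\<kappa> * N * x\<^sup>2)"
      using a by (simp add: mult_right_mono)
    show "b * x \<le> K * \<bar>x\<bar>"
      using b by - (rule abs_le_D1, simp add: abs_mult mult_right_mono)
    have "\<bar>p\<bar> * (\<bar>x\<bar> * x\<^sup>2) \<le> (K * N) * (e * x\<^sup>2)"
      using p x KN by (intro mult_mono) auto
    then show "p * x ^ 3 \<le> K * N * e * x\<^sup>2"
      by - (rule abs_le_D1, simp add: abs_mult power2_eq_square power3_eq_cube mult_ac)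
    have s: "x\<^sup>2 \<le> e"
      using mult_mono[OF x le1] e_pos by (simp add: power2_eq_square)
    have "\<bar>q\<bar> * (x\<^sup>2 * x\<^sup>2) \<le> (K * N) * (e * x\<^sup>2)"
      using q s KN e_pos by (intro mult_mono) auto
    then show "q * x ^ 4 \<le> K * N * e * x\<^sup>2"
      by - (rule abs_le_D1, simp add: abs_mult power2_eq_square power4_eq_xxxx mult_ac)
    have "\<bar>x\<bar> * (x\<^sup>2 * x\<^sup>2) \<le> 1 * (e * x\<^sup>2)"
      using s le1 e_pos by (intro mult_mono) auto
    then have "(K * N) * (\<bar>x\<bar> * (x\<^sup>2 * x\<^sup>2)) \<le> (K * N) * (1 * (e * x\<^sup>2))"
      using KN by (rule mult_left_mono)
    then show "\<bar>x\<bar> * (K * N * x ^ 4) \<le> K * N * e * x\<^sup>2"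
      by (simp add: power2_eq_square power4_eq_xxxx mult_ac)
  qed
  also have "\<dots> \<le> - (\<kappa> / 2 * N) * x\<^sup>2 + K * \<bar>x\<bar>"
  proof -
    have "(6 * K * e) * (N * x\<^sup>2) \<le> \<kappa> * (N * x\<^sup>2)"
      using e_le pos by (intro mult_right_mono) auto
    then show ?thesis by (simp add: algebra_simps)
  qed
  finally show ?thesis .
qed

lemma m_nonneg: "even k \<Longrightarrow> 0 \<le> m k"
  using E_mono[of "\<lambda>x. 0" "\<lambda>x. x ^ k"]
  by (simp add: m_def E_const continuous_on_power continuous_on_id zero_le_even_power)

lemma K2: "K\<^sup>2 / (\<kappa> * N) \<le> K\<^sup>2 / \<kappa>"
  using pos by (intro divide_left_mono) auto

text \<open>The relation for \<open>k = 1\<close> reads \<open>E (x * h' x) = e * bdry - 1\<close>.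
  By \<open>young\<close>, half of the curvature left in \<open>drift\<close> absorbs its linear
  term, and \<open>\<kappa> / 4\<close> remains.\<close>

lemma m2_le: "m 2 \<le> C2 / N"
proof -
  have "E (\<lambda>x. x ^ 1 * h' x) \<le> E (\<lambda>x. (- (\<kappa> / 4 * N)) * x\<^sup>2 + K\<^sup>2 / (\<kappa> * N))"
  proof (rule E_mono)
    fix x :: real assume x: "\<bar>x\<bar> \<le> e"
    show "x ^ 1 * h' x \<le> (- (\<kappa> / 4 * N)) * x\<^sup>2 + K\<^sup>2 / (\<kappa> * N)"
      using drift[OF x] young[of "\<kappa> / 4 * N" K x] pos by (simp add: algebra_simps)
  qed (intro continuous_intros cont_h')+
  also have "\<dots> = - (\<kappa> / 4 * N) * m 2 + K\<^sup>2 / (\<kappa> * N)"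
    unfolding m_def by (intro E_affine continuous_intros)
  finally have le: "E (\<lambda>x. x ^ 1 * h' x) \<le> - (\<kappa> / 4 * N) * m 2 + K\<^sup>2 / (\<kappa> * N)" .
  have eq: "E (\<lambda>x. x ^ 1 * h' x) = e * bdry - 1"
    using m_stein_odd[of 1] m_0 by simp
  have "\<kappa> / 4 * N * m 2 \<le> 1 - e * bdry + K\<^sup>2 / (\<kappa> * N)"
  proof -
    have "c * y \<le> 1 - z + r" if "z - 1 \<le> - c * y + r" for c y z r :: real
      using that by simp
    from this[OF le[unfolded eq]] show ?thesis .
  qed
  also have "\<dots> \<le> 1 + K\<^sup>2 / \<kappa>"
    using K2 mult_nonneg_nonneg[OF less_imp_le[OF e_pos] bdry_nonneg] by linarith
  finally show ?thesis
    unfolding C2_def using pos by (simp add: field_simps)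
qed

text \<open>The same pointwise bound times \<open>x\<^sup>2\<close>, used with \<open>k = 3\<close>.
  Both summands on the left are nonnegative, so this single inequality controls the fourth moment
  and the endpoint term.\<close>

lemma m4_bdry: "e ^ 3 * bdry + \<kappa> / 4 * N * m 4 \<le> (3 + K\<^sup>2 / \<kappa>) * C2 / N"
proof -
  have "E (\<lambda>x. x ^ 3 * h' x) \<le> E (\<lambda>x. (- (\<kappa> / 4 * N)) * x ^ 4 + K\<^sup>2 / (\<kappa> * N) * x\<^sup>2)"
  proof (rule E_mono)
    fix x :: real assume x: "\<bar>x\<bar> \<le> e"
    have "x * h' x \<le> (- (\<kappa> / 4 * N)) * x\<^sup>2 + K\<^sup>2 / (\<kappa> * N)"
      using drift[OF x] young[of "\<kappa> / 4 * N" K x] pos by (simp add: algebra_simps)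
    then have "x\<^sup>2 * (x * h' x) \<le> x\<^sup>2 * ((- (\<kappa> / 4 * N)) * x\<^sup>2 + K\<^sup>2 / (\<kappa> * N))"
      by (rule mult_left_mono) simp
    then show "x ^ 3 * h' x \<le> (- (\<kappa> / 4 * N)) * x ^ 4 + K\<^sup>2 / (\<kappa> * N) * x\<^sup>2"
      by (simp add: algebra_simps power2_eq_square power3_eq_cube power4_eq_xxxx)
  qed (intro continuous_intros cont_h')+
  also have "\<dots> = - (\<kappa> / 4 * N) * m 4 + K\<^sup>2 / (\<kappa> * N) * m 2"
    unfolding m_def by (intro E_lin continuous_intros)
  finally have "e ^ 3 * bdry + \<kappa> / 4 * N * m 4 \<le> (3 + K\<^sup>2 / (\<kappa> * N)) * m 2"
    using m_stein_odd[of 3] by (simp add: distrib_right)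
  also have "\<dots> \<le> (3 + K\<^sup>2 / \<kappa>) * (C2 / N)"
    using K2 m2_le m_nonneg[of 2] pos by (intro mult_mono) auto
  finally show ?thesis by simp
qed

lemma m4_le: "m 4 \<le> C4 / N\<^sup>2"
proof -
  have "\<kappa> / 4 * N * m 4 \<le> (3 + K\<^sup>2 / \<kappa>) * C2 / N"
    using m4_bdry bdry_nonneg e_pos by (smt (verit) mult_nonneg_nonneg zero_le_power)
  then show ?thesis unfolding C4_def using pos by (simp add: field_simps power2_eq_square)
qed

lemma bdry_le: "bdry \<le> CB / N"
proof -
  have "0 \<le> \<kappa> / 4 * N * m 4" using pos m_nonneg[of 4] by simp
  then have "e ^ 3 * bdry \<le> (3 + K\<^sup>2 / \<kappa>) * C2 / N" using m4_bdry by linarith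
  then show ?thesis unfolding CB_def using e_pos pos by (simp add: field_simps)
qed

lemma m3_crude: "\<bar>m 3\<bar> \<le> m 2"
proof -
  have "\<bar>m 3 - E (\<lambda>x. 0)\<bar> \<le> m 2"
  unfolding m_def
  proof (rule E_abs_diff)
    fix x :: real assume "\<bar>x\<bar> \<le> e"
    then have "\<bar>x\<bar> * x\<^sup>2 \<le> 1 * x\<^sup>2" using e_le by (intro mult_right_mono) auto
    then show "\<bar>x ^ 3 - 0\<bar> \<le> x\<^sup>2" by (simp add: abs_mult power2_eq_square power3_eq_cube)
  qed (intro continuous_intros)+
  then show ?thesis by (simp add: E_const)
qed

lemma m5_crude: "\<bar>m 5\<bar> \<le> m 4"
proof -
  have "\<bar>m 5 - E (\<lambda>x. 0)\<bar> \<le> m 4"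
  unfolding m_def
  proof (rule E_abs_diff)
    fix x :: real assume "\<bar>x\<bar> \<le> e"
    then have "\<bar>x\<bar> * x ^ 4 \<le> 1 * x ^ 4" using e_le by (intro mult_right_mono) auto
    moreover have "x ^ 5 = x * x ^ 4" by (simp add: eval_nat_numeral)
    ultimately show "\<bar>x ^ 5 - 0\<bar> \<le> x ^ 4" by (simp add: abs_mult)
  qed (intro continuous_intros)+
  then show ?thesis by (simp add: E_const)
qed

text \<open>The expansion of \<open>h'\<close> is inserted into the Stein relation. As
  \<open>\<bar>x\<bar> \<le> 1\<close>, the remainder costs at most \<open>K * N * m 4\<close> for
  every \<open>k\<close>, which is \<open>O(1 / N)\<close> like the endpoint term. At
  \<open>k = 0\<close> the truncated \<open>k - 1\<close> is harmless, since its factor is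
  0.\<close>

lemma moment_expansion:
  "\<bar>(- a * m (k + 1) + b * m k + p * m (k + 2) + q * m (k + 3)) + real k * m (k - 1)\<bar> \<le> K * N * m 4 + bdry"
proof -
  have "E (\<lambda>x. - a * x ^ (k + 1) + b * x ^ k + p * x ^ (k + 2) + q * x ^ (k + 3))
      = - a * m (k + 1) + b * m k + p * m (k + 2) + q * m (k + 3)"
    unfolding m_def by ((subst E_add | (intro continuous_intros; fail))+, simp only: E_cmult)
  moreover have "\<bar>E (\<lambda>x. x ^ k * h' x) - E (\<lambda>x. - a * x ^ (k + 1) + b * x ^ k + p * x ^ (k + 2) + q * x ^ (k + 3))\<bar>
      \<le> E (\<lambda>x. K * N * x ^ 4)"
  proof (rule E_abs_diff)
    fix x :: real assume x: "\<bar>x\<bar> \<le> e"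
    have "x ^ k * h' x - (- a * x ^ (k + 1) + b * x ^ k + p * x ^ (k + 2) + q * x ^ (k + 3))
        = x ^ k * (h' x - (- a * x + b + p * x\<^sup>2 + q * x ^ 3))"
      by (simp add: algebra_simps power_add power2_eq_square)
    moreover have "\<bar>x\<bar> ^ k * \<bar>h' x - (- a * x + b + p * x\<^sup>2 + q * x ^ 3)\<bar> \<le> 1 * (K * N * x ^ 4)"
      using x e_le h'[OF x] by (intro mult_mono power_le_one) auto
    ultimately show "\<bar>x ^ k * h' x - (- a * x ^ (k + 1) + b * x ^ k + p * x ^ (k + 2) + q * x ^ (k + 3))\<bar>
        \<le> K * N * x ^ 4"
      by (simp add: abs_mult power_abs)
  qed (intro continuous_intros cont_h')+
  ultimately show ?thesis
    using m_stein_abs[OF e_le(1), of k] E_cmult[of "K * N" "\<lambda>x. x ^ 4"]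
    by (simp add: abs_le_iff m_def[of 4])
qed

lemma moment_expansions:
  "\<bar>- a * m 1 + b + p * m 2 + q * m 3\<bar> \<le> K * N * m 4 + bdry"
  "\<bar>- a * m 2 + b * m 1 + p * m 3 + q * m 4 + 1\<bar> \<le> K * N * m 4 + bdry"
  "\<bar>- a * m 3 + b * m 2 + p * m 4 + q * m 5 + 2 * m 1\<bar> \<le> K * N * m 4 + bdry"
  using moment_expansion[of 0] moment_expansion[of 1] moment_expansion[of 2]
  by (simp_all add: m_0 numeral_eq_Suc)

text \<open>Constants of a bootstrap whose order matters: \<open>m 1 = O(1 / N)\<close> follows from
  \<open>k = 0\<close> with the crude bound on \<open>m 3\<close>; then \<open>k = 2\<close>
  improves \<open>m 3\<close> to \<open>O(1 / N\<^sup>2)\<close>, \<open>k = 1\<close> gives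
  \<open>m 2 = 1 / a + O(1 / N\<^sup>2)\<close>, and a second use of \<open>k = 0\<close> gives the
  mean with error \<open>A0 / N\<^sup>2\<close>.\<close>

definition "A1 = (K + 2 * K * C2 + K * C4 + CB) / \<kappa>"
definition "A3 = (2 * A1 + K * C2 + 3 * K * C4 + CB) / \<kappa>"
definition "A2 = (K * A1 + K * A3 + 2 * K * C4 + CB) / \<kappa>"
definition "A0 = (K * A2 + K * A3 + K * C4 + CB) / \<kappa>"

lemma divide_a: "\<bar>a * t\<bar> \<le> c \<Longrightarrow> \<bar>t\<bar> \<le> c / \<kappa> / N"
proof -
  assume c: "\<bar>a * t\<bar> \<le> c"
  have "\<kappa> * N * \<bar>t\<bar> \<le> a * \<bar>t\<bar>" using a by (intro mult_right_mono) auto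
  also have "\<dots> \<le> c" using c abs_ge_self[of a] by (simp add: abs_mult) (smt (verit) abs_ge_zero mult_right_mono)
  finally show ?thesis using pos by (simp add: field_simps)
qed

lemma C_nonneg: "0 \<le> C2" "0 \<le> C4" "0 \<le> CB"
  using pos e_pos by (auto simp: C2_def C4_def CB_def)

lemma divide_N_le: "0 \<le> c \<Longrightarrow> c / N \<le> c"
  using pos mult_left_mono[of 1 N c] by (simp add: field_simps)

lemma times_KN: "\<bar>c\<bar> \<le> K * N \<Longrightarrow> \<bar>t\<bar> \<le> d / N \<Longrightarrow> \<bar>c * t\<bar> \<le> K * d"
  "\<bar>c\<bar> \<le> K * N \<Longrightarrow> \<bar>t\<bar> \<le> d / N\<^sup>2 \<Longrightarrow> \<bar>c * t\<bar> \<le> K * d / N"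
  "\<bar>c\<bar> \<le> K \<Longrightarrow> \<bar>t\<bar> \<le> d / N \<Longrightarrow> \<bar>c * t\<bar> \<le> K * d / N"
  using pos mult_mono[of "\<bar>c\<bar>" "K * N" "\<bar>t\<bar>" "d / N"] mult_mono[of "\<bar>c\<bar>" "K * N" "\<bar>t\<bar>" "d / N\<^sup>2"]
    mult_mono[of "\<bar>c\<bar>" "K" "\<bar>t\<bar>" "d / N"]
  by (auto simp: abs_mult power2_eq_square)

lemma KNm4: "K * N * m 4 \<le> K * C4 / N" "\<bar>m 4\<bar> \<le> C4 / N\<^sup>2"  "\<bar>m 2\<bar> \<le> C2 / N" "\<bar>m 5\<bar> \<le> C4 / N\<^sup>2"
  "\<bar>m 3\<bar> \<le> C2 / N"
proof -
  show m4: "\<bar>m 4\<bar> \<le> C4 / N\<^sup>2" "\<bar>m 2\<bar> \<le> C2 / N" "\<bar>m 5\<bar> \<le> C4 / N\<^sup>2" "\<bar>m 3\<bar> \<le> C2 / N"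
    using m4_le m2_le m_nonneg[of 4] m_nonneg[of 2] m5_crude m3_crude by auto
  show "K * N * m 4 \<le> K * C4 / N"
    using times_KN(2)[of "K * N" "m 4" C4] m4 pos by (auto simp: abs_le_iff)
qed

lemma m1_le: "\<bar>m 1\<bar> \<le> A1 / N"
proof -
  have "\<bar>a * m 1\<bar> \<le> K + K * C2 + K * C2 + K * C4 + CB"
    using moment_expansions(1) b times_KN(1)[OF p KNm4(3)] times_KN(1)[OF q KNm4(5)] KNm4(1)
      bdry_le divide_N_le[OF C_nonneg(3)] divide_N_le[OF mult_nonneg_nonneg[OF pos(2) C_nonneg(2)]]
    by linarith
  from divide_a[OF this] show ?thesis by (simp add: A1_def algebra_simps)
qed

lemma m3_le: "\<bar>m 3\<bar> \<le> A3 / N\<^sup>2"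
proof -
  have "\<bar>a * m 3\<bar> \<le> 2 * (A1 / N) + K * C2 / N + K * C4 / N + K * C4 / N + K * C4 / N + CB / N"
    using moment_expansions(3) m1_le times_KN(3)[OF b KNm4(3)] times_KN(2)[OF p KNm4(2)]
      times_KN(2)[OF q KNm4(4)] KNm4(1) bdry_le
    by linarith
  from divide_a[OF this] show ?thesis
    using pos by (simp add: A3_def field_simps power2_eq_square)
qed

lemma m2_expansion: "\<bar>m 2 - 1 / a\<bar> \<le> A2 / N\<^sup>2"
proof -
  have a0: "a \<noteq> 0" using a pos by (smt (verit) mult_pos_pos)
  have "a * (m 2 - 1 / a) = a * m 2 - 1" using a0 by (simp add: field_simps)
  moreover have "\<bar>a * m 2 - 1\<bar> \<le> K * A1 / N + K * A3 / N + K * C4 / N + K * C4 / N + CB / N"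
    using moment_expansions(2) times_KN(3)[OF b m1_le] times_KN(2)[OF p m3_le]
      times_KN(2)[OF q KNm4(2)] KNm4(1) bdry_le
    by linarith
  ultimately have "\<bar>a * (m 2 - 1 / a)\<bar> \<le> K * A1 / N + K * A3 / N + K * C4 / N + K * C4 / N + CB / N"
    by simp
  from divide_a[OF this] show ?thesis
    using pos by (simp add: A2_def field_simps power2_eq_square)
qed

lemma mean_expansion: "\<bar>m 1 - (b / a + p / a\<^sup>2)\<bar> \<le> A0 / N\<^sup>2"
proof -
  have a0: "a \<noteq> 0" using a pos by (smt (verit) mult_pos_pos)
  have eq: "a * (m 1 - (b / a + p / a\<^sup>2)) = (a * m 1 - b - p * m 2) + p * (m 2 - 1 / a)"
    using a0 by (simp add: field_simps power2_eq_square)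
  have "\<bar>a * m 1 - b - p * m 2\<bar> \<le> K * A3 / N + K * C4 / N + CB / N"
    using moment_expansions(1) times_KN(2)[OF q m3_le] KNm4(1) bdry_le
    by linarith
  then have "\<bar>a * (m 1 - (b / a + p / a\<^sup>2))\<bar> \<le> K * A2 / N + K * A3 / N + K * C4 / N + CB / N"
    unfolding eq using times_KN(2)[OF p m2_expansion] by linarith
  from divide_a[OF this] show ?thesis
    using pos by (simp add: A0_def field_simps power2_eq_square)
qed

end

end

section \<open>Expansion of a one-dimensional mean\<close>

lemma exp_minus_le_power: "0 < x \<Longrightarrow> exp (- x) \<le> fact k / x ^ k" for x :: real
proof -
  assume x: "0 < x"
  have "(\<Sum>n\<in>{k}. x ^ n /\<^sub>R fact n) \<le> (\<Sum>n. x ^ n /\<^sub>R fact n)"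
    using x by (intro sum_le_suminf summable_exp_generic) auto
  then have "x ^ k / fact k \<le> exp x"
    by (simp add: exp_def divide_inverse mult.commute)
  then show ?thesis
    using x by (simp add: exp_minus field_simps)
qed

text \<open>The truncated mean has this expansion by \<open>mean_expansion\<close>. Removing the
  truncation changes numerator and denominator by exponentially small multiples of
  \<open>exp (h n 0)\<close>, while the truncated mass is at least of order
  \<open>exp (h n 0) / n\<close>.\<close>

lemma laplace_mean:
  fixes h h' :: "nat \<Rightarrow> real \<Rightarrow> real" and a b p q :: "nat \<Rightarrow> real" and e0 \<kappa> K :: real
  assumes "0 < e0" "0 < \<kappa>" "0 \<le> K"
    and expansion: "\<forall>\<^sub>F n in sequentially. \<forall>x. \<bar>x\<bar> \<le> e0 \<longrightarrow>
        (h n has_real_derivative h' n x) (at x) \<and> isCont (h' n) x \<and>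
        \<bar>h' n x - (- a n * x + b n + p n * x\<^sup>2 + q n * x ^ 3)\<bar> \<le> K * n * x ^ 4"
    and coeffs: "\<forall>\<^sub>F n in sequentially. \<kappa> * n \<le> a n \<and> \<bar>a n\<bar> \<le> K * n \<and> \<bar>b n\<bar> \<le> K \<and>
        \<bar>p n\<bar> \<le> K * n \<and> \<bar>q n\<bar> \<le> K * n"
    and meas: "\<forall>\<^sub>F n in sequentially. h n \<in> borel_measurable borel"
    and tails: "\<forall>k\<in>{0, 1}. tail_decay_cond (\<lambda>n x. x ^ k) (\<lambda>n x. exp (h n x)) (\<lambda>n. 0)"
  shows "(\<lambda>n. (\<integral>x. x * exp (h n x) \<partial>lborel) / (\<integral>x. exp (h n x) \<partial>lborel)
      - (b n / a n + p n / (a n)\<^sup>2)) \<in> O(\<lambda>n. 1 / real n ^ 2)"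
proof -
  \<comment> \<open>The radius has to serve \<open>mean_expansion\<close>: it lies in the region of
    the expansion, is at most 1 and satisfies \<open>6 * K * e \<le> \<kappa>\<close>. The
    \<open>+ 1\<close> keeps the denominator positive when \<open>K = 0\<close>.\<close>
  define e where "e = min e0 (min 1 (\<kappa> / (6 * K + 1)))"
  have e: "0 < e" "e \<le> e0" "e \<le> 1" "6 * K * e \<le> \<kappa>"
  proof -
    show "0 < e" "e \<le> e0" "e \<le> 1"
      using assms(1-3) by (auto simp: e_def)
    have "(6 * K + 1) * e \<le> (6 * K + 1) * (\<kappa> / (6 * K + 1))"
      using assms(1-3) by (intro mult_left_mono) (auto simp: e_def)
    also have "\<dots> = \<kappa>"
      using assms(3) by simp
    finally show "6 * K * e \<le> \<kappa>"
      using \<open>0 < e\<close> by (simp add: algebra_simps)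
  qed
  define T where "T k n = (LINT x:- ball 0 e|lborel. \<bar>x ^ k\<bar> * (exp (h n x) / exp (h n 0)))" for k :: nat and n
  have "\<exists>C>0. \<exists>c>0. \<forall>\<^sub>F n in sequentially.
      set_integrable lborel (- ball 0 e) (\<lambda>x. \<bar>x ^ k\<bar> * (exp (h n x) / exp (h n 0))) \<and> T k n \<le> C * exp (- c * real n)"
    if "k \<in> {0, 1}" for k
    using bspec[OF tails that] e(1) unfolding tail_decay_cond_def T_def by blast
  from this[of 0] this[of 1] obtain C0 c0 C1 c1 where C: "0 < C0" "0 < c0" "0 < C1" "0 < c1"
    and tail0: "\<forall>\<^sub>F n in sequentially.
      set_integrable lborel (- ball 0 e) (\<lambda>x. \<bar>x ^ 0\<bar> * (exp (h n x) / exp (h n 0))) \<and> T 0 n \<le> C0 * exp (- c0 * real n)"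
    and tail1: "\<forall>\<^sub>F n in sequentially.
      set_integrable lborel (- ball 0 e) (\<lambda>x. \<bar>x ^ 1\<bar> * (exp (h n x) / exp (h n 0))) \<and> T 1 n \<le> C1 * exp (- c1 * real n)"
    by auto
  define B where "B = log_density_interval.A0 e \<kappa> K + (C1 * fact 3 / c1 ^ 3 + C0 * fact 3 / c0 ^ 3) * exp (5 * K) / e"
  have "\<forall>\<^sub>F n in sequentially.
    \<bar>(\<integral>x. x * exp (h n x) \<partial>lborel) / (\<integral>x. exp (h n x) \<partial>lborel) - (b n / a n + p n / (a n)\<^sup>2)\<bar> \<le> B * (1 / real n ^ 2)"
    using expansion coeffs meas tail0 tail1 eventually_gt_at_top[of 0]
  proof eventually_elim
    case (elim n)
    then interpret log_density_interval "h n" "h' n" e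
      using e by unfold_locales auto
    have n: "1 \<le> real n" using elim by simp
    have dev: "\<bar>m 1 - (b n / a n + p n / (a n)\<^sup>2)\<bar> \<le> A0 \<kappa> K / (real n)\<^sup>2"
      by (rule mean_expansion[where q = "q n"]) (use elim assms(2,3) e n in auto)
    have lower: "exp (h n 0 - 5 * K) * (e / n) \<le> mass"
    proof (rule mass_lower)
      show "0 \<le> e / n" "e / n \<le> e" using e n by (auto simp: divide_le_eq mult_le_cancel_left1)
      fix x assume x: "0 \<le> x" "x \<le> e / n"
      \<comment> \<open>On \<open>[0, e / n]\<close> each of the five terms of the expanded
        derivative, the remainder included, is at most \<open>K\<close> in absolute value, because
        \<open>n * t \<le> 1\<close>. Hence \<open>h n\<close> drops by at most \<open>5 * K\<close>
        there.\<close>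
      have d: "h' n t \<ge> - (5 * K)" if t: "0 \<le> t" "t \<le> e / n" for t
      proof -
        have "n * t \<le> n * (e / n)"
          using t n by (intro mult_left_mono) auto
        then have t1: "t \<le> e" "t \<le> 1" "n * t \<le> 1"
          using order.trans[OF t(2) \<open>e / n \<le> e\<close>] e n by auto
        have r: "n * t ^ Suc k \<le> 1" for k
          using mult_mono[OF t1(3), of "t ^ k" 1] t t1 n by (simp add: power_le_one mult_ac)
        have s: "\<bar>c\<bar> * t ^ Suc k \<le> K" if "\<bar>c\<bar> \<le> K * n" for c k
        proof -
          have "\<bar>c\<bar> * t ^ Suc k \<le> K * n * t ^ Suc k"
            using that t by (intro mult_right_mono) auto
          also have "\<dots> \<le> K * 1"
            using mult_left_mono[OF r[of k] \<open>0 \<le> K\<close>] by (simp add: mult_ac)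
          finally show ?thesis by simp
        qed
        have "\<bar>a n * t\<bar> \<le> K" "\<bar>p n * t\<^sup>2\<bar> \<le> K" "\<bar>q n * t ^ 3\<bar> \<le> K" "K * n * t ^ 4 \<le> K"
          using s[of "a n" 0] s[of "p n" 1] s[of "q n" 2] s[of "K * n" 3] elim t \<open>0 \<le> K\<close>
          by (auto simp: abs_mult numeral_2_eq_2 numeral_3_eq_3 numeral_eq_Suc)
        moreover have "\<bar>h' n t - (- a n * t + b n + p n * t\<^sup>2 + q n * t ^ 3)\<bar> \<le> K * n * t ^ 4" "\<bar>b n\<bar> \<le> K"
          using elim t t1 e by auto
        ultimately show ?thesis by (simp add: abs_le_iff)
      qed
      have "h n x - h n 0 \<ge> - (5 * K) * x"
      proof (cases "x = 0")
        case False
        then have "0 < x" using x by simp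
        have "(h n has_real_derivative h' n t) (at t)" if "0 \<le> t" "t \<le> x" for t
          using that x \<open>e / n \<le> e\<close> by (intro h_deriv) auto
        from MVT2[OF \<open>0 < x\<close> this] obtain t where "0 < t" "t < x" "h n x - h n 0 = (x - 0) * h' n t"
          by blast
        then show ?thesis using d[of t] x mult_left_mono[of "- (5 * K)" "h' n t" x] by (simp add: mult_ac)
      qed simp
      moreover have "x \<le> 1" using x \<open>e / n \<le> e\<close> e by linarith
      ultimately show "exp (h n 0 - 5 * K) \<le> exp (h n x)"
        using mult_left_mono[of x 1 "5 * K"] \<open>0 \<le> K\<close> by simp
    qed
    have split: "(\<integral>x. f x * exp (h n x) \<partial>lborel) = E f * mass + (LINT x:- ball 0 e|lborel. f x * exp (h n x))"
      if f: "continuous_on UNIV f" and tail: "set_integrable lborel (- ball 0 e) (\<lambda>x. \<bar>f x\<bar> * (exp (h n x) / exp (h n 0)))" for f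
    proof -
      have [measurable]: "f \<in> borel_measurable borel" "h n \<in> borel_measurable borel"
        using f elim by (auto intro: borel_measurable_continuous_onI)
      have "set_integrable lborel (- ball 0 e) (\<lambda>x. exp (h n 0) * (\<bar>f x\<bar> * (exp (h n x) / exp (h n 0))))"
        using tail by (rule set_integrable_mult_right)
      then have i1: "set_integrable lborel (- ball 0 e) (\<lambda>x. f x * exp (h n x))"
        unfolding set_integrable_def
        by (rule Bochner_Integration.integrable_bound) (auto simp: abs_mult indicator_def)
      have i2: "set_integrable lborel I (\<lambda>x. f x * exp (h n x))"
        using f by (intro integrable) (auto intro: continuous_on_subset)
      then have i3: "set_integrable lborel (ball 0 e) (\<lambda>x. f x * exp (h n x))"
        by (rule set_integrable_subset) (auto simp: dist_real_def)
      have "(\<integral>x. f x * exp (h n x) \<partial>lborel) = (LINT x:ball 0 e \<union> - ball 0 e|lborel. f x * exp (h n x))"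
        by (simp add: set_lebesgue_integral_def Compl_partition)
      also have "\<dots> = (LINT x:ball 0 e|lborel. f x * exp (h n x)) + (LINT x:- ball 0 e|lborel. f x * exp (h n x))"
        using i1 i3 by (intro set_integral_Un) auto
      \<comment> \<open>The open ball and the closed interval differ by the two endpoints, a null
        set.\<close>
      also have "(LINT x:ball 0 e|lborel. f x * exp (h n x)) = (LINT x:I|lborel. f x * exp (h n x))"
        unfolding set_lebesgue_integral_def
        by (intro integral_cong_AE) (use AE_lborel_singleton[of e] AE_lborel_singleton[of "-e"] in
          \<open>auto elim!: eventually_elim2 simp: indicator_def dist_real_def\<close>)
      finally show ?thesis using mass_pos by (simp add: E_def)
    qed
    define R where "R k = (LINT x:- ball 0 e|lborel. x ^ k * exp (h n x))" for k :: nat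
    have R: "\<bar>R k\<bar> \<le> exp (h n 0) * T k n" for k
    proof -
      have "\<bar>R k\<bar> \<le> (LINT x:- ball 0 e|lborel. \<bar>x ^ k * exp (h n x)\<bar>)"
        unfolding R_def set_lebesgue_integral_def
        by (rule order.trans[OF integral_abs_bound]) (simp add: abs_mult)
      also have "\<dots> = exp (h n 0) * T k n"
        unfolding T_def by (subst set_integral_mult_right[symmetric]) (simp add: abs_mult mult_ac)
      finally show ?thesis .
    qed
    have R0: "0 \<le> R 0"
      unfolding R_def set_lebesgue_integral_def by (intro integral_nonneg_AE) auto
    have num: "(\<integral>x. x * exp (h n x) \<partial>lborel) = m 1 * mass + R 1"
      using split[of "\<lambda>x. x"] elim by (simp add: R_def m_def)
    have den: "(\<integral>x. exp (h n x) \<partial>lborel) = mass + R 0"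
      using split[of "\<lambda>x. 1"] elim by (simp add: R_def E_const)
    have m1: "\<bar>m 1\<bar> \<le> 1"
    proof -
      have "m 1 \<le> E (\<lambda>_. 1)" "E (\<lambda>_. -1) \<le> m 1"
        unfolding m_def by (rule E_mono; use e in \<open>auto intro!: continuous_intros\<close>)+
      then show ?thesis by (simp add: E_const)
    qed
    have "(\<integral>x. x * exp (h n x) \<partial>lborel) / (\<integral>x. exp (h n x) \<partial>lborel) - m 1 = (R 1 - m 1 * R 0) / (mass + R 0)"
      unfolding num den using mass_pos R0 by (simp add: field_simps)
    also have "\<bar>\<dots>\<bar> \<le> (exp (h n 0) * T 1 n + exp (h n 0) * T 0 n) / (exp (h n 0 - 5 * K) * (e / n))"
    proof -
      have "\<bar>m 1 * R 0\<bar> \<le> 1 * \<bar>R 0\<bar>"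
        unfolding abs_mult using m1 by (intro mult_right_mono) auto
      then have "\<bar>R 1 - m 1 * R 0\<bar> \<le> exp (h n 0) * T 1 n + exp (h n 0) * T 0 n"
        using R[of 1] R[of 0] by linarith
      then show ?thesis
        unfolding abs_divide using lower R0 mass_pos e n by (intro frac_le) auto
    qed
    also have "\<dots> = (T 1 n + T 0 n) * (exp (5 * K) / e * n)"
      using e n by (simp add: exp_diff field_simps)
    \<comment> \<open>The power 3 leaves \<open>1 / n\<^sup>2\<close> after one factor
      \<open>n\<close> is lost to the lower bound on the mass.\<close>
    also have "\<dots> \<le> (C1 * (fact 3 / (c1 * n) ^ 3) + C0 * (fact 3 / (c0 * n) ^ 3)) * (exp (5 * K) / e * n)"
    proof (intro mult_right_mono add_mono)
      show "T 1 n \<le> C1 * (fact 3 / (c1 * n) ^ 3)"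
        using elim C n mult_left_mono[OF exp_minus_le_power[of "c1 * n" 3], of C1] by auto
      show "T 0 n \<le> C0 * (fact 3 / (c0 * n) ^ 3)"
        using elim C n mult_left_mono[OF exp_minus_le_power[of "c0 * n" 3], of C0] by auto
    qed (use e in auto)
    also have "\<dots> = (C1 * fact 3 / c1 ^ 3 + C0 * fact 3 / c0 ^ 3) * exp (5 * K) / e / (real n)\<^sup>2"
      using C e n by (simp add: field_simps power2_eq_square power3_eq_cube)
    finally show ?case
      using dev unfolding B_def by (simp add: add_divide_distrib abs_le_iff) 
  qed
  then show ?thesis
    by (intro bigoI[of _ B]) simp
qed

section \<open>Gaussian weights\<close>

lemma distr_lborel_reflect_translate:
  fixes t :: "'a::euclidean_space"
  assumes "\<bar>c\<bar> = 1"
  shows "distr lborel borel (\<lambda>x. t + c *\<^sub>R x) = lborel"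
  using lborel_affine[of c t] assms by (auto simp: density_1)

lemma integrable_lborel_translate:
  fixes f :: "'a::euclidean_space \<Rightarrow> real"
  assumes "integrable lborel f"
  shows "integrable lborel (\<lambda>x. f (t + x))"
proof -
  have "integrable (distr lborel borel (\<lambda>x. t + 1 *\<^sub>R x)) f"
    using assms by (simp only: distr_lborel_reflect_translate[of 1 t] abs_one)
  then show ?thesis
    using assms by (subst (asm) integrable_distr_eq) auto
qed

lemma integral_lborel_translate:
  fixes f :: "'a::euclidean_space \<Rightarrow> real"
  assumes "f \<in> borel_measurable borel"
  shows "(\<integral>x. f (t + x) \<partial>lborel) = (\<integral>x. f x \<partial>lborel)"
proof -
  have "(\<integral>x. f x \<partial>lborel) = (\<integral>x. f x \<partial>distr lborel borel (\<lambda>x. t + 1 *\<^sub>R x))"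
    by (simp only: distr_lborel_reflect_translate[of 1 t] abs_one)
  also have "\<dots> = (\<integral>x. f (t + x) \<partial>lborel)"
    using assms by (subst integral_distr) auto
  finally show ?thesis ..
qed

lemma integral_lborel_reflect:
  fixes f :: "'a::euclidean_space \<Rightarrow> real"
  assumes "f \<in> borel_measurable borel"
  shows "(\<integral>x. f (- x) \<partial>lborel) = (\<integral>x. f x \<partial>lborel)"
proof -
  have "(\<integral>x. f x \<partial>lborel) = (\<integral>x. f x \<partial>distr lborel borel (\<lambda>x. 0 + (-1) *\<^sub>R x))"
    by (simp only: distr_lborel_reflect_translate[of "-1" 0] abs_neg_one)
  also have "\<dots> = (\<integral>x. f (- x) \<partial>lborel)"
    using assms by (subst integral_distr) auto
  finally show ?thesis ..
qed

lemma integrable_exp_neg_norm: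
  fixes c :: real
  assumes "0 < c"
  shows "integrable lborel (\<lambda>x::'a::euclidean_space. exp (- (c * (x \<bullet> x))))"
proof -
  have eq: "exp (- (c * (x \<bullet> x))) = (\<Prod>b\<in>Basis. exp (- (c * (x \<bullet> b)\<^sup>2)))" for x :: 'a
    by (subst euclidean_inner) (simp add: exp_sum sum_negf[symmetric] sum_distrib_left power2_eq_square)
  have int: "integrable lborel (\<lambda>x. exp (- (c * x\<^sup>2)))"
  proof -
    define \<sigma> where "\<sigma> = 1 / sqrt (2 * c)"
    have "integrable lborel (\<lambda>x. sqrt (2 * pi * \<sigma>\<^sup>2) * normal_density 0 \<sigma> x)"
      using assms by (intro integrable_mult_right integrable_normal_density) (simp add: \<sigma>_def)
    moreover have "sqrt (2 * pi * \<sigma>\<^sup>2) * normal_density 0 \<sigma> x = exp (- (c * x\<^sup>2))" for x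
      using assms by (simp add: normal_density_def \<sigma>_def power_divide)
    ultimately show ?thesis by simp
  qed
  have "(\<integral>\<^sup>+x. exp (- (c * (x \<bullet> x))) \<partial>(lborel :: 'a measure))
      = (\<Prod>b\<in>(Basis :: 'a set). \<integral>\<^sup>+x. exp (- (c * x\<^sup>2)) \<partial>lborel)"
    unfolding eq by (subst nn_integral_lborel_prod[symmetric]) (auto simp: prod_ennreal)
  also have "\<dots> < \<infinity>"
    using int by (simp add: nn_integral_eq_integral ennreal_power[symmetric] power_less_top_ennreal)
  finally show ?thesis
    by (intro integrableI_bounded) auto
qed

lemma matrix_inv_mult:
  fixes H :: "real^'m^'m"
  assumes "invertible H"
  shows "H ** matrix_inv H = mat 1" "matrix_inv H ** H = mat 1"
  using someI_ex[OF assms[unfolded invertible_def]] by (auto simp: matrix_inv_def)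

lemma matrix_inv_unique:
  fixes A B :: "real^'m^'m"
  assumes "A ** B = mat 1"
  shows "matrix_inv A = B"
proof -
  have "invertible A"
    using assms invertible_right_inverse by blast
  then have "matrix_inv A ** (A ** B) = B"
    by (simp add: matrix_mul_assoc matrix_inv_mult)
  then show ?thesis using assms by simp
qed

text \<open>One term of the exponential series. Since cosh is even and dominates every power, the
  exponential moments, which completing the square computes, control all polynomial ones.\<close>

lemma power_le_cosh: "\<bar>x\<bar> ^ k \<le> 2 * fact k * cosh x" for x :: real
proof -
  have "(\<Sum>n\<in>{k}. \<bar>x\<bar> ^ n /\<^sub>R fact n) \<le> (\<Sum>n. \<bar>x\<bar> ^ n /\<^sub>R fact n)"
    by (intro sum_le_suminf summable_exp_generic) auto
  then have "\<bar>x\<bar> ^ k / fact k \<le> exp \<bar>x\<bar>"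
    by (simp add: exp_def divide_inverse mult.commute)
  also have "\<dots> \<le> 2 * cosh \<bar>x\<bar>"
    by (simp add: cosh_def)
  finally show ?thesis by (simp add: field_simps)
qed

lemma cosh_taylor: "\<bar>cosh x - 1 - x\<^sup>2 / 2\<bar> \<le> x ^ 4 * cosh x / 24" for x :: real
proof -
  define diff where "diff k = (if even k then cosh else sinh :: real \<Rightarrow> real)" for k :: nat
  have "\<forall>k x. DERIV (diff k) x :> diff (Suc k) x"
    by (auto simp: diff_def intro!: derivative_eq_intros)
  from Maclaurin_all_le[of diff cosh, OF _ this, of x 4] obtain t
    where t: "\<bar>t\<bar> \<le> \<bar>x\<bar>" "cosh x = (\<Sum>k<4. diff k 0 / fact k * x ^ k) + diff 4 t / fact 4 * x ^ 4"
    by (auto simp: diff_def)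
  then have eq: "cosh x - 1 - x\<^sup>2 / 2 = cosh t / 24 * x ^ 4"
    by (simp add: diff_def lessThan_nat_numeral lessThan_Suc fact_numeral)
  have "cosh t \<le> cosh x"
    using t(1) cosh_real_nonneg_le_iff[of "\<bar>t\<bar>" "\<bar>x\<bar>"] by simp
  then show ?thesis
    unfolding eq by (simp add: abs_mult mult_right_mono mult.commute)
qed

text \<open>Coercivity carries an explicit constant, rather than being plain positive definiteness,
  to keep the moment bounds uniform: it is used with \<open>c = \<kappa> * N\<close>. The weight
  \<open>psi\<close> stays unnormalised, as the normalisation cancels from every comparison.\<close>

locale gaussian_weight =
  fixes H :: "real^'m^'m" and c :: real
  assumes sym: "transpose H = H" and c_pos: "0 < c"
    and coercive: "\<And>u. c * (u \<bullet> u) \<le> u \<bullet> (H *v u)"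
begin

definition Om :: "real^'m^'m" where "Om = matrix_inv H"
definition psi :: "real^'m \<Rightarrow> real" where "psi z = exp (- (1/2) * (z \<bullet> (H *v z)))"
definition mass :: real where "mass = (\<integral>z. psi z \<partial>lborel)"

lemma inner_H: "u \<bullet> (H *v v) = v \<bullet> (H *v u)"
  by (metis dot_lmul_matrix inner_commute sym transpose_matrix_vector)

lemma invertible_H: "invertible H"
proof -
  have "H *v u = 0 \<Longrightarrow> u = 0" for u
    using coercive[of u] c_pos by (simp add: mult_le_0_iff) (metis inner_gt_zero_iff not_less)
  then show ?thesis
    using invertible_left_inverse matrix_left_invertible_ker by blast
qed

lemma H_Om: "H *v (Om *v a) = a" and Om_H: "Om *v (H *v a) = a"
  unfolding Om_def using matrix_inv_mult[OF invertible_H]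
  by (simp_all add: matrix_vector_mul_assoc)

lemma inner_Om: "u \<bullet> (Om *v v) = v \<bullet> (Om *v u)"
  using inner_H[of "Om *v u" "Om *v v"] by (simp add: H_Om inner_commute)

lemma Om_sym: "Om $ i $ j = Om $ j $ i"
  using inner_Om[of "axis i 1" "axis j 1"]
  by (simp add: inner_axis' matrix_vector_mul_component inner_axis)

lemma norm_Om: "norm (Om *v a) \<le> norm a / c"
proof (cases "Om *v a = 0")
  case True
  then show ?thesis using c_pos by simp
next
  case False
  have "c * (norm (Om *v a))\<^sup>2 \<le> (Om *v a) \<bullet> a"
    using coercive[of "Om *v a"] by (simp add: H_Om power2_norm_eq_inner)
  also have "\<dots> \<le> norm (Om *v a) * norm a"
    by (rule norm_cauchy_schwarz)
  finally show ?thesis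
    using False c_pos by (simp add: power2_eq_square field_simps)
qed

lemma Om_quad_le: "a \<bullet> (Om *v a) \<le> (norm a)\<^sup>2 / c"
proof -
  have "a \<bullet> (Om *v a) \<le> norm a * norm (Om *v a)"
    by (rule norm_cauchy_schwarz)
  also have "\<dots> \<le> norm a * (norm a / c)"
    using norm_Om by (intro mult_left_mono) auto
  finally show ?thesis by (simp add: power2_eq_square)
qed

lemma psi_pos: "0 < psi z" and psi_le_1: "psi z \<le> 1" and psi_even: "psi (- z) = psi z"
proof -
  have "0 \<le> c * (z \<bullet> z)" using c_pos by simp
  then have "0 \<le> z \<bullet> (H *v z)" using coercive[of z] by linarith
  then show "psi z \<le> 1" by (simp add: psi_def)
  have "H *v (- z) = - (H *v z)"
    using matrix_vector_mult_diff_distrib[of H 0 z] by simp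
  then show "psi (- z) = psi z" by (simp add: psi_def)
qed (simp add: psi_def)

lemma continuous_psi: "continuous_on A psi"
  unfolding psi_def
  by (intro continuous_intros linear_continuous_on_compose[OF continuous_on_id] matrix_vector_mul_linear)

lemma measurable_psi [measurable]: "psi \<in> borel_measurable borel"
  by (intro borel_measurable_continuous_onI continuous_psi)

lemma integrable_psi: "integrable lborel psi"
proof (rule Bochner_Integration.integrable_bound)
  show "integrable lborel (\<lambda>x::real^'m. exp (- (c / 2 * (x \<bullet> x))))"
    using c_pos by (intro integrable_exp_neg_norm) simp
  show "AE x in lborel. norm (psi x) \<le> norm (exp (- (c / 2 * (x \<bullet> x))))"
    using coercive by (intro AE_I2) (simp add: psi_def)
qed simp

lemma psi_translate: "psi (z - Om *v a) = psi z * exp (a \<bullet> z) * exp (- (1/2) * (a \<bullet> (Om *v a)))"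
proof -
  have "(z - Om *v a) \<bullet> (H *v (z - Om *v a)) = z \<bullet> (H *v z) - 2 * (a \<bullet> z) + a \<bullet> (Om *v a)"
    using inner_H[of z "Om *v a"]
    by (simp add: matrix_vector_mult_diff_distrib inner_diff_left inner_diff_right H_Om inner_commute)
  then show ?thesis
    by (simp add: psi_def algebra_simps flip: exp_add)
qed

text \<open>Completing the square and translation invariance give the moment generating function
  up to the factor \<^const>\<open>mass\<close>, whose value is never needed.\<close>

lemma exp_moment:
  "integrable lborel (\<lambda>z. psi z * exp (a \<bullet> z))"
  "(\<integral>z. psi z * exp (a \<bullet> z) \<partial>lborel) = exp (1/2 * (a \<bullet> (Om *v a))) * mass"
proof -
  have eq: "psi z * exp (a \<bullet> z) = exp (1/2 * (a \<bullet> (Om *v a))) * psi (- (Om *v a) + z)" for z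
    using psi_translate[of z a] by (simp add: exp_minus)
  show "integrable lborel (\<lambda>z. psi z * exp (a \<bullet> z))"
    unfolding eq by (intro integrable_mult_right integrable_lborel_translate integrable_psi)
  show "(\<integral>z. psi z * exp (a \<bullet> z) \<partial>lborel) = exp (1/2 * (a \<bullet> (Om *v a))) * mass"
    unfolding eq mass_def by (simp add: integral_lborel_translate del: add_uminus_conv_diff uminus_add_conv_diff)
qed

lemma cosh_moment:
  "integrable lborel (\<lambda>z. psi z * cosh (a \<bullet> z))"
  "(\<integral>z. psi z * cosh (a \<bullet> z) \<partial>lborel) = exp (1/2 * (a \<bullet> (Om *v a))) * mass"
proof -
  have neg: "(- a) \<bullet> (Om *v (- a)) = a \<bullet> (Om *v a)"
    using matrix_vector_mult_diff_distrib[of Om 0 a] by simp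
  have eq: "psi z * cosh (a \<bullet> z) = (psi z * exp (a \<bullet> z) + psi z * exp ((- a) \<bullet> z)) / 2" for z
    by (simp add: cosh_field_def algebra_simps)
  show "integrable lborel (\<lambda>z. psi z * cosh (a \<bullet> z))"
    unfolding eq by (intro integrable_divide Bochner_Integration.integrable_add exp_moment)
  show "(\<integral>z. psi z * cosh (a \<bullet> z) \<partial>lborel) = exp (1/2 * (a \<bullet> (Om *v a))) * mass"
    unfolding eq using exp_moment[of a] exp_moment[of "- a"] neg by simp
qed

lemma mass_nonneg: "0 \<le> mass"
  unfolding mass_def using psi_pos by (intro integral_nonneg_AE AE_I2) (simp add: less_imp_le)

lemma power_moment_integrable: "integrable lborel (\<lambda>z. psi z * (a \<bullet> z) ^ k)"
proof (rule Bochner_Integration.integrable_bound)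
  show "integrable lborel (\<lambda>z. 2 * fact k * (psi z * cosh (a \<bullet> z)))"
    by (intro integrable_mult_right cosh_moment)
  have "\<bar>psi z * (a \<bullet> z) ^ k\<bar> \<le> 2 * fact k * (psi z * cosh (a \<bullet> z))" for z
    using mult_left_mono[OF power_le_cosh[of "a \<bullet> z" k], of "psi z"] psi_pos[of z]
    by (simp add: abs_mult power_abs mult_ac)
  then show "AE z in lborel. norm (psi z * (a \<bullet> z) ^ k) \<le> norm (2 * fact k * (psi z * cosh (a \<bullet> z)))"
    using psi_pos by (intro AE_I2) (simp add: abs_mult less_imp_le)
qed simp

text \<open>Rescaling \<open>a\<close> to variance at most 1 makes the cosh moment at most
  \<open>exp (1/2) * mass\<close>; the scale returns as the factor \<open>V ^ k\<close>.\<close>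

lemma power_moment_le:
  assumes V: "0 < V" "a \<bullet> (Om *v a) \<le> V"
  shows "(\<integral>z. psi z * (a \<bullet> z) ^ (2 * k) \<partial>lborel) \<le> 4 * fact (2 * k) * V ^ k * mass"
proof -
  define b where "b = (1 / sqrt V) *\<^sub>R a"
  have b: "b \<bullet> (Om *v b) \<le> 1"
    using V by (simp add: b_def matrix_vector_mult_scaleR)
  have ab: "a \<bullet> z = sqrt V * (b \<bullet> z)" for z
    using V by (simp add: b_def)
  have "(\<integral>z. psi z * (a \<bullet> z) ^ (2 * k) \<partial>lborel)
      \<le> (\<integral>z. V ^ k * (2 * fact (2 * k)) * (psi z * cosh (b \<bullet> z)) \<partial>lborel)"
  proof (rule integral_mono)
    fix z
    have "(a \<bullet> z) ^ (2 * k) = V ^ k * \<bar>b \<bullet> z\<bar> ^ (2 * k)"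
      using V by (simp add: ab power_mult_distrib power_mult)
    also have "\<dots> \<le> V ^ k * (2 * fact (2 * k) * cosh (b \<bullet> z))"
      using V by (intro mult_left_mono power_le_cosh) auto
    finally show "psi z * (a \<bullet> z) ^ (2 * k) \<le> V ^ k * (2 * fact (2 * k)) * (psi z * cosh (b \<bullet> z))"
      using mult_left_mono[of _ _ "psi z"] psi_pos[of z] by (fastforce simp: mult_ac)
  qed (intro integrable_mult_right cosh_moment power_moment_integrable)+
  also have "\<dots> = V ^ k * (2 * fact (2 * k)) * (exp (1/2 * (b \<bullet> (Om *v b))) * mass)"
    by (simp add: cosh_moment)
  also have "\<dots> \<le> V ^ k * (2 * fact (2 * k)) * (2 * mass)"
  proof (intro mult_left_mono mult_right_mono mass_nonneg)
    have "exp (1/2 * (b \<bullet> (Om *v b))) \<le> exp (1/2)" using b by simp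
    also have "\<dots> \<le> (2::real)"
      using exp_bound[of "1/2"] by (simp add: power2_eq_square)
    finally show "exp (1/2 * (b \<bullet> (Om *v b))) \<le> 2" .
  qed (use V in auto)
  finally show ?thesis by (simp add: mult_ac)
qed

text \<open>The second derivative of the moment generating function at 0, by hand: the cosh moment
  at \<open>t *\<^sub>R a\<close> minus its second-order Taylor polynomial, divided by
  \<open>t\<^sup>2\<close>, is at most \<open>t\<^sup>2 * B\<close> and vanishes as \<open>t\<close>
  tends to 0, while its closed form tends to \<open>v / 2 * mass - M / 2\<close>.\<close>

lemma second_moment: "(\<integral>z. psi z * (a \<bullet> z)\<^sup>2 \<partial>lborel) = (a \<bullet> (Om *v a)) * mass"
proof -
  define v where "v = a \<bullet> (Om *v a)"
  define M where "M = (\<integral>z. psi z * (a \<bullet> z)\<^sup>2 \<partial>lborel)"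
  define B where "B = 4 * exp (1/2 * ((2 *\<^sub>R a) \<bullet> (Om *v (2 *\<^sub>R a)))) * mass"
  have bound: "\<bar>(exp (1/2 * t\<^sup>2 * v) - 1) / t\<^sup>2 * mass - M / 2\<bar> \<le> t\<^sup>2 * B" if t: "0 < t" "t \<le> 1" for t
  proof -
    have int1: "integrable lborel (\<lambda>z. psi z * cosh ((t *\<^sub>R a) \<bullet> z) - psi z - t\<^sup>2 / 2 * (psi z * (a \<bullet> z)\<^sup>2))"
      by (intro Bochner_Integration.integrable_diff integrable_mult_right cosh_moment integrable_psi power_moment_integrable)
    have eq: "exp (1/2 * t\<^sup>2 * v) * mass - mass - t\<^sup>2 / 2 * M
        = (\<integral>z. psi z * cosh ((t *\<^sub>R a) \<bullet> z) - psi z - t\<^sup>2 / 2 * (psi z * (a \<bullet> z)\<^sup>2) \<partial>lborel)"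
      using cosh_moment[of "t *\<^sub>R a"] integrable_psi power_moment_integrable[of a 2]
      by (simp add: M_def mass_def v_def matrix_vector_mult_scaleR power2_eq_square mult_ac)
    have "\<bar>exp (1/2 * t\<^sup>2 * v) * mass - mass - t\<^sup>2 / 2 * M\<bar> \<le> (\<integral>z. \<bar>psi z * cosh ((t *\<^sub>R a) \<bullet> z) - psi z - t\<^sup>2 / 2 * (psi z * (a \<bullet> z)\<^sup>2)\<bar> \<partial>lborel)"
      unfolding eq by (rule integral_abs_bound)
    also have "\<dots> \<le> (\<integral>z. 4 * t ^ 4 * (psi z * cosh ((2 *\<^sub>R a) \<bullet> z)) \<partial>lborel)"
    proof (rule integral_mono[OF integrable_abs[OF int1] integrable_mult_right[OF cosh_moment(1)]])
      fix z
      define x where "x = a \<bullet> z"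
      have "\<bar>cosh (t * x) - 1 - (t * x)\<^sup>2 / 2\<bar> \<le> (t * x) ^ 4 * cosh (t * x) / 24"
        by (rule cosh_taylor)
      \<comment> \<open>The number 48 is \<open>2 * fact 4\<close> from
        \<open>power_le_cosh\<close>. The two cosh factors at \<open>x\<close> are then traded for
        one at \<open>2 * x\<close>, whose integral is known.\<close>
      also have "\<dots> \<le> t ^ 4 * (48 * cosh x) * cosh x / 24"
      proof -
        have "cosh (t * x) \<le> cosh x"
          using t cosh_real_nonneg_le_iff[of "\<bar>t * x\<bar>" "\<bar>x\<bar>"]
          by (simp add: abs_mult[of t x] mult_left_le_one_le del: cosh_real_abs)
             (metis abs_mult abs_of_pos cosh_real_abs)
        moreover have "x ^ 4 \<le> 48 * cosh x"
          using power_le_cosh[of x 4] by (simp add: eval_nat_numeral)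
        ultimately show ?thesis
          using t by (simp only: power_mult_distrib) (intro divide_right_mono mult_mono mult_left_mono; simp)
      qed
      also have "\<dots> \<le> 4 * t ^ 4 * cosh (2 * x)"
      proof -
        have "(cosh x)\<^sup>2 \<le> 2 * cosh (2 * x)"
          using cosh_double_cosh[of x] cosh_real_ge_1[of "2 * x"] by simp
        from mult_left_mono[OF this, of "2 * t ^ 4"] show ?thesis
          by (simp add: power2_eq_square mult_ac)
      qed
      finally have "psi z * \<bar>cosh (t * x) - 1 - (t * x)\<^sup>2 / 2\<bar> \<le> psi z * (4 * t ^ 4 * cosh (2 * x))"
        using psi_pos[of z] by (intro mult_left_mono) auto
      moreover have "psi z * cosh (t * x) - psi z - t\<^sup>2 / 2 * (psi z * x\<^sup>2)
          = psi z * (cosh (t * x) - 1 - (t * x)\<^sup>2 / 2)"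
        by (simp add: algebra_simps power_mult_distrib)
      ultimately show "\<bar>psi z * cosh ((t *\<^sub>R a) \<bullet> z) - psi z - t\<^sup>2 / 2 * (psi z * (a \<bullet> z)\<^sup>2)\<bar>
          \<le> 4 * t ^ 4 * (psi z * cosh ((2 *\<^sub>R a) \<bullet> z))"
        using psi_pos[of z] by (simp add: abs_mult mult_ac flip: x_def)
    qed
    also have "\<dots> = t ^ 4 * B"
      unfolding integral_mult_right_zero cosh_moment(2) B_def by (simp only: mult_ac)
    finally have "\<bar>exp (1/2 * t\<^sup>2 * v) * mass - mass - t\<^sup>2 / 2 * M\<bar> / t\<^sup>2 \<le> t ^ 4 * B / t\<^sup>2"
      by (rule divide_right_mono) simp
    moreover have "(exp (1/2 * t\<^sup>2 * v) - 1) / t\<^sup>2 * mass - M / 2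
        = (exp (1/2 * t\<^sup>2 * v) * mass - mass - t\<^sup>2 / 2 * M) / t\<^sup>2"
      using t by (simp add: field_simps)
    moreover have "t ^ 4 * B / t\<^sup>2 = t\<^sup>2 * B"
      using t by (simp add: power2_eq_square power4_eq_xxxx)
    ultimately show ?thesis by (simp add: abs_divide)
  qed
  have "((\<lambda>t. t\<^sup>2 * B) \<longlongrightarrow> 0) (at_right 0)"
    by (auto intro!: tendsto_eq_intros)
  moreover have "\<forall>\<^sub>F t in at_right 0. norm ((exp (1/2 * t\<^sup>2 * v) - 1) / t\<^sup>2 * mass - M / 2) \<le> t\<^sup>2 * B"
    using eventually_at_right_real[of 0 1] by (rule eventually_mono[OF _ ]) (use bound in \<open>auto simp only: real_norm_def greaterThanLessThan_iff less_imp_le\<close>)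
  ultimately have "((\<lambda>t. (exp (1/2 * t\<^sup>2 * v) - 1) / t\<^sup>2 * mass - M / 2) \<longlongrightarrow> 0) (at_right 0)"
    by (rule Lim_null_comparison[rotated])
  moreover have "((\<lambda>t. (exp (1/2 * t\<^sup>2 * v) - 1) / t\<^sup>2 * mass - M / 2) \<longlongrightarrow> v / 2 * mass - M / 2) (at_right 0)"
  proof -
    have "((\<lambda>t. (exp (1/2 * t\<^sup>2 * v) - 1) / t\<^sup>2) \<longlongrightarrow> v / 2) (at_right 0)"
      by real_asymp
    then show ?thesis by (intro tendsto_diff tendsto_mult tendsto_const)
  qed
  ultimately have "v / 2 * mass - M / 2 = 0"
    by (intro tendsto_unique[OF trivial_limit_at_right_real])
  then show ?thesis by (simp add: M_def v_def)
qed

text \<open>Polarisation of \<open>second_moment\<close>, with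
  \<open>axis i 1 + axis j 1\<close>.\<close>

lemma component_moments:
  "integrable lborel (\<lambda>z. psi z * (z $ i * z $ j))"
  "(\<integral>z. psi z * (z $ i * z $ j) \<partial>lborel) = Om $ i $ j * mass"
proof -
  have comp: "z $ k = axis k 1 \<bullet> z" for z :: "real^'m" and k
    by (simp add: inner_axis')
  have eq: "psi z * (z $ i * z $ j) = (psi z * ((axis i 1 + axis j 1) \<bullet> z)\<^sup>2
      - psi z * (axis i 1 \<bullet> z)\<^sup>2 - psi z * (axis j 1 \<bullet> z)\<^sup>2) / 2" for z
    by (simp add: comp inner_add_left power2_eq_square algebra_simps)
  have quad: "axis k 1 \<bullet> (Om *v axis l 1) = Om $ k $ l" for k l
    by (simp add: inner_axis' matrix_vector_mul_component inner_axis)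
  note int = power_moment_integrable[of _ 2]
  show "integrable lborel (\<lambda>z. psi z * (z $ i * z $ j))"
    unfolding eq by (intro integrable_divide Bochner_Integration.integrable_diff int)
  have "(axis i 1 + axis j 1) \<bullet> (Om *v (axis i 1 + axis j 1)) = Om $ i $ i + 2 * Om $ i $ j + Om $ j $ j"
    using Om_sym[of i j] by (simp add: matrix_vector_right_distrib inner_add_left inner_add_right quad)
  then show "(\<integral>z. psi z * (z $ i * z $ j) \<partial>lborel) = Om $ i $ j * mass"
    unfolding eq using int[of "axis i 1"] int[of "axis j 1"] int[of "axis i 1 + axis j 1"]
    by (simp add: second_moment quad) (simp add: algebra_simps)
qed

lemma norm_sq_sum: "(norm z)\<^sup>2 = (\<Sum>i\<in>UNIV. (z $ i)\<^sup>2)" for z :: "real^'m"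
  unfolding power2_norm_eq_inner inner_vec_def by (simp add: power2_eq_square)

lemma axis_power_moment:
  "integrable lborel (\<lambda>z. psi z * (z $ i) ^ k)"
  "(\<integral>z. psi z * (z $ i) ^ (2 * k) \<partial>lborel) \<le> 4 * fact (2 * k) * (1 / c) ^ k * mass"
  using power_moment_integrable[of "axis i 1" k] power_moment_le[of "1 / c" "axis i 1" k]
    Om_quad_le[of "axis i 1"] c_pos by (simp_all add: inner_axis' norm_axis_1)

lemma norm_moment_2:
  "integrable lborel (\<lambda>z. psi z * (norm z)\<^sup>2)"
  "(\<integral>z. psi z * (norm z)\<^sup>2 \<partial>lborel) \<le> 8 * CARD('m) / c * mass"
proof -
  have eq: "psi z * (norm z)\<^sup>2 = (\<Sum>i\<in>UNIV. psi z * (z $ i)\<^sup>2)" for z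
    by (simp add: norm_sq_sum sum_distrib_left)
  show "integrable lborel (\<lambda>z. psi z * (norm z)\<^sup>2)"
    unfolding eq by (intro Bochner_Integration.integrable_sum axis_power_moment)
  have "(\<integral>z. psi z * (norm z)\<^sup>2 \<partial>lborel) = (\<Sum>i\<in>UNIV. \<integral>z. psi z * (z $ i)\<^sup>2 \<partial>lborel)"
    unfolding eq by (intro Bochner_Integration.integral_sum axis_power_moment)
  also have "\<dots> \<le> (\<Sum>i\<in>(UNIV::'m set). 8 * (1 / c) * mass)"
    using axis_power_moment(2)[of _ 1] by (intro sum_mono) (simp add: numeral_2_eq_2)
  finally show "(\<integral>z. psi z * (norm z)\<^sup>2 \<partial>lborel) \<le> 8 * CARD('m) / c * mass"
    by (simp add: mult_ac)
qed

lemma norm_moment_4: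
  "integrable lborel (\<lambda>z. psi z * norm z ^ 4)"
  "(\<integral>z. psi z * norm z ^ 4 \<partial>lborel) \<le> 96 * (real CARD('m))\<^sup>2 / c\<^sup>2 * mass"
proof -
  have n4: "norm z ^ 4 = ((norm z)\<^sup>2)\<^sup>2" for z :: "real^'m"
    by (simp flip: power_mult)
  have le: "psi z * norm z ^ 4 \<le> (\<Sum>i\<in>UNIV. real CARD('m) * (psi z * (z $ i) ^ 4))" for z
  proof -
    have "norm z ^ 4 \<le> (\<Sum>i\<in>UNIV. ((z $ i)\<^sup>2)\<^sup>2) * CARD('m)"
      unfolding n4 norm_sq_sum by (rule sum_squared_le_sum_of_squares)
    from mult_left_mono[OF this, of "psi z"] psi_pos[of z] show ?thesis
      by (simp add: sum_distrib_left sum_distrib_right mult_ac)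
  qed
  have int: "integrable lborel (\<lambda>z. \<Sum>i\<in>UNIV. real CARD('m) * (psi z * (z $ i) ^ 4))"
    by (intro Bochner_Integration.integrable_sum integrable_mult_right axis_power_moment)
  show i4: "integrable lborel (\<lambda>z. psi z * norm z ^ 4)"
    using le psi_pos by (intro Bochner_Integration.integrable_bound[OF int])
      (auto simp: abs_mult less_imp_le intro!: AE_I2 order.trans[OF _ abs_ge_self])
  have "(\<integral>z. psi z * norm z ^ 4 \<partial>lborel) \<le> (\<integral>z. (\<Sum>i\<in>UNIV. real CARD('m) * (psi z * (z $ i) ^ 4)) \<partial>lborel)"
    by (rule integral_mono[OF i4 int le])
  also have "\<dots> = (\<Sum>i\<in>UNIV. real CARD('m) * (\<integral>z. psi z * (z $ i) ^ 4 \<partial>lborel))"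
    by (subst Bochner_Integration.integral_sum) (auto intro!: integrable_mult_right axis_power_moment)
  also have "\<dots> \<le> (\<Sum>i\<in>(UNIV::'m set). real CARD('m) * (96 * (1 / c)\<^sup>2 * mass))"
    using axis_power_moment(2)[of _ 2] by (intro sum_mono mult_left_mono) (simp_all add: eval_nat_numeral)
  also have "\<dots> = 96 * (real CARD('m))\<^sup>2 / c\<^sup>2 * mass"
    by (simp add: power2_eq_square)
  finally show "(\<integral>z. psi z * norm z ^ 4 \<partial>lborel) \<le> 96 * (real CARD('m))\<^sup>2 / c\<^sup>2 * mass" .
qed

end

text \<open>A cube has an elementary volume, and the sum norm keeps its points within
  \<open>CARD('m) * d\<close> of the corner \<open>x0\<close>. With \<open>d = 1 / N\<close> this
  yields the polynomial lower bounds for \<open>mass\<close> and for the posterior integral.\<close>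

lemma integral_ge_box:
  fixes f :: "real^'m \<Rightarrow> real" and d b :: real
  assumes f: "integrable lborel f" "\<And>x. 0 \<le> f x" and d: "0 \<le> d"
    and b: "\<And>x. norm (x - x0) \<le> CARD('m) * d \<Longrightarrow> b \<le> f x"
  shows "b * d ^ CARD('m) \<le> (\<integral>x. f x \<partial>lborel)"
proof -
  define S where "S = cbox x0 (x0 + (\<chi> i. d))"
  have mS: "measure lborel S = d ^ CARD('m)"
    unfolding S_def using d by (subst content_cbox_cart) (auto simp: interval_ne_empty_cart)
  have "b * d ^ CARD('m) = (\<integral>x. b * indicator S x \<partial>lborel)"
    using mS by (simp add: S_def)
  also have "\<dots> \<le> (\<integral>x. f x \<partial>lborel)"
  proof (rule integral_mono)
    fix x
    show "b * indicator S x \<le> f x"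
    proof (cases "x \<in> S")
      case True
      then have "x0 $ i \<le> x $ i \<and> x $ i \<le> x0 $ i + d" for i
        by (simp add: S_def mem_box_cart)
      then have "\<bar>(x - x0) $ i\<bar> \<le> d" for i
        by (simp add: abs_le_iff algebra_simps)
      then have "norm (x - x0) \<le> (\<Sum>i\<in>(UNIV::'m set). d)"
        by (intro order.trans[OF norm_le_l1_cart] sum_mono) auto
      then show ?thesis using b True by simp
    qed (use f in auto)
  qed (use f in \<open>auto simp: S_def intro!: integrable_real_indicator emeasure_bounded_finite\<close>)
  finally show ?thesis .
qed

section \<open>Determinants\<close>

text \<open>Along the segment from the identity to \<open>A\<close> the quadratic form stays
  positive, so no matrix on it is singular; a determinant that starts at 1 and never vanishes stays
  positive by the intermediate value theorem.\<close>

lemma pos_def_det_pos: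
  fixes A :: "real^'n^'n"
  assumes "\<And>u. u \<noteq> 0 \<Longrightarrow> 0 < u \<bullet> (A *v u)"
  shows "0 < det A"
proof (rule ccontr)
  assume neg: "\<not> 0 < det A"
  define B where "B t = (\<chi> i j. t * A $ i $ j + (1 - t) * mat 1 $ i $ j)" for t :: real
  have B: "B t *v u = t *\<^sub>R (A *v u) + (1 - t) *\<^sub>R u" for t u
  proof -
    have "B t = t *\<^sub>R A + (1 - t) *\<^sub>R mat 1"
      by (simp add: B_def vec_eq_iff)
    then show ?thesis
      by (simp add: matrix_vector_mult_add_rdistrib scaleR_matrix_vector_assoc[symmetric])
  qed
  have "continuous_on {0..1} (\<lambda>t. det (B t))"
    unfolding det_def B_def by (intro continuous_intros)
  moreover have "det (B 0) = 1" "det (B 1) = det A"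
  proof -
    have "B 0 = mat 1" "B 1 = A" by (simp_all add: B_def vec_eq_iff)
    then show "det (B 0) = 1" "det (B 1) = det A" by simp_all
  qed
  ultimately obtain t where t: "0 \<le> t" "t \<le> 1" "det (B t) = 0"
    using IVT2'[of "\<lambda>t. det (B t)" 1 0 0] neg by auto
  have "\<not> invertible (B t)"
    using t(3) by (simp add: invertible_det_nz)
  then obtain u where u: "u \<noteq> 0" "B t *v u = 0"
    unfolding invertible_left_inverse matrix_left_invertible_ker by blast
  have "0 = u \<bullet> (B t *v u)" using u by simp
  also have "\<dots> = t * (u \<bullet> (A *v u)) + (1 - t) * (u \<bullet> u)"
    by (simp add: B inner_add_right)
  finally have "t * (u \<bullet> (A *v u)) + (1 - t) * (u \<bullet> u) = 0" ..
  moreover have "0 < u \<bullet> (A *v u)" "0 < u \<bullet> u"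
    using assms u by auto
  moreover have "0 \<le> t * (u \<bullet> (A *v u))" "0 \<le> (1 - t) * (u \<bullet> u)"
    using t calculation by auto
  ultimately have "t = 0" "1 - t = 0"
    by (smt (verit) mult_eq_0_iff)+
  then show False by simp
qed

lemma det_derivative_at_identity:
  fixes M :: "real \<Rightarrow> real^'n^'n"
  assumes "M t = mat 1" and "\<And>i j. ((\<lambda>s. M s $ i $ j) has_real_derivative M' $ i $ j) (at t)"
  shows "((\<lambda>s. det (M s)) has_real_derivative trace M') (at t)"
proof -
  have deriv: "((\<lambda>s. \<Prod>i\<in>UNIV. M s $ i $ p i) has_real_derivative
      (\<Sum>i\<in>UNIV. M' $ i $ p i * (\<Prod>k\<in>UNIV - {i}. M t $ k $ p k))) (at t)" for p
    using assms(2) by (rule has_field_derivative_prod)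
  have val: "(\<Sum>i\<in>UNIV. M' $ i $ p i * (\<Prod>k\<in>UNIV - {i}. M t $ k $ p k))
      = (if p = id then trace M' else 0)" if p: "p permutes UNIV" for p
  proof (cases "p = id")
    case True
    then show ?thesis by (simp add: assms(1) mat_def trace_def)
  next
    case False
    \<comment> \<open>A permutation other than the identity moves at least two points, so the
      product without the factor \<open>i\<close> still contains an off-diagonal entry of the
      identity matrix.\<close>
    have zero: "(\<Prod>k\<in>UNIV - {i}. M t $ k $ p k) = 0" for i
    proof -
      obtain k where k: "p k \<noteq> k" using False by (auto simp: fun_eq_iff)
      have "\<exists>k. k \<noteq> i \<and> k \<noteq> p k"
      proof (cases "k = i")
        case True
        then have "p k \<noteq> p (p k)" using k p by (metis permutes_inj injD)
        then show ?thesis using True k by auto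
      qed (use k in metis)
      then show ?thesis by (intro prod_zero) (auto simp: assms(1) mat_def)
    qed
    show ?thesis by (simp only: zero mult_zero_right sum.neutral_const False if_False)
  qed
  have "((\<lambda>s. \<Sum>p | p permutes UNIV. of_int (sign p) * (\<Prod>i\<in>UNIV. M s $ i $ p i)) has_real_derivative
      (\<Sum>p | p permutes (UNIV::'n set). of_int (sign p) * (\<Sum>i\<in>UNIV. M' $ i $ p i * (\<Prod>k\<in>UNIV - {i}. M t $ k $ p k)))) (at t)"
    by (intro DERIV_sum DERIV_cmult deriv)
  also have "(\<Sum>p | p permutes (UNIV::'n set). of_int (sign p) * (\<Sum>i\<in>UNIV. M' $ i $ p i * (\<Prod>k\<in>UNIV - {i}. M t $ k $ p k)))
      = (\<Sum>p | p permutes (UNIV::'n set). if p = id then trace M' else 0)"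
    by (intro sum.cong refl) (auto simp: val sign_id)
  also have "\<dots> = trace M'"
    by (simp add: finite_permutations permutes_id)
  finally show ?thesis by (simp add: det_def)
qed

text \<open>Multiplication by the fixed inverse \<open>P\<close> moves the base point to the
  identity; multiplicativity of the determinant undoes this afterwards.\<close>

lemma jacobi_formula:
  fixes A :: "real \<Rightarrow> real^'n^'n"
  assumes inv: "A t ** P = mat 1"
    and deriv: "\<And>i j. ((\<lambda>s. A s $ i $ j) has_real_derivative A' $ i $ j) (at t)"
  shows "((\<lambda>s. det (A s)) has_real_derivative det (A t) * trace (A' ** P)) (at t)"
proof -
  have "((\<lambda>s. det (A s ** P)) has_real_derivative trace (A' ** P)) (at t)"
  proof (rule det_derivative_at_identity[where M = "\<lambda>s. A s ** P"], rule inv)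
    show "((\<lambda>s. (A s ** P) $ i $ j) has_real_derivative (A' ** P) $ i $ j) (at t)" for i j
      unfolding matrix_matrix_mult_def by (simp, intro DERIV_sum DERIV_cmult_right deriv)
  qed
  from DERIV_cmult[OF this, of "det (A t)"]
  have "((\<lambda>s. det (A t) * (det (A s) * det P)) has_real_derivative det (A t) * trace (A' ** P)) (at t)"
    by (simp add: det_mul)
  moreover have "det (A t) * (det (A s) * det P) = det (A s)" for s
  proof -
    have "det (A t) * det P = 1"
      using inv by (simp flip: det_mul)
    then show ?thesis by (simp add: mult.left_commute)
  qed
  ultimately show ?thesis by simp
qed

text \<open>Represents the minor by a matrix of full size, to which the results on
  \<open>det\<close> apply.\<close>

definition border :: "'n \<Rightarrow> real^'n^'n \<Rightarrow> real^'n^'n" where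
  "border j A = (\<chi> a b. if a = j \<or> b = j then (if a = b then 1 else 0) else A $ a $ b)"

text \<open>Permutations that move \<open>j\<close> meet a zero in row \<open>j\<close>; those that
  fix it are the permutations of \<open>- {j}\<close>, with one extra factor 1.\<close>

lemma submatrix_det_border: "submatrix_det A (- {j}) = det (border j A)"
proof -
  have "det (border j A) = (\<Sum>p | p permutes UNIV. of_int (sign p) * (\<Prod>i\<in>UNIV. border j A $ i $ p i))"
    by (simp add: det_def)
  also have "\<dots> = (\<Sum>p | p permutes (- {j}). of_int (sign p) * (\<Prod>i\<in>UNIV. border j A $ i $ p i))"
  proof (rule sum.mono_neutral_right)
    show "{p. p permutes - {j}} \<subseteq> {p. p permutes UNIV}"
      by (auto intro: permutes_subset)
    show "\<forall>p\<in>{p. p permutes UNIV} - {p. p permutes - {j}}.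
        of_int (sign p) * (\<Prod>i\<in>UNIV. border j A $ i $ p i) = 0"
    proof
      fix p assume p: "p \<in> {p. p permutes UNIV} - {p. p permutes - {j}}"
      then have "p j \<noteq> j"
        by (auto simp: permutes_def)
      then have "(\<Prod>i\<in>UNIV. border j A $ i $ p i) = 0"
        by (intro prod_zero) (auto simp: border_def intro!: bexI[of _ j])
      then show "of_int (sign p) * (\<Prod>i\<in>UNIV. border j A $ i $ p i) = 0" by simp
    qed
  qed (simp add: finite_permutations)
  also have "\<dots> = submatrix_det A (- {j})"
    unfolding submatrix_det_def
  proof (intro sum.cong refl arg_cong2[of _ _ _ _ "(*)"])
    fix p assume "p \<in> {p. p permutes - {j}}"
    then have p: "p permutes - {j}" by simp
    then have pj: "p j = j" by (simp add: permutes_not_in)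
    have "(\<Prod>i\<in>UNIV. border j A $ i $ p i) = border j A $ j $ p j * (\<Prod>i\<in>UNIV - {j}. border j A $ i $ p i)"
      by (rule prod.remove) auto
    also have "\<dots> = (\<Prod>i\<in>- {j}. A $ i $ p i)"
    proof -
      have "border j A $ i $ p i = A $ i $ p i" if "i \<in> - {j}" for i
        using permutes_in_image[OF p, of i] that by (simp add: border_def)
      then show ?thesis by (simp add: pj border_def[of j A] Compl_eq_Diff_UNIV)
    qed
    finally show "(\<Prod>i\<in>UNIV. border j A $ i $ p i) = (\<Prod>i\<in>- {j}. A $ i $ p i)" .
  qed
  finally show ?thesis ..
qed

context gaussian_weight
begin

lemma Om_diag_pos: "0 < Om $ j $ j"
proof -
  have quad: "axis j 1 \<bullet> (Om *v axis j 1) = Om $ j $ j"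
    by (simp add: inner_axis' matrix_vector_mul_component inner_axis)
  have "Om *v axis j 1 \<noteq> 0"
    using H_Om[of "axis j 1"] by (metis axis_eq_0_iff matrix_vector_mult_0_right zero_neq_one)
  then have "0 < c * ((Om *v axis j 1) \<bullet> (Om *v axis j 1))"
    using c_pos by simp
  also have "\<dots> \<le> (Om *v axis j 1) \<bullet> axis j 1"
    using coercive[of "Om *v axis j 1"] by (simp add: H_Om)
  finally show ?thesis using quad by (simp add: inner_commute)
qed

text \<open>The quadratic form of the bordered matrix at \<open>u\<close> is
  \<open>(u $ j)\<^sup>2\<close> plus the form of \<open>H\<close> at \<open>u\<close> with its
  \<open>j\<close>-th coordinate set to 0.\<close>

lemma det_border_pos: "0 < det (border j H)"
proof (rule pos_def_det_pos)
  fix u :: "real^'m" assume u: "u \<noteq> 0"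
  define v where "v = (\<chi> i. if i = j then 0 else u $ i)"
  have "u \<bullet> (border j H *v u) = (u $ j)\<^sup>2 + v \<bullet> (H *v v)"
  proof -
    have "(border j H *v u) $ j = u $ j"
      by (simp add: border_def matrix_vector_mult_def if_distrib[of "\<lambda>a. a * _"] cong: if_cong)
    moreover have "u $ a * (border j H *v u) $ a = v $ a * (H *v v) $ a" if "a \<noteq> j" for a
      using that by (auto simp: border_def v_def matrix_vector_mult_def intro!: sum.cong)
    moreover have "v $ j = 0" by (simp add: v_def)
    ultimately show ?thesis
      unfolding inner_vec_def by (subst (1 2) sum.remove[of UNIV j]) (auto simp: power2_eq_square)
  qed
  moreover have "c * (v \<bullet> v) \<le> v \<bullet> (H *v v)" by (rule coercive)
  moreover have "0 < (u $ j)\<^sup>2 \<or> 0 < v \<bullet> v"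
  proof (rule ccontr)
    assume "\<not> ?thesis"
    then have "u $ j = 0" "v = 0" by auto
    then have "u = 0" by (auto simp: v_def vec_eq_iff split: if_splits)
    then show False using u by simp
  qed
  moreover have "0 \<le> v \<bullet> v" by simp
  ultimately show "0 < u \<bullet> (border j H *v u)"
    using c_pos by (smt (verit) mult_nonneg_nonneg mult_pos_pos zero_le_power2)
qed

text \<open>The inverse of \<open>H\<close> without row and column \<open>j\<close>, padded with zeros (a Schur complement of \<^const>\<open>Om\<close>).\<close>

definition Om_cond :: "'m \<Rightarrow> real^'m^'m" where
  "Om_cond j = (\<chi> a b. Om $ a $ b - Om $ a $ j * Om $ j $ b / Om $ j $ j)"

text \<open>In a row \<open>a \<noteq> j\<close> the correction in \<open>Om_cond\<close> multiplies
  the entry \<open>(a, j)\<close> of \<open>H ** Om\<close>, which is 0; the entry added at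
  \<open>(j, j)\<close> serves the trivial row.\<close>

lemma border_inverse: "border j H ** (Om_cond j + (\<chi> a b. if a = j \<and> b = j then 1 else 0)) = mat 1"
proof -
  have HOm: "(\<Sum>k\<in>UNIV. H $ a $ k * Om $ k $ b) = (if a = b then 1 else 0)" for a b
    using matrix_inv_mult(1)[OF invertible_H]
    by (auto simp: Om_def vec_eq_iff matrix_matrix_mult_def mat_def)
  have zero: "Om_cond j $ j $ b = 0" "Om_cond j $ b $ j = 0" for b
    using Om_diag_pos[of j] by (auto simp: Om_cond_def)
  have "(\<Sum>k\<in>UNIV. border j H $ a $ k * (Om_cond j + (\<chi> a b. if a = j \<and> b = j then 1 else 0)) $ k $ b)
      = (if a = b then 1 else 0)" for a b
  proof (cases "a = j")
    case True
    then have "border j H $ a $ k = (if k = j then 1 else 0)" for k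
      by (simp add: border_def)
    then show ?thesis using True by (simp add: zero if_distrib[of "\<lambda>x. x * _"] cong: if_cong)
  next
    case False
    have "(\<Sum>k\<in>UNIV. border j H $ a $ k * (Om_cond j + (\<chi> a b. if a = j \<and> b = j then 1 else 0)) $ k $ b)
        = (\<Sum>k\<in>UNIV. H $ a $ k * Om_cond j $ k $ b)"
      using False by (intro sum.cong) (auto simp: border_def zero)
    also have "\<dots> = (\<Sum>k\<in>UNIV. H $ a $ k * Om $ k $ b)
        - (\<Sum>k\<in>UNIV. H $ a $ k * Om $ k $ j) * (Om $ j $ b / Om $ j $ j)"
      by (simp add: Om_cond_def right_diff_distrib sum_subtractf sum_distrib_right sum_divide_distrib mult.assoc)
    also have "\<dots> = (if a = b then 1 else 0)"
      using False by (simp add: HOm)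
    finally show ?thesis .
  qed
  then show ?thesis
    by (simp add: vec_eq_iff matrix_matrix_mult_def mat_def)
qed

text \<open>The factor \<open>det\<close> of Jacobi's formula cancels under the logarithm. Dropping
  row and column \<open>j\<close> from the derivative is invisible in the trace, because
  \<open>Om_cond\<close> vanishes there.\<close>

lemma ln_submatrix_det_derivative:
  fixes A :: "real \<Rightarrow> real^'m^'m"
  assumes "A t = H" and deriv: "\<And>i j. ((\<lambda>s. A s $ i $ j) has_real_derivative A' $ i $ j) (at t)"
  shows "((\<lambda>s. ln (submatrix_det (A s) (- {j}))) has_real_derivative
           (\<Sum>a\<in>UNIV. \<Sum>b\<in>UNIV. A' $ a $ b * Om_cond j $ b $ a)) (at t)"
proof -
  define D where "D = (\<chi> a b. if a = j \<or> b = j then 0 else A' $ a $ b)"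
  define P where "P = Om_cond j + (\<chi> a b. if a = j \<and> b = j then 1 else 0)"
  have "((\<lambda>s. border j (A s) $ a $ b) has_real_derivative D $ a $ b) (at t)" for a b
    using deriv by (auto simp: border_def D_def)
  moreover have "border j (A t) ** P = mat 1"
    using border_inverse assms(1) by (simp add: P_def)
  ultimately have "((\<lambda>s. det (border j (A s))) has_real_derivative det (border j (A t)) * trace (D ** P)) (at t)"
    by (intro jacobi_formula)
  from DERIV_chain2[OF DERIV_ln this] have
    "((\<lambda>s. ln (det (border j (A s)))) has_real_derivative trace (D ** P)) (at t)"
    using det_border_pos[of j] assms(1) by (simp add: mult.assoc[symmetric])
  moreover have "trace (D ** P) = (\<Sum>a\<in>UNIV. \<Sum>b\<in>UNIV. A' $ a $ b * Om_cond j $ b $ a)"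
    unfolding trace_def matrix_matrix_mult_def
    using Om_diag_pos[of j]
    by (auto simp: D_def P_def Om_cond_def intro!: sum.cong)
  ultimately show ?thesis by (simp add: submatrix_det_border)
qed

end

section \<open>Expansions around the mode\<close>

lemma dir_deriv_scale: "dir_deriv k (c *\<^sub>R u) f x = c ^ k * dir_deriv k u f x"
proof (induction k arbitrary: f)
  case (Suc k)
  show ?case
    unfolding dir_deriv.simps Suc.IH by (simp add: sum_distrib_left mult_ac)
qed simp

lemma partial_cong_open:
  assumes "g differentiable (at x)" "open U" "x \<in> U" "\<And>y. y \<in> U \<Longrightarrow> g y = h y"
  shows "partial i g x = partial i h x"
proof -
  have "(g has_derivative frechet_derivative g (at x)) (at x)"
    using assms(1) by (simp add: frechet_derivative_works)
  then have "(h has_derivative frechet_derivative g (at x)) (at x)"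
    by (rule has_derivative_transform_within_open) (use assms in auto)
  then show ?thesis
    using frechet_derivative_at by (metis partial_def)
qed

text \<open>One posterior at a fixed sample size \<open>N\<close>. Curvature and derivative bounds
  scale with \<open>N\<close>, whereas \<open>\<kappa>\<close>, \<open>M\<close> and
  \<open>\<epsilon>\<close> do not; a constant defined here from these three alone can be named
  outside before the sample size is chosen.\<close>

locale peaked = gaussian_weight H "\<kappa> * N"
  for H :: "real^'m^'m" and \<kappa> N :: real +
  fixes f :: "real^'m \<Rightarrow> real" and \<mu> :: "real^'m" and M \<epsilon> :: real
  assumes N: "1 \<le> N" and \<epsilon>: "0 < \<epsilon>"
    and H_def: "H = - hessian f \<mu>"
    and smooth: "bounded_derivs_on 5 (M * N) (ball \<mu> \<epsilon>) f"
    and max_at: "\<And>x. f x \<le> f \<mu>"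
begin

lemma n_ge_1: "1 \<le> real CARD('m)"
  by (simp add: Suc_leI)

lemma \<kappa>: "0 < \<kappa>"
  using c_pos N by (simp add: zero_less_mult_iff)

lemma \<mu>_in: "\<mu> \<in> ball \<mu> \<epsilon>"
  using \<epsilon> by simp

lemma in_ball: "norm u < \<epsilon> \<Longrightarrow> \<mu> + u \<in> ball \<mu> \<epsilon>"
  by (simp add: dist_norm)

lemma MN_nonneg: "0 \<le> M * N"
  using bounded_derivs_onD(3)[OF smooth, of "[undefined]" \<mu>] \<mu>_in by simp

lemma M_nonneg: "0 \<le> M"
  using MN_nonneg N by (simp add: zero_le_mult_iff)

lemma smooth_le: "k \<le> 5 \<Longrightarrow> bounded_derivs_on k (M * N) (ball \<mu> \<epsilon>) f"
  using smooth by (rule bounded_derivs_on_mono) auto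

lemma smooth_grad: "k \<le> 4 \<Longrightarrow> bounded_derivs_on k (M * N) (ball \<mu> \<epsilon>) (partial i f)"
  using smooth_le[of "Suc k"] by (intro bounded_derivs_on_partial) auto

lemma smooth_hess: "k \<le> 3 \<Longrightarrow> bounded_derivs_on k (M * N) (ball \<mu> \<epsilon>) (partial j (partial i f))"
  by (rule bounded_derivs_on_partial[OF smooth_grad]) simp

lemma grad_zero: "partial i f \<mu> = 0"
proof -
  have "f differentiable (at \<mu>)"
    using bounded_derivs_onD(1)[OF smooth, of "[]" \<mu>] \<mu>_in by simp
  then have "(f has_derivative frechet_derivative f (at \<mu>)) (at \<mu>)"
    by (simp add: frechet_derivative_works)
  then have "frechet_derivative f (at \<mu>) = (\<lambda>v. 0)"
    by (rule differential_zero_maxmin[OF \<mu>_in open_ball]) (use max_at in auto)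
  then show ?thesis by (simp add: partial_def)
qed

lemma H_entry: "partial a (partial b f) \<mu> = - H $ a $ b"
  by (simp add: H_def hessian_def)

definition T :: "'m \<Rightarrow> 'm \<Rightarrow> 'm \<Rightarrow> real" where
  "T l k i = partial l (partial k (partial i f)) \<mu>"

lemma T_bound: "\<bar>T l k i\<bar> \<le> M * N"
  using bounded_derivs_onD(3)[OF smooth, of "[l, k, i]" \<mu>] \<mu>_in by (simp add: T_def)

lemma hess_commute: "x \<in> ball \<mu> \<epsilon> \<Longrightarrow> partial i (partial j f) x = partial j (partial i f) x"
  using partial_commute[OF smooth_le[of 2]] by simp

text \<open>The inner swap is an equation between functions near the mode, so it may be
  differentiated; the outer swap is symmetry for \<open>partial k f\<close>. This rotation is what
  the comparison of the volume slope with \<open>tau\<close> requires.\<close>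

lemma T_rotate: "T l k i = T i l k"
proof -
  have "partial l (partial k (partial i f)) \<mu> = partial l (partial i (partial k f)) \<mu>"
  proof (rule partial_cong_open[OF _ open_ball \<mu>_in])
    show "partial k (partial i f) differentiable (at \<mu>)"
      using bounded_derivs_onD(1)[OF smooth, of "[k, i]" \<mu>] \<mu>_in by simp
  qed (rule hess_commute)
  also have "\<dots> = partial i (partial l (partial k f)) \<mu>"
    using partial_commute[OF smooth_grad[of 2] open_ball \<mu>_in] by simp
  finally show ?thesis by (simp add: T_def)
qed

lemma quadratic_lower:
  assumes "norm u < \<epsilon>"
  shows "f \<mu> - f (\<mu> + u) \<le> M * N * (real CARD('m))\<^sup>2 * (norm u)\<^sup>2"
proof -
  have eq: "(\<Sum>l<2. dir_deriv l u f \<mu> / fact l) = f \<mu>"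
    by (simp add: lessThan_nat_numeral lessThan_Suc numeral_2_eq_2 grad_zero)
  have "\<bar>f (\<mu> + u) - (\<Sum>l<2. dir_deriv l u f \<mu> / fact l)\<bar> \<le> M * N * (\<Sum>i\<in>UNIV. \<bar>u $ i\<bar>)\<^sup>2 / fact 2"
    by (rule taylor_dir_deriv_bound[OF smooth_le]) (use \<mu>_in in_ball[OF assms] in auto)
  also have "\<dots> \<le> M * N * (real CARD('m) * norm u)\<^sup>2 / 1"
    by (intro frac_le mult_left_mono power_mono sum_abs_le_card_norm MN_nonneg sum_nonneg mult_nonneg_nonneg) auto
  finally have "\<bar>f (\<mu> + u) - f \<mu>\<bar> \<le> M * N * (real CARD('m))\<^sup>2 * (norm u)\<^sup>2"
    unfolding eq by (simp add: power_mult_distrib mult.assoc)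
  then show ?thesis by linarith
qed

text \<open>Within this radius every Hessian entry is within \<open>M * N * (CARD('m) * rad)\<close>
  of its value at the mode; for the quadratic form this costs at most half of the curvature.\<close>

definition rad :: real where
  "rad = min (\<epsilon> / 2) (min 1 (\<kappa> / (2 * (real CARD('m)) ^ 3 * M + 1)))"

lemma rad: "0 < rad" "rad < \<epsilon>" "rad \<le> 1" "(real CARD('m)) ^ 3 * M * rad \<le> \<kappa> / 2"
proof -
  have pos: "0 < 2 * (real CARD('m)) ^ 3 * M + 1"
    using M_nonneg by (simp add: add_nonneg_pos)
  show r: "0 < rad" "rad < \<epsilon>" "rad \<le> 1"
    using \<epsilon> \<kappa> pos by (auto simp: rad_def)
  have "(2 * (real CARD('m)) ^ 3 * M + 1) * rad \<le> (2 * (real CARD('m)) ^ 3 * M + 1) * (\<kappa> / (2 * (real CARD('m)) ^ 3 * M + 1))"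
    using pos by (intro mult_left_mono) (auto simp: rad_def)
  also have "\<dots> = \<kappa>" using pos by simp
  finally show "(real CARD('m)) ^ 3 * M * rad \<le> \<kappa> / 2"
    using r by (simp add: algebra_simps)
qed

text \<open>The curvature left throughout the ball is \<open>\<kappa> * N / 2\<close>, and the
  factor 1/2 of the second-order Taylor term halves it once more. The base point is arbitrary in the
  ball because the inequality is averaged over Gaussian displacements.\<close>

lemma strong_concavity:
  assumes x: "norm x < rad" "norm (x + e) < rad"
  shows "f (\<mu> + (x + e)) \<le> f (\<mu> + x) + (\<Sum>i\<in>UNIV. e $ i * partial i f (\<mu> + x)) - \<kappa> * N / 4 * (norm e)\<^sup>2"
proof -
  have neg: "norm (- x - e) < rad"
    using x(2) norm_minus_cancel[of "x + e"] by simp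
  have "bounded_derivs_on 2 (M * N) (ball \<mu> rad) f"
    using smooth by (rule bounded_derivs_on_mono) (use rad in auto)
  then obtain t where t: "(\<mu> + x) + t *\<^sub>R e \<in> ball \<mu> rad"
    "f ((\<mu> + x) + e) = (\<Sum>l<2. dir_deriv l e f (\<mu> + x) / fact l) + dir_deriv 2 e f ((\<mu> + x) + t *\<^sub>R e) / fact 2"
    by (rule taylor_dir_deriv[where x = "\<mu> + x" and u = e])
      (use x neg in \<open>auto simp: dist_norm add.assoc\<close>)
  define u where "u = x + t *\<^sub>R e"
  have u: "norm u < rad" "\<mu> + x + t *\<^sub>R e = \<mu> + u"
    using t(1) norm_minus_cancel[of "x + t *\<^sub>R e"] by (auto simp: u_def dist_norm add_ac)
  have entry: "\<bar>partial j (partial i f) (\<mu> + u) - - H $ j $ i\<bar> \<le> M * N * (real CARD('m) * rad)" for i j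
  proof -
    have "\<bar>partial j (partial i f) (\<mu> + u) - (\<Sum>l<1. dir_deriv l u (partial j (partial i f)) \<mu> / fact l)\<bar>
        \<le> M * N * (\<Sum>i\<in>UNIV. \<bar>u $ i\<bar>) ^ 1 / fact 1"
      by (rule taylor_dir_deriv_bound[OF smooth_hess]) (use \<mu>_in in_ball u rad in auto)
    moreover have "M * N * (\<Sum>i\<in>UNIV. \<bar>u $ i\<bar>) \<le> M * N * (real CARD('m) * rad)"
      using u n_ge_1 by (intro mult_left_mono order.trans[OF sum_abs_le_card_norm] MN_nonneg) auto
    ultimately show ?thesis by (simp add: H_entry)
  qed
  have "dir_deriv 2 e f (\<mu> + u) = (\<Sum>i\<in>UNIV. \<Sum>j\<in>UNIV. e $ i * e $ j * partial j (partial i f) (\<mu> + u))"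
    by (simp add: numeral_2_eq_2 sum_distrib_left mult_ac)
  also have "\<dots> \<le> (\<Sum>i\<in>UNIV. \<Sum>j\<in>UNIV. e $ i * e $ j * (- H $ j $ i) + \<bar>e $ i\<bar> * \<bar>e $ j\<bar> * (M * N * (real CARD('m) * rad)))"
  proof (intro sum_mono)
    fix i j
    have "e $ i * e $ j * (partial j (partial i f) (\<mu> + u) - - H $ j $ i)
        \<le> \<bar>e $ i\<bar> * \<bar>e $ j\<bar> * (M * N * (real CARD('m) * rad))"
      using mult_left_mono[OF entry[of j i], of "\<bar>e $ i\<bar> * \<bar>e $ j\<bar>"]
      by (simp only: abs_mult[symmetric] abs_le_iff)
    then show "e $ i * e $ j * partial j (partial i f) (\<mu> + u)
        \<le> e $ i * e $ j * (- H $ j $ i) + \<bar>e $ i\<bar> * \<bar>e $ j\<bar> * (M * N * (real CARD('m) * rad))"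
      by (simp add: algebra_simps)
  qed
  also have "\<dots> = - (e \<bullet> (H *v e)) + (\<Sum>i\<in>UNIV. \<bar>e $ i\<bar>)\<^sup>2 * (M * N * (real CARD('m) * rad))"
  proof -
    have "(\<Sum>i\<in>UNIV. \<Sum>j\<in>UNIV. e $ i * e $ j * (- H $ j $ i)) = - (e \<bullet> (H *v e))"
      unfolding inner_vec_def matrix_vector_mult_def
      by (subst sum.swap) (simp add: sum_negf sum_distrib_left mult_ac)
    moreover have "(\<Sum>i\<in>UNIV. \<Sum>j\<in>UNIV. \<bar>e $ i\<bar> * \<bar>e $ j\<bar> * (M * N * (real CARD('m) * rad)))
        = (\<Sum>i\<in>UNIV. \<bar>e $ i\<bar>)\<^sup>2 * (M * N * (real CARD('m) * rad))"
      unfolding power2_eq_square sum_product by (simp only: sum_distrib_right)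
    ultimately show ?thesis by (simp only: sum.distrib)
  qed
  also have "\<dots> \<le> - (\<kappa> * N * (norm e)\<^sup>2) + (real CARD('m) * norm e)\<^sup>2 * (M * N * (real CARD('m) * rad))"
    using coercive[of e] MN_nonneg n_ge_1 rad(1)
    by (intro add_mono mult_right_mono power_mono sum_abs_le_card_norm)
      (auto simp: power2_norm_eq_inner sum_nonneg)
  also have "(real CARD('m) * norm e)\<^sup>2 * (M * N * (real CARD('m) * rad)) = ((real CARD('m)) ^ 3 * M * rad) * (N * (norm e)\<^sup>2)"
    by (simp add: power2_eq_square power3_eq_cube)
  also have "\<dots> \<le> \<kappa> / 2 * (N * (norm e)\<^sup>2)"
    using rad(4) N by (intro mult_right_mono) auto
  finally have "dir_deriv 2 e f (\<mu> + u) \<le> - (\<kappa> * N / 2 * (norm e)\<^sup>2)"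
    by (simp add: mult_ac)
  moreover have "(\<Sum>l<2. dir_deriv l e f (\<mu> + x) / fact l) = f (\<mu> + x) + (\<Sum>i\<in>UNIV. e $ i * partial i f (\<mu> + x))"
    by (simp add: lessThan_nat_numeral lessThan_Suc numeral_2_eq_2)
  ultimately show ?thesis
    using t(2) unfolding u(2) by (simp add: add_ac mult_ac fact_numeral)
qed

section \<open>Taylor expansion of the gradient and its symmetrisation\<close>

definition Q :: "'m \<Rightarrow> real^'m \<Rightarrow> real" where
  "Q i u = (\<Sum>k\<in>UNIV. \<Sum>l\<in>UNIV. u $ k * u $ l * T l k i)"

definition C :: "'m \<Rightarrow> real^'m \<Rightarrow> real" where
  "C i u = dir_deriv 3 u (partial i f) \<mu>"

lemma C_sum: "C i u = (\<Sum>a\<in>UNIV. \<Sum>b\<in>UNIV. \<Sum>c\<in>UNIV. u $ a * u $ b * u $ c * partials [c, b, a, i] f \<mu>)"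
  by (simp add: C_def numeral_3_eq_3 sum_distrib_left mult_ac)

text \<open>The fifth derivatives of \<open>f\<close> enter here, as the fourth-order remainder of
  its gradient. There is no constant term because the gradient vanishes at the mode.\<close>

lemma grad_taylor:
  assumes "norm u < \<epsilon>"
  shows "\<bar>partial i f (\<mu> + u) - (- (H *v u) $ i + Q i u / 2 + C i u / 6)\<bar> \<le> M * N * (real CARD('m)) ^ 4 * norm u ^ 4 / 24"
proof -
  have "\<bar>partial i f (\<mu> + u) - (\<Sum>l<4. dir_deriv l u (partial i f) \<mu> / fact l)\<bar>
      \<le> M * N * (\<Sum>i\<in>UNIV. \<bar>u $ i\<bar>) ^ 4 / fact 4"
    by (rule taylor_dir_deriv_bound[OF smooth_grad]) (use \<mu>_in in_ball[OF assms] in auto)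
  moreover have "M * N * (\<Sum>i\<in>UNIV. \<bar>u $ i\<bar>) ^ 4 \<le> M * N * (real CARD('m) * norm u) ^ 4"
    by (intro mult_left_mono power_mono sum_abs_le_card_norm MN_nonneg sum_nonneg) auto
  moreover have "(\<Sum>l<4. dir_deriv l u (partial i f) \<mu> / fact l) = - (H *v u) $ i + Q i u / 2 + C i u / 6"
  proof -
    have "dir_deriv 1 u (partial i f) \<mu> = - (H *v u) $ i"
    proof -
      have "H $ i $ k = H $ k $ i" for k
        using arg_cong[OF sym, of "\<lambda>A. A $ k $ i"] by (simp add: transpose_def)
      then show ?thesis
        by (simp add: H_entry matrix_vector_mult_def sum_negf mult.commute)
    qed
    moreover have "dir_deriv 2 u (partial i f) \<mu> = Q i u"
      by (simp add: Q_def T_def numeral_2_eq_2 sum_distrib_left mult_ac)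
    ultimately show ?thesis
      by (simp add: lessThan_nat_numeral lessThan_Suc fact_numeral grad_zero C_def
          numeral_2_eq_2 numeral_3_eq_3 del: dir_deriv.simps(2))
  qed
  ultimately show ?thesis
    by (simp add: power_mult_distrib fact_numeral mult.assoc)
qed

lemma Q_parallelogram: "Q i (d + z) + Q i (d - z) = 2 * Q i d + 2 * Q i z"
proof -
  have "Q i (d + z) + Q i (d - z) = (\<Sum>k\<in>UNIV. \<Sum>l\<in>UNIV.
      ((d + z) $ k * (d + z) $ l + (d - z) $ k * (d - z) $ l) * T l k i)"
    by (simp add: Q_def sum.distrib[symmetric] distrib_right)
  also have "\<dots> = (\<Sum>k\<in>UNIV. \<Sum>l\<in>UNIV. 2 * (d $ k * d $ l * T l k i) + 2 * (z $ k * z $ l * T l k i))"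
    by (intro sum.cong refl) (simp add: algebra_simps)
  also have "\<dots> = 2 * Q i d + 2 * Q i z"
    by (simp add: Q_def sum.distrib sum_distrib_left)
  finally show ?thesis .
qed

lemma Q_bound: "\<bar>Q i u\<bar> \<le> M * N * (real CARD('m))\<^sup>2 * (norm u)\<^sup>2"
proof -
  have "\<bar>Q i u\<bar> \<le> (\<Sum>k\<in>UNIV. \<Sum>l\<in>UNIV. \<bar>u $ k * u $ l * T l k i\<bar>)"
    unfolding Q_def by (rule order.trans[OF sum_abs], rule sum_mono, rule sum_abs)
  also have "\<dots> \<le> (\<Sum>k\<in>(UNIV::'m set). \<Sum>l\<in>(UNIV::'m set). norm u * norm u * (M * N))"
    unfolding abs_mult by (intro sum_mono mult_mono T_bound component_le_norm_cart) auto
  finally show ?thesis by (simp add: power2_eq_square mult_ac)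
qed

lemma C_bound: "\<bar>C i u\<bar> \<le> M * N * (real CARD('m)) ^ 3 * norm u ^ 3"
proof -
  have "\<bar>C i u\<bar> \<le> M * N * (\<Sum>i\<in>UNIV. \<bar>u $ i\<bar>) ^ 3"
    unfolding C_def by (rule dir_deriv_bound[OF smooth_grad]) (use \<mu>_in in auto)
  also have "\<dots> \<le> M * N * (real CARD('m) * norm u) ^ 3"
    by (intro mult_left_mono power_mono sum_abs_le_card_norm MN_nonneg sum_nonneg) auto
  finally show ?thesis by (simp add: power_mult_distrib mult.assoc)
qed

text \<open>The part cubic in \<open>z\<close> is odd and cancels. Every surviving term has a factor
  \<open>d\<close>, which makes it small once \<open>d = O(1 / N)\<close>; the 6 counts two terms
  for each of the three positions of \<open>d\<close>.\<close>

lemma C_symmetrised: "\<bar>C i (d + z) + C i (d - z)\<bar> \<le> M * N * (real CARD('m)) ^ 3 * (2 * norm d ^ 3 + 6 * (norm d * (norm z)\<^sup>2))"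
proof -
  let ?P = "\<lambda>a b c. partials [c, b, a, i] f \<mu>"
  have P: "\<bar>?P a b c\<bar> \<le> M * N" for a b c
    using bounded_derivs_onD(3)[OF smooth, of "[c, b, a, i]" \<mu>] \<mu>_in by simp
  have prod3: "\<bar>x $ a * y $ b * w $ c\<bar> \<le> norm x * norm y * norm w" for x y w :: "real^'m" and a b c
    unfolding abs_mult by (intro mult_mono component_le_norm_cart) auto
  have summand: "\<bar>((d + z) $ a * (d + z) $ b * (d + z) $ c + (d - z) $ a * (d - z) $ b * (d - z) $ c) * ?P a b c\<bar>
      \<le> (2 * norm d ^ 3 + 6 * (norm d * (norm z)\<^sup>2)) * (M * N)" for a b c
    unfolding abs_mult
  proof (intro mult_mono P)
    have "(d + z) $ a * (d + z) $ b * (d + z) $ c + (d - z) $ a * (d - z) $ b * (d - z) $ c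
        = 2 * (d $ a * d $ b * d $ c) + 2 * (d $ a * z $ b * z $ c) + 2 * (z $ a * d $ b * z $ c) + 2 * (z $ a * z $ b * d $ c)"
      by (simp add: algebra_simps)
    then show "\<bar>(d + z) $ a * (d + z) $ b * (d + z) $ c + (d - z) $ a * (d - z) $ b * (d - z) $ c\<bar>
        \<le> 2 * norm d ^ 3 + 6 * (norm d * (norm z)\<^sup>2)"
      using prod3[of d a d b d c] prod3[of d a z b z c] prod3[of z a d b z c] prod3[of z a z b d c]
      by (simp add: power2_eq_square power3_eq_cube mult_ac abs_le_iff)
  qed auto
  have eq: "C i (d + z) + C i (d - z) = (\<Sum>a\<in>UNIV. \<Sum>b\<in>UNIV. \<Sum>c\<in>UNIV.
      ((d + z) $ a * (d + z) $ b * (d + z) $ c + (d - z) $ a * (d - z) $ b * (d - z) $ c) * ?P a b c)"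
    unfolding C_sum by (simp only: sum.distrib[symmetric] distrib_right)
  have "\<bar>C i (d + z) + C i (d - z)\<bar> \<le> (\<Sum>a\<in>(UNIV::'m set). \<Sum>b\<in>(UNIV::'m set). \<Sum>c\<in>(UNIV::'m set).
      (2 * norm d ^ 3 + 6 * (norm d * (norm z)\<^sup>2)) * (M * N))"
    unfolding eq by (rule order.trans[OF sum_abs], rule sum_mono, rule order.trans[OF sum_abs], rule sum_mono,
      rule order.trans[OF sum_abs], rule sum_mono, rule summand)
  then show ?thesis by (simp add: power3_eq_cube mult_ac)
qed

text \<open>What is odd in \<open>z\<close> disappears. The error consists of \<open>Q i d\<close>,
  the surviving part of the cubic term and the two fourth-order remainders; the factor 4 is
  generous.\<close>

lemma symmetrised_gradient:
  assumes "norm d + norm z < \<epsilon>" "norm d \<le> 1"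
  shows "\<bar>partial i f (\<mu> + (d + z)) + partial i f (\<mu> + (d - z)) - (- 2 * (H *v d) $ i + Q i z)\<bar>
      \<le> 4 * (M * N * (real CARD('m)) ^ 4) * (norm z ^ 4 + (norm d)\<^sup>2 + norm d * (norm z)\<^sup>2)"
proof -
  define B where "B = M * N * (real CARD('m)) ^ 4"
  have pow: "(real CARD('m)) ^ k \<le> (real CARD('m)) ^ 4" if "k \<le> 4" for k
    using that n_ge_1 by (rule power_increasing)
  have MNB: "M * N * (real CARD('m)) ^ k \<le> B" if "k \<le> 4" for k
    unfolding B_def using pow[OF that] MN_nonneg by (rule mult_left_mono)
  have B: "0 \<le> B" using MN_nonneg by (simp add: B_def)
  have d: "norm d ^ 3 \<le> (norm d)\<^sup>2" "norm d ^ 4 \<le> (norm d)\<^sup>2"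
    using assms(2) by (intro power_decreasing; simp)+
  have s4: "norm u ^ 4 \<le> 8 * (norm z ^ 4 + norm d ^ 4)" if "norm u \<le> norm z + norm d" for u :: "real^'m"
  proof -
    have "norm u ^ 4 \<le> (norm z + norm d) ^ 4"
      using that by (rule power_mono) simp
    also have "\<dots> = ((norm z + norm d)\<^sup>2)\<^sup>2"
      by (simp flip: power_mult)
    also have "\<dots> \<le> (2 * ((norm z)\<^sup>2 + (norm d)\<^sup>2))\<^sup>2"
      by (intro power_mono) (use sum_squares_bound[of "norm z" "norm d"] in \<open>auto simp: power2_sum\<close>)
    also have "\<dots> = 4 * ((norm z)\<^sup>2 + (norm d)\<^sup>2)\<^sup>2"
      unfolding power_mult_distrib by simp
    also have "\<dots> \<le> 4 * (2 * (((norm z)\<^sup>2)\<^sup>2 + ((norm d)\<^sup>2)\<^sup>2))"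
      using sum_squares_bound[of "(norm z)\<^sup>2" "(norm d)\<^sup>2"] by (simp add: power2_sum)
    finally show ?thesis by (simp flip: power_mult)
  qed
  have plus: "norm (d + z) < \<epsilon>" "norm (d - z) < \<epsilon>" "norm (d + z) \<le> norm z + norm d" "norm (d - z) \<le> norm z + norm d"
    using norm_triangle_ineq[of d z] norm_triangle_ineq4[of d z] assms(1) by linarith+
  have lin: "(H *v (d + z)) $ i + (H *v (d - z)) $ i = 2 * (H *v d) $ i"
    by (simp add: matrix_vector_right_distrib matrix_vector_mult_diff_distrib)
  have "\<bar>Q i d\<bar> \<le> B * (norm d)\<^sup>2"
    using order.trans[OF Q_bound mult_right_mono[OF MNB[of 2]]] by simp
  moreover have "\<bar>C i (d + z) + C i (d - z)\<bar> \<le> B * (2 * (norm d)\<^sup>2 + 6 * (norm d * (norm z)\<^sup>2))"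
  proof -
    have "M * N * (real CARD('m)) ^ 3 * (2 * norm d ^ 3 + 6 * (norm d * (norm z)\<^sup>2)) \<le> B * (2 * (norm d)\<^sup>2 + 6 * (norm d * (norm z)\<^sup>2))"
      using d B by (intro mult_mono MNB) auto
    then show ?thesis using C_symmetrised[of i d z] by linarith
  qed
  moreover have "M * N * (real CARD('m)) ^ 4 * norm u ^ 4 / 24 \<le> B * (norm z ^ 4 + (norm d)\<^sup>2) / 3"
    if "norm u \<le> norm z + norm d" for u :: "real^'m"
  proof -
    have "norm u ^ 4 \<le> 8 * (norm z ^ 4 + (norm d)\<^sup>2)"
      by (rule order.trans[OF s4[OF that]]) (intro mult_left_mono add_left_mono d; simp)
    from mult_left_mono[OF this B] show ?thesis unfolding B_def[symmetric] by (simp add: algebra_simps)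
  qed
  note this[OF plus(3)] this[OF plus(4)]
  moreover note grad_taylor[OF plus(1), of i] grad_taylor[OF plus(2), of i] Q_parallelogram[of i d z] lin
  ultimately have "\<bar>partial i f (\<mu> + (d + z)) + partial i f (\<mu> + (d - z)) - (- 2 * (H *v d) $ i + Q i z)\<bar>
      \<le> B * (norm d)\<^sup>2 + B * (2 * (norm d)\<^sup>2 + 6 * (norm d * (norm z)\<^sup>2)) / 6
        + B * (norm z ^ 4 + (norm d)\<^sup>2) / 3 + B * (norm z ^ 4 + (norm d)\<^sup>2) / 3"
    by linarith
  also have "\<dots> \<le> 4 * B * (norm z ^ 4 + (norm d)\<^sup>2 + norm d * (norm z)\<^sup>2)"
  proof -
    have "B * x + B * (2 * x + 6 * w) / 6 + B * (y + x) / 3 + B * (y + x) / 3 \<le> 4 * B * (y + x + w)"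
      if "0 \<le> x" "0 \<le> y" "0 \<le> w" for x y w
    proof -
      have "0 \<le> B * x" "0 \<le> B * y" "0 \<le> B * w"
        using B that by auto
      moreover have "4 * B * (y + x + w) - (B * x + B * (2 * x + 6 * w) / 6 + B * (y + x) / 3 + B * (y + x) / 3)
          = 2 * (B * x) + 10 / 3 * (B * y) + 3 * (B * w)"
        by (simp add: field_simps)
      ultimately show ?thesis by linarith
    qed
    from this[of "(norm d)\<^sup>2" "norm z ^ 4" "norm d * (norm z)\<^sup>2"] show ?thesis by simp
  qed
  finally show ?thesis by (simp add: B_def)
qed

end

section \<open>The variational mean correction\<close>

context peaked
begin

definition tau :: "real^'m" where
  "tau = (\<chi> i. \<Sum>k\<in>UNIV. \<Sum>l\<in>UNIV. T l k i * Om $ k $ l)"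

definition dstar :: "real^'m" where
  "dstar = (1/2) *\<^sub>R (Om *v tau)"

lemma H_dstar: "2 * (H *v dstar) $ i = tau $ i"
  by (simp add: dstar_def matrix_vector_mult_scaleR H_Om)

lemma Om_entry: "\<bar>Om $ k $ l\<bar> \<le> 1 / (\<kappa> * N)"
proof -
  have "\<bar>Om $ k $ l\<bar> = \<bar>(Om *v axis l 1) $ k\<bar>"
    by (simp add: matrix_vector_mul_component inner_axis)
  also have "\<dots> \<le> norm (Om *v axis l 1)"
    by (rule component_le_norm_cart)
  also have "\<dots> \<le> 1 / (\<kappa> * N)"
    using norm_Om[of "axis l 1"] by (simp add: norm_axis_1)
  finally show ?thesis .
qed

lemma tau_bound: "\<bar>tau $ i\<bar> \<le> (real CARD('m))\<^sup>2 * M / \<kappa>"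
proof -
  have "\<bar>tau $ i\<bar> \<le> (\<Sum>k\<in>UNIV. \<Sum>l\<in>UNIV. \<bar>T l k i * Om $ k $ l\<bar>)"
    unfolding tau_def by (simp, rule order.trans[OF sum_abs], rule sum_mono, rule sum_abs)
  also have "\<dots> \<le> (\<Sum>k\<in>(UNIV::'m set). \<Sum>l\<in>(UNIV::'m set). (M * N) * (1 / (\<kappa> * N)))"
    unfolding abs_mult by (intro sum_mono mult_mono T_bound Om_entry MN_nonneg) auto
  also have "\<dots> = (real CARD('m))\<^sup>2 * M / \<kappa>"
    using N by (simp add: power2_eq_square)
  finally show ?thesis .
qed

definition D :: real where "D = (real CARD('m)) ^ 3 * M / \<kappa>\<^sup>2"

lemma D_nonneg: "0 \<le> D"
  using M_nonneg by (simp add: D_def)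

lemma dstar_bound: "norm dstar \<le> D / N"
proof -
  have "norm tau \<le> (\<Sum>i\<in>UNIV. \<bar>tau $ i\<bar>)"
    by (rule norm_le_l1_cart)
  also have "\<dots> \<le> (\<Sum>i\<in>(UNIV::'m set). (real CARD('m))\<^sup>2 * M / \<kappa>)"
    by (intro sum_mono tau_bound)
  also have "\<dots> = (real CARD('m)) ^ 3 * M / \<kappa>"
    by (simp add: power2_eq_square power3_eq_cube)
  finally have t: "norm tau \<le> (real CARD('m)) ^ 3 * M / \<kappa>" .
  have "norm dstar \<le> norm (Om *v tau)"
    by (simp add: dstar_def)
  also have "\<dots> \<le> norm tau / (\<kappa> * N)"
    by (rule norm_Om)
  also have "\<dots> \<le> (real CARD('m)) ^ 3 * M / \<kappa> / (\<kappa> * N)"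
    using t c_pos by (intro divide_right_mono) auto
  finally show ?thesis by (simp add: D_def power2_eq_square)
qed

text \<open>The origin of \<open>tau\<close>: it is the Gaussian mean of the quadratic term of the
  gradient.\<close>

lemma Q_moment:
  "integrable lborel (\<lambda>z. psi z * Q i z)" "(\<integral>z. psi z * Q i z \<partial>lborel) = tau $ i * mass"
proof -
  have eq: "psi z * Q i z = (\<Sum>k\<in>UNIV. \<Sum>l\<in>UNIV. T l k i * (psi z * (z $ k * z $ l)))" for z
    by (simp add: Q_def sum_distrib_left mult_ac)
  note int = component_moments(1)
  show "integrable lborel (\<lambda>z. psi z * Q i z)"
    unfolding eq by (intro Bochner_Integration.integrable_sum integrable_mult_right int)
  show "(\<integral>z. psi z * Q i z \<partial>lborel) = tau $ i * mass"
    unfolding eq by (simp add: int component_moments(2) tau_def sum_distrib_right mult.assoc)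
qed

lemma local_integrable:
  assumes "continuous_on (ball 0 \<rho>) g" "\<And>z. norm z < \<rho> \<Longrightarrow> \<bar>g z\<bar> \<le> B"
  shows "integrable lborel (\<lambda>z. indicator (ball 0 \<rho>) z * (psi z * g z))"
proof (rule Bochner_Integration.integrable_bound)
  show "integrable lborel (\<lambda>z. \<bar>B\<bar> * psi z)"
    by (intro integrable_mult_right integrable_psi)
  have "(\<lambda>z. indicator (ball 0 \<rho>) z *\<^sub>R (psi z * g z)) \<in> borel_measurable borel"
    by (intro borel_measurable_continuous_on_indicator continuous_intros continuous_psi assms) auto
  then show "(\<lambda>z. indicator (ball 0 \<rho>) z * (psi z * g z)) \<in> borel_measurable lborel"
    by simp
  have "\<bar>indicator (ball 0 \<rho>) z * (psi z * g z)\<bar> \<le> \<bar>B\<bar> * psi z" for z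
  proof (cases "norm z < \<rho>")
    case True
    then have "\<bar>g z\<bar> \<le> \<bar>B\<bar>" using assms(2)[of z] by linarith
    then show ?thesis
      using True psi_pos[of z] by (simp add: abs_mult mult.commute)
  next
    case False
    then show ?thesis using psi_pos[of z] by (simp add: less_imp_le)
  qed
  then show "AE z in lborel. norm (indicator (ball 0 \<rho>) z * (psi z * g z)) \<le> norm (\<bar>B\<bar> * psi z)"
    using psi_pos by (intro AE_I2) (simp add: less_imp_le abs_mult)
qed

lemma grad_local_integrable:
  assumes "norm d + \<rho> \<le> \<epsilon>"
  shows "integrable lborel (\<lambda>z. indicator (ball 0 \<rho>) z * (psi z * partial i f (\<mu> + (d + z))))"
proof (rule local_integrable)
  have sub: "\<mu> + (d + z) \<in> ball \<mu> \<epsilon>" if "norm z < \<rho>" for z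
    using that assms norm_triangle_ineq[of d z] by (intro in_ball) linarith
  have "continuous_on (ball \<mu> \<epsilon>) (partial i f)"
    using bounded_derivs_onD(2)[OF smooth, of "[i]"] by simp
  then show "continuous_on (ball 0 \<rho>) (\<lambda>z. partial i f (\<mu> + (d + z)))"
    by (rule continuous_on_compose2) (use sub in \<open>auto intro!: continuous_intros\<close>)
  show "\<bar>partial i f (\<mu> + (d + z))\<bar> \<le> M * N" if "norm z < \<rho>" for z
    using bounded_derivs_onD(3)[OF smooth, of "[i]"] sub[OF that] by simp
qed

lemma f_local_integrable:
  assumes "norm d + \<rho> \<le> rad"
  shows "integrable lborel (\<lambda>z. indicator (ball 0 \<rho>) z * (psi z * f (\<mu> + (d + z))))"
proof (rule local_integrable)
  have sub: "norm (d + z) < rad" if "norm z < \<rho>" for z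
    using that assms norm_triangle_ineq[of d z] by linarith
  then have sub': "\<mu> + (d + z) \<in> ball \<mu> \<epsilon>" if "norm z < \<rho>" for z
    using that rad(2) by (intro in_ball) fastforce
  have "continuous_on (ball \<mu> \<epsilon>) f"
    using bounded_derivs_onD(2)[OF smooth, of "[]"] by simp
  then show "continuous_on (ball 0 \<rho>) (\<lambda>z. f (\<mu> + (d + z)))"
    by (rule continuous_on_compose2) (use sub' in \<open>auto intro!: continuous_intros\<close>)
  show "\<bar>f (\<mu> + (d + z))\<bar> \<le> \<bar>f \<mu>\<bar> + M * N * (real CARD('m))\<^sup>2 * 1" if "norm z < \<rho>" for z
  proof -
    have "M * N * (real CARD('m))\<^sup>2 * (norm (d + z))\<^sup>2 \<le> M * N * (real CARD('m))\<^sup>2 * 1"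
      using sub[OF that] rad(3) MN_nonneg by (intro mult_left_mono) (auto simp: power_le_one)
    then show ?thesis
      using quadratic_lower[of "d + z"] max_at[of "\<mu> + (d + z)"] sub[OF that] rad(2) by linarith
  qed
qed

abbreviation inside :: "real \<Rightarrow> (real^'m \<Rightarrow> real) \<Rightarrow> real" where
  "inside \<rho> g \<equiv> \<integral>z. indicator (ball 0 \<rho>) z * g z \<partial>lborel"

abbreviation outside :: "real \<Rightarrow> (real^'m \<Rightarrow> real) \<Rightarrow> real" where
  "outside \<rho> g \<equiv> \<integral>z. indicator (- ball 0 \<rho>) z * g z \<partial>lborel"

lemma psi_ball_integrable: "integrable lborel (\<lambda>z. indicator (ball 0 \<rho>) z * psi z)"
  using local_integrable[of \<rho> "\<lambda>_. 1" 1] by simp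

text \<open>Chebyshev's inequality with the second moment of \<open>norm z\<close>.\<close>

lemma psi_outside:
  assumes "0 < \<rho>"
  shows "outside \<rho> psi \<le> 8 * real CARD('m) / (\<kappa> * N * \<rho>\<^sup>2) * mass"
proof -
  have "outside \<rho> psi \<le> (\<integral>z. (1 / \<rho>\<^sup>2) * (psi z * (norm z)\<^sup>2) \<partial>lborel)"
  proof (rule integral_mono)
    show "integrable lborel (\<lambda>z. indicator (- ball 0 \<rho>) z * psi z)"
      using integrable_real_mult_indicator[OF _ integrable_psi, of "- ball 0 \<rho>"] by (simp add: mult.commute)
    fix z :: "real^'m"
    show "indicator (- ball 0 \<rho>) z * psi z \<le> (1 / \<rho>\<^sup>2) * (psi z * (norm z)\<^sup>2)"
    proof (cases "norm z < \<rho>")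
      case False
      then have "1 * psi z \<le> ((norm z)\<^sup>2 / \<rho>\<^sup>2) * psi z"
        using assms psi_pos[of z] by (intro mult_right_mono) (auto simp: field_simps intro: power_mono)
      then show ?thesis using False by (simp add: mult_ac)
    qed (use psi_pos[of z] in \<open>auto simp: less_imp_le\<close>)
  qed (intro integrable_mult_right norm_moment_2)
  also have "\<dots> \<le> (1 / \<rho>\<^sup>2) * (8 * CARD('m) / (\<kappa> * N) * mass)"
    unfolding integral_mult_right_zero by (intro mult_left_mono norm_moment_2) auto
  finally show ?thesis by (simp add: mult_ac)
qed

lemma psi_split:
  fixes g :: "real^'m \<Rightarrow> real"
  assumes "integrable lborel g"
  shows "(\<integral>z. g z \<partial>lborel)
    = inside \<rho> g + outside \<rho> g"
    and "integrable lborel (\<lambda>z. indicator (ball 0 \<rho>) z * g z)"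
    and "integrable lborel (\<lambda>z. indicator (- ball 0 \<rho>) z * g z)"
proof -
  show i: "integrable lborel (\<lambda>z. indicator (ball 0 \<rho>) z * g z)"
    "integrable lborel (\<lambda>z. indicator (- ball 0 \<rho>) z * g z)"
    using integrable_real_mult_indicator[OF _ assms, of "ball 0 \<rho>"]
      integrable_real_mult_indicator[OF _ assms, of "- ball 0 \<rho>"] by (simp_all add: mult.commute)
  have "g z = indicator (ball 0 \<rho>) z * g z + indicator (- ball 0 \<rho>) z * g z" for z
    by (simp add: indicator_def)
  then have "(\<integral>z. g z \<partial>lborel) = (\<integral>z. indicator (ball 0 \<rho>) z * g z + indicator (- ball 0 \<rho>) z * g z \<partial>lborel)"
    by (intro Bochner_Integration.integral_cong) auto
  then show "(\<integral>z. g z \<partial>lborel)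
    = inside \<rho> g + outside \<rho> g"
    using i by simp
qed

lemma psi_inside:
  assumes "0 < \<rho>" "16 * real CARD('m) / (\<kappa> * \<rho>\<^sup>2) \<le> N"
  shows "mass / 2 \<le> inside \<rho> psi"
proof -
  have "8 * real CARD('m) / (\<kappa> * N * \<rho>\<^sup>2) \<le> 1 / 2"
    using assms \<kappa> N by (simp add: field_simps)
  from mult_right_mono[OF this mass_nonneg] show ?thesis
    using psi_split(1)[OF integrable_psi, of \<rho>] psi_outside[OF assms(1)] by (simp add: mass_def)
qed

definition K2 :: real where "K2 = 4 * (M * (real CARD('m)) ^ 4)"

text \<open>Serves to dominate \<open>Q i z - tau $ i\<close> by a multiple of
  \<open>norm z ^ 4\<close> outside the ball of radius \<open>\<rho>\<close>: \<open>Q\<close> is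
  short of that by two powers of the norm, \<open>tau\<close> by four.\<close>

definition K1 :: "real \<Rightarrow> real" where
  "K1 \<rho> = (real CARD('m))\<^sup>2 * M / \<rho>\<^sup>2 + (real CARD('m))\<^sup>2 * M / \<kappa> / \<rho> ^ 4"

lemma K_nonneg: "0 \<le> K2" "0 \<le> K1 \<rho>"
  using M_nonneg \<kappa> by (auto simp: K1_def K2_def)

definition KG :: "real \<Rightarrow> real" where
  "KG \<rho> = (K2 + K1 \<rho>) * (96 * (real CARD('m))\<^sup>2 / \<kappa>\<^sup>2) + K2 * (D\<^sup>2 + D * (8 * real CARD('m) / \<kappa>))"

text \<open>The gradient is truncated to the ball, but the polynomial \<open>Q i z - tau $ i\<close>
  is not, since its mean is exactly 0 only over the whole space. Outside the ball it is therefore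
  charged to \<open>norm z ^ 4\<close>, whose moment relative to \<open>mass\<close> is of order
  \<open>1 / N\<^sup>2\<close>.\<close>

lemma gradient_deviation:
  assumes \<rho>: "0 < \<rho>" "norm dstar + \<rho> \<le> \<epsilon>" "norm dstar \<le> 1"
  shows "\<bar>indicator (ball 0 \<rho>) z * (partial i f (\<mu> + (dstar + z)) + partial i f (\<mu> + (dstar - z))) - (Q i z - tau $ i)\<bar>
    \<le> N * (K2 + K1 \<rho>) * norm z ^ 4 + N * K2 * ((norm dstar)\<^sup>2 + norm dstar * (norm z)\<^sup>2)"
proof -
  have p: "0 \<le> N * K2 * ((norm dstar)\<^sup>2 + norm dstar * (norm z)\<^sup>2)" "0 \<le> N * K1 \<rho> * norm z ^ 4" "0 \<le> N * K2 * norm z ^ 4"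
    using K_nonneg N by auto
  show ?thesis
  proof (cases "norm z < \<rho>")
    case True
    have "\<bar>partial i f (\<mu> + (dstar + z)) + partial i f (\<mu> + (dstar - z)) - (- 2 * (H *v dstar) $ i + Q i z)\<bar>
      \<le> 4 * (M * N * (real CARD('m)) ^ 4) * (norm z ^ 4 + (norm dstar)\<^sup>2 + norm dstar * (norm z)\<^sup>2)"
      by (rule symmetrised_gradient) (use assms True in auto)
    also have "- 2 * (H *v dstar) $ i + Q i z = Q i z - tau $ i"
      using H_dstar[of i] by simp
    also have "4 * (M * N * (real CARD('m)) ^ 4) * (norm z ^ 4 + (norm dstar)\<^sup>2 + norm dstar * (norm z)\<^sup>2)
        = N * K2 * norm z ^ 4 + N * K2 * ((norm dstar)\<^sup>2 + norm dstar * (norm z)\<^sup>2)"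
      by (simp add: K2_def algebra_simps)
    finally show ?thesis
      using True p by (simp add: distrib_left distrib_right)
  next
    case False
    have s: "(norm z)\<^sup>2 * \<rho>\<^sup>2 \<le> norm z ^ 4" "\<rho> ^ 4 \<le> norm z ^ 4"
    proof -
      have "(norm z)\<^sup>2 * \<rho>\<^sup>2 \<le> (norm z)\<^sup>2 * (norm z)\<^sup>2"
        using False \<rho> by (intro mult_left_mono power_mono) auto
      then show "(norm z)\<^sup>2 * \<rho>\<^sup>2 \<le> norm z ^ 4" by (simp flip: power_add)
      show "\<rho> ^ 4 \<le> norm z ^ 4"
        using False \<rho> by (intro power_mono) auto
    qed
    have "\<bar>Q i z\<bar> \<le> N * ((real CARD('m))\<^sup>2 * M) * (norm z ^ 4 / \<rho>\<^sup>2)"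
    proof -
      have "\<bar>Q i z\<bar> \<le> N * ((real CARD('m))\<^sup>2 * M) * (norm z)\<^sup>2"
        using Q_bound[of i z] by (simp add: mult_ac)
      also have "\<dots> \<le> N * ((real CARD('m))\<^sup>2 * M) * (norm z ^ 4 / \<rho>\<^sup>2)"
        using s(1) \<rho> N M_nonneg by (intro mult_left_mono) (auto simp: field_simps)
      finally show ?thesis .
    qed
    moreover have "\<bar>tau $ i\<bar> \<le> N * ((real CARD('m))\<^sup>2 * M / \<kappa>) * (norm z ^ 4 / \<rho> ^ 4)"
    proof -
      have "1 * ((real CARD('m))\<^sup>2 * M / \<kappa>) * 1 \<le> N * ((real CARD('m))\<^sup>2 * M / \<kappa>) * (norm z ^ 4 / \<rho> ^ 4)"
        using s(2) \<rho> N M_nonneg \<kappa> by (intro mult_mono) auto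
      then show ?thesis using tau_bound[of i] by simp
    qed
    moreover have "N * ((real CARD('m))\<^sup>2 * M) * (norm z ^ 4 / \<rho>\<^sup>2) + N * ((real CARD('m))\<^sup>2 * M / \<kappa>) * (norm z ^ 4 / \<rho> ^ 4)
        = N * K1 \<rho> * norm z ^ 4"
      by (simp add: K1_def algebra_simps)
    ultimately have "\<bar>Q i z - tau $ i\<bar> \<le> N * K1 \<rho> * norm z ^ 4"
      by linarith
    then show ?thesis
      using False p by (simp add: distrib_left distrib_right abs_minus_commute)
  qed
qed

text \<open>Averaging over \<open>z\<close> and \<open>- z\<close> cancels the odd terms of the expansion of the gradient, and
  at \<^const>\<open>dstar\<close> the linear term cancels the mean of the quadratic one.\<close>

lemma grad_integral:
  assumes \<rho>: "0 < \<rho>" "norm dstar + \<rho> \<le> \<epsilon>" "norm dstar \<le> 1"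
  shows "\<bar>inside \<rho> (\<lambda>z. psi z * partial i f (\<mu> + (dstar + z)))\<bar> \<le> KG \<rho> / N * mass"
proof -
  define g where "g z = indicator (ball 0 \<rho>) z * (psi z * partial i f (\<mu> + (dstar + z)))" for z
  have ig: "integrable lborel g"
    unfolding g_def using grad_local_integrable[OF \<rho>(2)] .
  then have mg: "g \<in> borel_measurable borel" by auto
  have ig': "integrable lborel (\<lambda>z. g (- z))"
  proof -
    have "integrable (distr lborel borel (\<lambda>x. 0 + (-1) *\<^sub>R x)) g"
      using ig by (simp only: distr_lborel_reflect_translate[of "-1" 0] abs_neg_one)
    then show ?thesis
      using mg by (subst (asm) integrable_distr_eq) auto
  qed
  have sym: "g z + g (- z) = indicator (ball 0 \<rho>) z * (partial i f (\<mu> + (dstar + z)) + partial i f (\<mu> + (dstar - z))) * psi z" for z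
    by (simp add: g_def psi_even indicator_def algebra_simps)
  define q where "q z = psi z * Q i z - tau $ i * psi z" for z
  have iq: "integrable lborel q"
    unfolding q_def by (intro Bochner_Integration.integrable_diff Q_moment integrable_mult_right integrable_psi)
  have q0: "(\<integral>z. q z \<partial>lborel) = 0"
    unfolding q_def using Q_moment integrable_psi by (simp add: mass_def)
  have i3: "integrable lborel (\<lambda>z. N * (K2 + K1 \<rho>) * (psi z * norm z ^ 4) + N * K2 * ((norm dstar)\<^sup>2 * psi z + norm dstar * (psi z * (norm z)\<^sup>2)))"
    by (intro Bochner_Integration.integrable_add integrable_mult_right norm_moment_4 norm_moment_2 integrable_psi)
  have "2 * (\<integral>z. g z \<partial>lborel) = (\<integral>z. g z + g (- z) - q z \<partial>lborel)"
    using ig ig' iq q0 integral_lborel_reflect[OF mg] by simp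
  then have "2 * \<bar>\<integral>z. g z \<partial>lborel\<bar> = \<bar>\<integral>z. g z + g (- z) - q z \<partial>lborel\<bar>"
    by linarith
  also have "\<dots> \<le> (\<integral>z. \<bar>g z + g (- z) - q z\<bar> \<partial>lborel)"
    by (rule integral_abs_bound)
  also have "\<dots> \<le> (\<integral>z. N * (K2 + K1 \<rho>) * (psi z * norm z ^ 4) + N * K2 * ((norm dstar)\<^sup>2 * psi z + norm dstar * (psi z * (norm z)\<^sup>2)) \<partial>lborel)"
  proof (rule integral_mono[OF _ i3])
    show "integrable lborel (\<lambda>z. \<bar>g z + g (- z) - q z\<bar>)"
      using ig ig' iq by auto
    fix z
    have "g z + g (- z) - q z = psi z * (indicator (ball 0 \<rho>) z * (partial i f (\<mu> + (dstar + z)) + partial i f (\<mu> + (dstar - z))) - (Q i z - tau $ i))"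
      unfolding sym q_def by (simp add: algebra_simps)
    then have "\<bar>g z + g (- z) - q z\<bar> = psi z * \<bar>indicator (ball 0 \<rho>) z * (partial i f (\<mu> + (dstar + z)) + partial i f (\<mu> + (dstar - z))) - (Q i z - tau $ i)\<bar>"
      using psi_pos[of z] by (simp add: abs_mult)
    also have "\<dots> \<le> psi z * (N * (K2 + K1 \<rho>) * norm z ^ 4 + N * K2 * ((norm dstar)\<^sup>2 + norm dstar * (norm z)\<^sup>2))"
      using psi_pos[of z] by (intro mult_left_mono gradient_deviation \<rho>) auto
    finally show "\<bar>g z + g (- z) - q z\<bar>
        \<le> N * (K2 + K1 \<rho>) * (psi z * norm z ^ 4) + N * K2 * ((norm dstar)\<^sup>2 * psi z + norm dstar * (psi z * (norm z)\<^sup>2))"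
      by (simp add: algebra_simps)
  qed
  also have "\<dots> = N * (K2 + K1 \<rho>) * (\<integral>z. psi z * norm z ^ 4 \<partial>lborel)
      + N * K2 * ((norm dstar)\<^sup>2 * mass + norm dstar * (\<integral>z. psi z * (norm z)\<^sup>2 \<partial>lborel))"
    using norm_moment_4(1) norm_moment_2(1) integrable_psi by (simp add: mass_def)
  also have "\<dots> \<le> N * (K2 + K1 \<rho>) * (96 * (real CARD('m))\<^sup>2 / (\<kappa> * N)\<^sup>2 * mass)
      + N * K2 * ((D / N)\<^sup>2 * mass + D / N * (8 * CARD('m) / (\<kappa> * N) * mass))"
    using K_nonneg N \<kappa> dstar_bound D_nonneg mass_nonneg
    by (intro add_mono mult_left_mono mult_mono mult_right_mono power_mono norm_moment_4 norm_moment_2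
        mult_nonneg_nonneg zero_le_power integral_nonneg_AE AE_I2) (auto simp: less_imp_le[OF psi_pos])
  also have "\<dots> = KG \<rho> / N * mass"
    using N \<kappa> by (simp add: KG_def field_simps power2_eq_square)
  finally have "2 * \<bar>\<integral>z. g z \<partial>lborel\<bar> \<le> KG \<rho> / N * mass" .
  then show ?thesis unfolding g_def by linarith
qed

lemma KG_nonneg: "0 < \<rho> \<Longrightarrow> 0 \<le> KG \<rho>"
  unfolding KG_def using K_nonneg \<kappa> D_nonneg by simp

text \<open>Strong concavity holds only near the mode, so maximality is split into ball and
  complement, and the complements become \<open>t1\<close> and \<open>t2\<close>. One half of the
  coefficient \<open>\<kappa> / 4\<close> survives, because at least half of the mass lies in the
  ball.\<close>

lemma vb_compare:
  assumes \<rho>: "0 < \<rho>" "norm dstar + \<rho> \<le> rad" "norm \<delta> + \<rho> \<le> rad" "16 * real CARD('m) / (\<kappa> * \<rho>\<^sup>2) \<le> N"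
    and int: "integrable lborel (\<lambda>z. psi z * f (\<mu> + (\<delta> + z)))" "integrable lborel (\<lambda>z. psi z * f (\<mu> + (dstar + z)))"
    and opt: "(\<integral>z. psi z * f (\<mu> + (dstar + z)) \<partial>lborel) \<le> (\<integral>z. psi z * f (\<mu> + (\<delta> + z)) \<partial>lborel)"
    and tail: "outside \<rho> (\<lambda>z. psi z * \<bar>f (\<mu> + (\<delta> + z))\<bar>) \<le> t1"
      "outside \<rho> (\<lambda>z. psi z * \<bar>f (\<mu> + (dstar + z))\<bar>) \<le> t2"
  shows "\<kappa> * N / 8 * (norm (\<delta> - dstar))\<^sup>2 * mass
    \<le> real CARD('m) * norm (\<delta> - dstar) * (KG \<rho> / N * mass) + t1 + t2"
proof -
  define e where "e = \<delta> - dstar"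
  let ?F = "\<lambda>d z. psi z * f (\<mu> + (d + z))"
  let ?G = "\<lambda>i z. psi z * partial i f (\<mu> + (dstar + z))"
  have \<rho>': "norm dstar + \<rho> \<le> \<epsilon>" "norm dstar \<le> 1"
    using \<rho> rad by auto
  have tailabs: "\<bar>outside \<rho> (?F d)\<bar>
      \<le> outside \<rho> (\<lambda>z. psi z * \<bar>f (\<mu> + (d + z))\<bar>)" for d
    using integral_abs_bound[of lborel "\<lambda>z. indicator (- ball 0 \<rho>) z * ?F d z"] psi_pos
    by (simp add: abs_mult less_imp_le)
  note split = psi_split[OF int(1), of \<rho>] psi_split[OF int(2), of \<rho>]
  have "inside \<rho> (?F dstar) - inside \<rho> (?F \<delta>)
      \<le> outside \<rho> (?F \<delta>) - outside \<rho> (?F dstar)"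
    using opt split(1) split(4) by linarith
  also have "\<dots> \<le> t1 + t2"
    using tail tailabs[of \<delta>] tailabs[of dstar] by linarith
  finally have upper: "inside \<rho> (?F dstar) - inside \<rho> (?F \<delta>) \<le> t1 + t2" .
  have ig: "integrable lborel (\<lambda>z. indicator (ball 0 \<rho>) z * ?G i z)" for i
    by (rule grad_local_integrable[OF \<rho>'(1)])
  have ir: "integrable lborel (\<lambda>z. indicator (ball 0 \<rho>) z * ?F dstar z
      + (\<Sum>i\<in>UNIV. e $ i * (indicator (ball 0 \<rho>) z * ?G i z)) - \<kappa> * N / 4 * (norm e)\<^sup>2 * (indicator (ball 0 \<rho>) z * psi z))"
    by (intro Bochner_Integration.integrable_diff Bochner_Integration.integrable_add Bochner_Integration.integrable_sum
        integrable_mult_right ig split psi_ball_integrable)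
  have "inside \<rho> (?F \<delta>)
      \<le> (\<integral>z. indicator (ball 0 \<rho>) z * ?F dstar z
      + (\<Sum>i\<in>UNIV. e $ i * (indicator (ball 0 \<rho>) z * ?G i z)) - \<kappa> * N / 4 * (norm e)\<^sup>2 * (indicator (ball 0 \<rho>) z * psi z) \<partial>lborel)"
  proof (rule integral_mono[OF split(2) ir])
    fix z :: "real^'m"
    show "indicator (ball 0 \<rho>) z * ?F \<delta> z \<le> indicator (ball 0 \<rho>) z * ?F dstar z
      + (\<Sum>i\<in>UNIV. e $ i * (indicator (ball 0 \<rho>) z * ?G i z)) - \<kappa> * N / 4 * (norm e)\<^sup>2 * (indicator (ball 0 \<rho>) z * psi z)"
    proof (cases "norm z < \<rho>")
      case True
      have eq: "dstar + z + e = \<delta> + z" by (simp add: e_def)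
      have "norm (dstar + z) < rad" "norm (dstar + z + e) < rad"
        unfolding eq using True \<rho> norm_triangle_ineq[of dstar z] norm_triangle_ineq[of \<delta> z] by linarith+
      from strong_concavity[OF this] have
        "f (\<mu> + (\<delta> + z)) \<le> f (\<mu> + (dstar + z)) + (\<Sum>i\<in>UNIV. e $ i * partial i f (\<mu> + (dstar + z))) - \<kappa> * N / 4 * (norm e)\<^sup>2"
        unfolding eq .
      from mult_left_mono[OF this, of "psi z"] psi_pos[of z] True show ?thesis
        by (simp add: algebra_simps sum_distrib_left)
    qed simp
  qed
  also have "\<dots> = inside \<rho> (?F dstar)
      + (\<Sum>i\<in>UNIV. e $ i * inside \<rho> (?G i))
      - \<kappa> * N / 4 * (norm e)\<^sup>2 * inside \<rho> psi"
    by (subst Bochner_Integration.integral_diff Bochner_Integration.integral_add Bochner_Integration.integral_sum,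
        (intro Bochner_Integration.integrable_add Bochner_Integration.integrable_sum integrable_mult_right ig split psi_ball_integrable)+)+
      simp
  finally have lower: "\<kappa> * N / 4 * (norm e)\<^sup>2 * inside \<rho> psi
      \<le> (\<Sum>i\<in>UNIV. e $ i * inside \<rho> (?G i)) + (t1 + t2)"
    using upper by linarith
  have "(\<Sum>i\<in>UNIV. e $ i * inside \<rho> (?G i)) \<le> (\<Sum>i\<in>(UNIV::'m set). norm e * (KG \<rho> / N * mass))"
  proof (rule sum_mono)
    fix i
    have "\<bar>e $ i\<bar> * \<bar>inside \<rho> (?G i)\<bar> \<le> norm e * (KG \<rho> / N * mass)"
      by (intro mult_mono component_le_norm_cart grad_integral \<rho>' \<rho>) auto
    then show "e $ i * inside \<rho> (?G i) \<le> norm e * (KG \<rho> / N * mass)"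
      by (simp flip: abs_mult)
  qed
  moreover have "\<kappa> * N / 4 * (norm e)\<^sup>2 * (mass / 2) \<le> \<kappa> * N / 4 * (norm e)\<^sup>2 * inside \<rho> psi"
    using psi_inside[OF \<rho>(1) \<rho>(4)] \<kappa> N by (intro mult_left_mono) auto
  moreover have "(\<Sum>i\<in>(UNIV::'m set). norm e * (KG \<rho> / N * mass)) = real CARD('m) * norm e * (KG \<rho> / N * mass)"
    by simp
  moreover have "\<kappa> * N / 4 * (norm e)\<^sup>2 * (mass / 2) = \<kappa> * N / 8 * (norm e)\<^sup>2 * mass"
    by simp
  ultimately show ?thesis
    using lower unfolding e_def[symmetric] by linarith
qed

section \<open>Excluding corrections far from zero\<close>

definition far_const :: "real \<Rightarrow> real \<Rightarrow> real" where
  "far_const B \<rho> = M * (real CARD('m))\<^sup>2 * (8 * real CARD('m) / \<kappa>) + B * (8 * real CARD('m) / (\<kappa> * \<rho>\<^sup>2))"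

text \<open>For \<open>norm z < \<eta> / 2\<close> the point \<open>\<mu> + (\<delta> + z)\<close>
  is at least \<open>\<eta> / 2\<close> away from the mode, so the log posterior loses
  \<open>c * N\<close> on half of the mass (\<open>psi_inside\<close> at radius
  \<open>\<eta> / 2\<close> gives the 64). Elsewhere maximality of the mode suffices, so no tail at
  \<open>\<delta>\<close> is needed. Apart from \<open>t\<close>, the zero shift loses only a
  bounded amount: \<open>N\<close> times a second moment of order \<open>1 / N\<close>, and
  \<open>f \<mu>\<close>, at most linear in \<open>N\<close>, times an outer mass of order
  \<open>1 / N\<close>.\<close>

lemma vb_far:
  assumes far: "0 < \<eta>" "0 < c" "\<And>x. \<eta> / 2 \<le> dist x \<mu> \<Longrightarrow> f x \<le> f \<mu> - c * N" "\<eta> \<le> norm \<delta>"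
    and large: "64 * real CARD('m) / (\<kappa> * \<eta>\<^sup>2) \<le> N"
    and \<rho>: "0 < \<rho>" "\<rho> \<le> rad" and B: "0 \<le> B" "f \<mu> \<le> B * N"
    and int: "integrable lborel (\<lambda>z. psi z * f (\<mu> + (\<delta> + z)))" "integrable lborel (\<lambda>z. psi z * f (\<mu> + z))"
    and opt: "(\<integral>z. psi z * f (\<mu> + z) \<partial>lborel) \<le> (\<integral>z. psi z * f (\<mu> + (\<delta> + z)) \<partial>lborel)"
    and tail: "outside \<rho> (\<lambda>z. psi z * \<bar>f (\<mu> + z)\<bar>) \<le> t"
  shows "c * N / 2 * mass \<le> far_const B \<rho> * mass + t"
proof -
  have "c * N * (mass / 2) \<le> c * N * inside (\<eta> / 2) psi"
    using far N large by (intro mult_left_mono psi_inside) (auto simp: power_divide)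
  also have "\<dots> \<le> (\<integral>z. f \<mu> * psi z - psi z * f (\<mu> + (\<delta> + z)) \<partial>lborel)"
    unfolding integral_mult_right_zero[symmetric]
  proof (rule integral_mono)
    fix z :: "real^'m"
    show "c * N * (indicator (ball 0 (\<eta> / 2)) z * psi z) \<le> f \<mu> * psi z - psi z * f (\<mu> + (\<delta> + z))"
    proof (cases "norm z < \<eta> / 2")
      case True
      have "norm \<delta> \<le> norm (\<delta> + z) + norm z"
        using norm_triangle_ineq4[of "\<delta> + z" z] by simp
      then have "\<eta> / 2 \<le> dist (\<mu> + (\<delta> + z)) \<mu>"
        using True far(4) by (simp add: dist_norm)
      from mult_left_mono[OF far(3)[OF this], of "psi z"] psi_pos[of z] True show ?thesis
        by (simp add: algebra_simps)
    next
      case False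
      then show ?thesis
        using mult_left_mono[OF max_at[of "\<mu> + (\<delta> + z)"], of "psi z"] psi_pos[of z] by (simp add: mult.commute)
    qed
  qed (intro Bochner_Integration.integrable_diff integrable_mult_right integrable_psi psi_ball_integrable int)+
  also have "\<dots> \<le> (\<integral>z. f \<mu> * psi z - psi z * f (\<mu> + z) \<partial>lborel)"
    using opt int integrable_psi by simp
  also have "\<dots> \<le> (\<integral>z. M * N * (real CARD('m))\<^sup>2 * (psi z * (norm z)\<^sup>2) + B * N * (indicator (- ball 0 \<rho>) z * psi z)
      + indicator (- ball 0 \<rho>) z * \<bar>psi z * f (\<mu> + z)\<bar> \<partial>lborel)"
  proof (rule integral_mono)
    fix z :: "real^'m"
    show "f \<mu> * psi z - psi z * f (\<mu> + z) \<le> M * N * (real CARD('m))\<^sup>2 * (psi z * (norm z)\<^sup>2)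
        + B * N * (indicator (- ball 0 \<rho>) z * psi z) + indicator (- ball 0 \<rho>) z * \<bar>psi z * f (\<mu> + z)\<bar>"
    proof (cases "norm z < \<rho>")
      case True
      then have "f \<mu> - f (\<mu> + z) \<le> M * N * (real CARD('m))\<^sup>2 * (norm z)\<^sup>2"
        using \<rho> rad by (intro quadratic_lower) auto
      from mult_left_mono[OF this, of "psi z"] psi_pos[of z] True show ?thesis
        by (simp add: algebra_simps)
    next
      case False
      have "0 \<le> M * N * (real CARD('m))\<^sup>2 * (psi z * (norm z)\<^sup>2)"
        using MN_nonneg psi_pos[of z] by simp
      moreover have "f \<mu> * psi z \<le> B * N * psi z"
        using B psi_pos[of z] by (intro mult_right_mono) auto
      ultimately show ?thesis
        using False by simp
    qed
  qed (intro Bochner_Integration.integrable_diff Bochner_Integration.integrable_add integrable_mult_right integrable_psi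
      int norm_moment_2 psi_split(3) integrable_abs)+
  also have "\<dots> = M * N * (real CARD('m))\<^sup>2 * (\<integral>z. psi z * (norm z)\<^sup>2 \<partial>lborel) + B * N * outside \<rho> psi
      + outside \<rho> (\<lambda>z. \<bar>psi z * f (\<mu> + z)\<bar>)"
    using norm_moment_2(1) psi_split(3)[OF integrable_psi, of \<rho>] psi_split(3)[OF integrable_abs[OF int(2)], of \<rho>]
    by simp
  also have "\<dots> \<le> M * N * (real CARD('m))\<^sup>2 * (8 * CARD('m) / (\<kappa> * N) * mass) + B * N * (8 * real CARD('m) / (\<kappa> * N * \<rho>\<^sup>2) * mass) + t"
  proof (intro add_mono mult_left_mono norm_moment_2 psi_outside \<rho>)
    show "outside \<rho> (\<lambda>z. \<bar>psi z * f (\<mu> + z)\<bar>) \<le> t"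
      using tail psi_pos by (simp add: abs_mult less_imp_le)
  qed (use MN_nonneg B N in auto)
  also have "\<dots> = far_const B \<rho> * mass + t"
    using N by (simp add: far_const_def field_simps)
  finally show ?thesis by simp
qed

section \<open>Polynomial bounds for the Gaussian mass and the posterior maximum\<close>

lemma H_quad_upper: "z \<bullet> (H *v z) \<le> M * N * (real CARD('m))\<^sup>2 * (norm z)\<^sup>2"
proof -
  have H: "\<bar>H $ a $ b\<bar> \<le> M * N" for a b
    using bounded_derivs_onD(3)[OF smooth, of "[a, b]" \<mu>] \<mu>_in H_entry[of a b] by simp
  have "z \<bullet> (H *v z) = (\<Sum>a\<in>UNIV. \<Sum>b\<in>UNIV. z $ a * (H $ a $ b * z $ b))"
    by (simp add: inner_vec_def matrix_vector_mult_def sum_distrib_left)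
  also have "\<dots> \<le> (\<Sum>a\<in>(UNIV::'m set). \<Sum>b\<in>(UNIV::'m set). norm z * (M * N * norm z))"
  proof (intro sum_mono)
    fix a b
    have "\<bar>z $ a * (H $ a $ b * z $ b)\<bar> \<le> norm z * (M * N * norm z)"
      unfolding abs_mult by (intro mult_mono component_le_norm_cart H MN_nonneg mult_nonneg_nonneg) auto
    then show "z $ a * (H $ a $ b * z $ b) \<le> norm z * (M * N * norm z)" by linarith
  qed
  finally show ?thesis by (simp add: power2_eq_square mult_ac)
qed

lemma box_norm: "norm z \<le> CARD('m) * (1 / N) \<Longrightarrow> M * N * (real CARD('m))\<^sup>2 * (norm z)\<^sup>2 \<le> M * (real CARD('m)) ^ 4"
  for z :: "real^'m"
proof -
  assume z: "norm z \<le> CARD('m) * (1 / N)"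
  have "M * N * (real CARD('m))\<^sup>2 * (norm z)\<^sup>2 \<le> M * N * (real CARD('m))\<^sup>2 * (CARD('m) * (1 / N))\<^sup>2"
    using z MN_nonneg by (intro mult_left_mono power_mono) auto
  also have "\<dots> = M * (real CARD('m)) ^ 4 * (1 / N)"
    using N by (simp add: power_mult_distrib power_divide power2_eq_square power4_eq_xxxx)
  also have "\<dots> \<le> M * (real CARD('m)) ^ 4 * 1"
    using N M_nonneg by (intro mult_left_mono) auto
  finally show ?thesis by simp
qed

text \<open>On the cube of side \<open>1 / N\<close> the exponent of \<open>psi\<close> stays
  bounded. The power of \<open>N\<close> is not sharp; it only has to be beaten by the exponential
  tails.\<close>

lemma mass_lower: "exp (- (M * (real CARD('m)) ^ 4)) / N ^ CARD('m) \<le> mass"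
proof -
  have "exp (- (M * (real CARD('m)) ^ 4)) * (1 / N) ^ CARD('m) \<le> mass"
    unfolding mass_def
  proof (rule integral_ge_box[where ?x0.0 = 0])
    fix z :: "real^'m" assume "norm (z - 0) \<le> CARD('m) * (1 / N)"
    then have "M * N * (real CARD('m))\<^sup>2 * (norm z)\<^sup>2 \<le> M * (real CARD('m)) ^ 4"
      by (intro box_norm) simp
    moreover have "0 \<le> M * (real CARD('m)) ^ 4" using M_nonneg by simp
    ultimately show "exp (- (M * (real CARD('m)) ^ 4)) \<le> psi z"
      unfolding psi_def using H_quad_upper[of z] by simp
  qed (use N psi_pos in \<open>auto intro: integrable_psi simp: less_imp_le\<close>)
  then show ?thesis by (simp add: power_one_over field_simps)
qed

lemma mass_pos: "0 < mass"
  by (rule less_le_trans[OF _ mass_lower]) (use N in simp)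

text \<open>On the cube of side \<open>1 / N\<close> at the mode the density stays comparable with
  its maximum. As its integral is 1, the maximum is at most polynomial in \<open>N\<close>, and its
  logarithm at most linear.\<close>

lemma log_max_bound:
  assumes "integrable lborel (\<lambda>x. exp (f x))" "(\<integral>x. exp (f x) \<partial>lborel) = 1" "real CARD('m) / N < \<epsilon>"
  shows "f \<mu> \<le> (M * (real CARD('m)) ^ 4 + CARD('m)) * N"
proof -
  have "exp (f \<mu> - M * (real CARD('m)) ^ 4) * (1 / N) ^ CARD('m) \<le> (\<integral>x. exp (f x) \<partial>lborel)"
  proof (rule integral_ge_box[where ?x0.0 = \<mu>])
    fix x assume x: "norm (x - \<mu>) \<le> CARD('m) * (1 / N)"
    then have "f \<mu> - f (\<mu> + (x - \<mu>)) \<le> M * N * (real CARD('m))\<^sup>2 * (norm (x - \<mu>))\<^sup>2"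
      using assms(3) by (intro quadratic_lower) simp
    then show "exp (f \<mu> - M * (real CARD('m)) ^ 4) \<le> exp (f x)"
      using box_norm[OF x] by simp
  qed (use N assms in auto)
  then have "exp (f \<mu> - M * (real CARD('m)) ^ 4) \<le> N ^ CARD('m)"
    using N by (simp add: assms(2) power_one_over field_simps)
  also have "\<dots> = exp (CARD('m) * ln N)"
    using N by (simp add: exp_of_nat_mult)
  finally have "f \<mu> - M * (real CARD('m)) ^ 4 \<le> CARD('m) * ln N"
    by simp
  also have "\<dots> \<le> CARD('m) * N"
    using ln_le_minus_one[of N] N by (intro mult_left_mono) auto
  finally have "f \<mu> \<le> M * (real CARD('m)) ^ 4 * 1 + CARD('m) * N"
    by simp
  also have "\<dots> \<le> M * (real CARD('m)) ^ 4 * N + CARD('m) * N"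
    using N M_nonneg by (intro add_mono mult_left_mono) auto
  finally show ?thesis by (simp add: distrib_right)
qed

end

section \<open>The volume-corrected scan\<close>

context peaked
begin

text \<open>The scan direction rescaled to have \<open>j\<close>-th component 1, so that the scan
  variable is the displacement of the \<open>j\<close>-th coordinate. As \<open>H\<close> maps it to
  a multiple of \<open>axis j 1\<close>, it minimises the quadratic form of \<open>H\<close> among
  the vectors with that component.\<close>

definition w :: "'m \<Rightarrow> real^'m" where
  "w j = (1 / Om $ j $ j) *\<^sub>R column j Om"

lemma w_eq: "w j = (1 / Om $ j $ j) *\<^sub>R (Om *v axis j 1)"
  by (simp add: w_def matrix_vector_mult_basis)

lemma w_component: "w j $ i = Om $ i $ j / Om $ j $ j"
  by (simp add: w_def column_def)

lemma H_w: "H *v w j = (1 / Om $ j $ j) *\<^sub>R axis j 1"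
  by (simp add: w_eq matrix_vector_mult_scaleR H_Om)

lemma w_quad: "w j \<bullet> (H *v w j) = 1 / Om $ j $ j"
  using Om_diag_pos[of j] by (simp add: H_w inner_axis w_component)

lemma curvature_lower: "\<kappa> * N \<le> 1 / Om $ j $ j"
  using Om_entry[of j j] Om_diag_pos[of j] c_pos by (simp add: field_simps)

text \<open>By the minimality of \<open>w j\<close>, the form at \<open>axis j 1\<close> exceeds the
  form at \<open>w j\<close> by the form at their difference, which is nonnegative.\<close>

lemma curvature_upper: "1 / Om $ j $ j \<le> M * N"
proof -
  have "0 \<le> \<kappa> * N * ((axis j 1 - w j) \<bullet> (axis j 1 - w j))"
    using c_pos by simp
  also have "\<dots> \<le> (axis j 1 - w j) \<bullet> (H *v (axis j 1 - w j))"
    by (rule coercive)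
  also have "\<dots> = H $ j $ j - 1 / Om $ j $ j"
  proof -
    have "axis j 1 \<bullet> (H *v axis j 1) = H $ j $ j"
      by (simp add: inner_axis' matrix_vector_mul_component inner_axis)
    moreover have "axis j 1 \<bullet> (H *v w j) = 1 / Om $ j $ j"
      by (simp add: H_w inner_axis')
    moreover have "w j \<bullet> (H *v axis j 1) = 1 / Om $ j $ j"
      using inner_H[of "w j" "axis j 1"] by (simp add: H_w inner_axis')
    ultimately show ?thesis
      using w_quad[of j] by (simp add: matrix_vector_mult_diff_distrib inner_diff_left inner_diff_right)
  qed
  also have "H $ j $ j \<le> M * N"
    using bounded_derivs_onD(3)[OF smooth, of "[j, j]" \<mu>] \<mu>_in H_entry[of j j] by simp
  finally show ?thesis by simp
qed

text \<open>Bounds the norm of \<open>w j\<close>: coercivity is compared with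
  \<open>curvature_upper\<close>, and the factors \<open>N\<close> cancel.\<close>

definition W :: real where "W = sqrt (M / \<kappa>)"

lemma W_nonneg: "0 \<le> W"
  using M_nonneg \<kappa> by (simp add: W_def)

lemma w_norm: "norm (w j) \<le> W"
proof -
  have "\<kappa> * N * (norm (w j))\<^sup>2 \<le> M * N"
    using coercive[of "w j"] curvature_upper[of j] by (simp add: w_quad power2_norm_eq_inner)
  then have "(norm (w j))\<^sup>2 \<le> M / \<kappa>"
    using N \<kappa> by (simp add: field_simps)
  then show ?thesis unfolding W_def by (rule real_le_rsqrt)
qed

text \<open>The volume slope per unit of the \<open>j\<close>-th coordinate; the slope along the
  scan direction itself is \<open>sqrt (Om $ j $ j)\<close> times this.\<close>

definition beta :: "'m \<Rightarrow> real" where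
  "beta j = (\<Sum>a\<in>UNIV. \<Sum>b\<in>UNIV. (\<Sum>c\<in>UNIV. w j $ c * T c a b) * Om_cond j $ b $ a) / 2"

definition p :: "'m \<Rightarrow> real" where "p j = (\<Sum>i\<in>UNIV. w j $ i * Q i (w j)) / 2"

definition q :: "'m \<Rightarrow> real" where "q j = (\<Sum>i\<in>UNIV. w j $ i * C i (w j)) / 6"

lemma hessian_line:
  "((\<lambda>s. (- hessian f (\<mu> + s *\<^sub>R v)) $ a $ b) has_real_derivative - (\<Sum>c\<in>UNIV. v $ c * T c a b)) (at 0)"
proof -
  have "((\<lambda>s. dir_deriv 0 v (partial a (partial b f)) (\<mu> + s *\<^sub>R v)) has_real_derivative
      dir_deriv (Suc 0) v (partial a (partial b f)) (\<mu> + 0 *\<^sub>R v)) (at 0)"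
    by (rule dir_deriv_has_derivative[OF smooth_hess]) (use \<mu>_in in auto)
  from DERIV_minus[OF this] show ?thesis
    by (simp add: hessian_def T_def)
qed

text \<open>Two signs cancel: differentiating the negative Hessian produces minus the third
  derivatives, and the log-volume carries the factor \<open>- (1/2)\<close>.\<close>

lemma log_volume_derivative:
  "((\<lambda>s. - (1/2) * ln (submatrix_det (- hessian f (\<mu> + s *\<^sub>R v)) (- {j}))) has_real_derivative
     (\<Sum>a\<in>UNIV. \<Sum>b\<in>UNIV. (\<Sum>c\<in>UNIV. v $ c * T c a b) * Om_cond j $ b $ a) / 2) (at 0)"
proof -
  have "((\<lambda>s. ln (submatrix_det (- hessian f (\<mu> + s *\<^sub>R v)) (- {j}))) has_real_derivative
      (\<Sum>a\<in>UNIV. \<Sum>b\<in>UNIV. (\<chi> a b. - (\<Sum>c\<in>UNIV. v $ c * T c a b)) $ a $ b * Om_cond j $ b $ a)) (at 0)"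
    by (rule ln_submatrix_det_derivative) (use hessian_line in \<open>auto simp: H_def\<close>)
  from DERIV_cmult[OF this, of "- (1/2)"] show ?thesis
    by (simp add: sum_negf)
qed

lemma scan_expansion:
  fixes j :: 'm
  assumes x: "\<bar>x\<bar> * W < \<epsilon>"
  defines "h' \<equiv> \<lambda>x. (\<Sum>i\<in>UNIV. w j $ i * partial i f (\<mu> + x *\<^sub>R w j)) + beta j"
  shows "((\<lambda>x. f (\<mu> + x *\<^sub>R w j) + x * beta j) has_real_derivative h' x) (at x)"
    and "isCont h' x"
    and "\<bar>h' x - (- (1 / Om $ j $ j) * x + beta j + p j * x\<^sup>2 + q j * x ^ 3)\<bar>
      \<le> (M * (real CARD('m)) ^ 5 * W ^ 5) * N * x ^ 4"
proof -
  have small: "norm (x *\<^sub>R w j) < \<epsilon>"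
    using x mult_left_mono[OF w_norm[of j], of "\<bar>x\<bar>"] by simp
  have line: "((\<lambda>x. g (\<mu> + x *\<^sub>R w j)) has_real_derivative dir_deriv 1 (w j) g (\<mu> + x *\<^sub>R w j)) (at x)"
    if "bounded_derivs_on 1 (M * N) (ball \<mu> \<epsilon>) g" for g
    using dir_deriv_has_derivative[of 0 "M * N" "ball \<mu> \<epsilon>" g \<mu> x "w j"] that in_ball[OF small] by simp
  show "((\<lambda>x. f (\<mu> + x *\<^sub>R w j) + x * beta j) has_real_derivative h' x) (at x)"
    using DERIV_add[OF line[OF smooth_le[of 1]] DERIV_cmult_right[OF DERIV_ident, of "beta j"]]
    by (simp add: h'_def)
  have "isCont (\<lambda>x. partial i f (\<mu> + x *\<^sub>R w j)) x" for i
    by (rule DERIV_isCont[OF line[OF smooth_grad]]) simp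
  then show "isCont h' x"
    unfolding h'_def by (intro continuous_intros)
  have scaled: "(H *v (x *\<^sub>R w j)) $ i = x * (H *v w j) $ i" "Q i (x *\<^sub>R w j) = x\<^sup>2 * Q i (w j)"
    "C i (x *\<^sub>R w j) = x ^ 3 * C i (w j)" for i
    by (simp_all add: matrix_vector_mult_scaleR Q_def C_def dir_deriv_scale sum_distrib_left power2_eq_square mult_ac)
  define rem where "rem i = partial i f (\<mu> + x *\<^sub>R w j) - (- x * (H *v w j) $ i + x\<^sup>2 * Q i (w j) / 2 + x ^ 3 * C i (w j) / 6)" for i
  have g: "\<bar>rem i\<bar>
      \<le> M * N * (real CARD('m)) ^ 4 * (x ^ 4 * W ^ 4)" for i
  proof -
    have "norm (x *\<^sub>R w j) ^ 4 \<le> x ^ 4 * W ^ 4"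
      using power_mono[OF w_norm[of j], of 4] by (simp add: power_mult_distrib mult_left_mono)
    then have "M * N * (real CARD('m)) ^ 4 * norm (x *\<^sub>R w j) ^ 4 / 24 \<le> M * N * (real CARD('m)) ^ 4 * (x ^ 4 * W ^ 4) / 1"
      using M_nonneg N W_nonneg by (intro frac_le mult_left_mono mult_nonneg_nonneg) auto
    then show ?thesis
      using grad_taylor[OF small, of i] unfolding rem_def scaled by simp
  qed
  have lin: "(\<Sum>i\<in>UNIV. w j $ i * (H *v w j) $ i) = 1 / Om $ j $ j"
    using w_quad[of j] by (simp add: inner_vec_def)
  have eq: "h' x - (- (1 / Om $ j $ j) * x + beta j + p j * x\<^sup>2 + q j * x ^ 3)
      = (\<Sum>i\<in>UNIV. w j $ i * rem i)"
  proof -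
    have "(\<Sum>i\<in>UNIV. w j $ i * rem i)
        = (\<Sum>i\<in>UNIV. w j $ i * partial i f (\<mu> + x *\<^sub>R w j)) + x * (\<Sum>i\<in>UNIV. w j $ i * (H *v w j) $ i)
          - x\<^sup>2 * p j - x ^ 3 * q j"
      by (simp add: rem_def p_def q_def sum_distrib_left sum_divide_distrib sum.distrib[symmetric] sum_subtractf[symmetric] algebra_simps)
    then show ?thesis
      unfolding lin h'_def by (simp add: algebra_simps)
  qed
  have "\<bar>h' x - (- (1 / Om $ j $ j) * x + beta j + p j * x\<^sup>2 + q j * x ^ 3)\<bar>
      \<le> (\<Sum>i\<in>(UNIV::'m set). W * (M * N * (real CARD('m)) ^ 4 * (x ^ 4 * W ^ 4)))"
    unfolding eq
  proof (rule order.trans[OF sum_abs], rule sum_mono)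
    fix i
    show "\<bar>w j $ i * rem i\<bar>
        \<le> W * (M * N * (real CARD('m)) ^ 4 * (x ^ 4 * W ^ 4))"
      unfolding abs_mult[of "w j $ i"]
      by (intro mult_mono g order.trans[OF component_le_norm_cart w_norm] W_nonneg) simp
  qed
  also have "\<dots> = (M * (real CARD('m)) ^ 5 * W ^ 5) * N * x ^ 4"
    by (simp add: eval_nat_numeral mult_ac)
  finally show "\<bar>h' x - (- (1 / Om $ j $ j) * x + beta j + p j * x\<^sup>2 + q j * x ^ 3)\<bar>
      \<le> (M * (real CARD('m)) ^ 5 * W ^ 5) * N * x ^ 4" .
qed

text \<open>The factor \<open>N\<close> of the third derivatives cancels against the
  \<open>1 / N\<close> of \<open>Om_cond\<close>, so the bound is free of \<open>N\<close>, unlike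
  those for \<open>p\<close> and \<open>q\<close>.\<close>

lemma beta_bound: "\<bar>beta j\<bar> \<le> (real CARD('m)) ^ 3 * W * M * (1 + W\<^sup>2) / \<kappa>"
proof -
  have cond: "\<bar>Om_cond j $ b $ a\<bar> \<le> (1 + W\<^sup>2) / (\<kappa> * N)" for a b
  proof -
    have "Om_cond j $ b $ a = Om $ b $ a - Om $ j $ j * (w j $ b * w j $ a)"
      using Om_diag_pos[of j] Om_sym[of j a] by (simp add: Om_cond_def w_component)
    moreover have "\<bar>Om $ j $ j * (w j $ b * w j $ a)\<bar> \<le> 1 / (\<kappa> * N) * (W * W)"
      unfolding abs_mult using c_pos W_nonneg
      by (intro mult_mono Om_entry order.trans[OF component_le_norm_cart w_norm]) auto
    ultimately show ?thesis
      using Om_entry[of b a] by (simp add: add_divide_distrib power2_eq_square)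
  qed
  have row: "\<bar>\<Sum>c\<in>UNIV. w j $ c * T c a b\<bar> \<le> real CARD('m) * (W * (M * N))" for a b
  proof -
    have "\<bar>\<Sum>c\<in>UNIV. w j $ c * T c a b\<bar> \<le> (\<Sum>c\<in>(UNIV::'m set). W * (M * N))"
      by (rule order.trans[OF sum_abs], rule sum_mono)
        (auto simp: abs_mult intro!: mult_mono T_bound order.trans[OF component_le_norm_cart w_norm] W_nonneg)
    then show ?thesis by simp
  qed
  have "\<bar>\<Sum>a\<in>UNIV. \<Sum>b\<in>UNIV. (\<Sum>c\<in>UNIV. w j $ c * T c a b) * Om_cond j $ b $ a\<bar>
      \<le> (\<Sum>a\<in>(UNIV::'m set). \<Sum>b\<in>(UNIV::'m set). real CARD('m) * (W * (M * N)) * ((1 + W\<^sup>2) / (\<kappa> * N)))"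
    by (rule order.trans[OF sum_abs], rule sum_mono, rule order.trans[OF sum_abs], rule sum_mono)
      (auto simp only: abs_mult intro!: mult_mono row cond mult_nonneg_nonneg W_nonneg MN_nonneg)
  also have "\<dots> = (real CARD('m)) ^ 3 * W * M * (1 + W\<^sup>2) / \<kappa>"
    using N by (simp add: power3_eq_cube)
  finally show ?thesis
    unfolding beta_def by (rule order.trans[rotated]) simp
qed

lemma p_bound: "\<bar>p j\<bar> \<le> (M * (real CARD('m)) ^ 3 * W ^ 3) * N"
proof -
  have "\<bar>\<Sum>i\<in>UNIV. w j $ i * Q i (w j)\<bar> \<le> (\<Sum>i\<in>(UNIV::'m set). W * (M * N * (real CARD('m))\<^sup>2 * W\<^sup>2))"
  proof (rule order.trans[OF sum_abs], rule sum_mono)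
    fix i
    have "\<bar>Q i (w j)\<bar> \<le> M * N * (real CARD('m))\<^sup>2 * W\<^sup>2"
      using Q_bound[of i "w j"] mult_left_mono[OF power_mono[OF w_norm[of j], of 2], of "M * N * (real CARD('m))\<^sup>2"] MN_nonneg
      by simp
    then show "\<bar>w j $ i * Q i (w j)\<bar> \<le> W * (M * N * (real CARD('m))\<^sup>2 * W\<^sup>2)"
      unfolding abs_mult by (intro mult_mono order.trans[OF component_le_norm_cart w_norm] W_nonneg) auto
  qed
  also have "\<dots> = (M * (real CARD('m)) ^ 3 * W ^ 3) * N"
    by (simp add: power2_eq_square power3_eq_cube mult_ac)
  finally show ?thesis by (simp add: p_def)
qed

lemma q_bound: "\<bar>q j\<bar> \<le> (M * (real CARD('m)) ^ 4 * W ^ 4) * N"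
proof -
  have "\<bar>\<Sum>i\<in>UNIV. w j $ i * C i (w j)\<bar> \<le> (\<Sum>i\<in>(UNIV::'m set). W * (M * N * (real CARD('m)) ^ 3 * W ^ 3))"
  proof (rule order.trans[OF sum_abs], rule sum_mono)
    fix i
    have "\<bar>C i (w j)\<bar> \<le> M * N * (real CARD('m)) ^ 3 * W ^ 3"
      using C_bound[of i "w j"] mult_left_mono[OF power_mono[OF w_norm[of j], of 3], of "M * N * (real CARD('m)) ^ 3"] MN_nonneg
      by simp
    then show "\<bar>w j $ i * C i (w j)\<bar> \<le> W * (M * N * (real CARD('m)) ^ 3 * W ^ 3)"
      unfolding abs_mult by (intro mult_mono order.trans[OF component_le_norm_cart w_norm] W_nonneg) auto
  qed
  also have "\<dots> = (M * (real CARD('m)) ^ 4 * W ^ 4) * N"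
    by (simp add: power3_eq_cube power4_eq_xxxx mult_ac)
  finally show ?thesis by (simp add: q_def)
qed

lemma scan_shift_eq_dstar: "beta j / (1 / Om $ j $ j) + p j / (1 / Om $ j $ j)\<^sup>2 = dstar $ j"
proof -
  define v where "v = w j"
  define r where "r = Om $ j $ j"
  have r: "r \<noteq> 0" using Om_diag_pos[of j] by (simp add: r_def)
  define A where "A = (\<Sum>a\<in>UNIV. \<Sum>b\<in>UNIV. \<Sum>c\<in>UNIV. v $ c * T c a b * Om $ b $ a)"
  define B where "B = (\<Sum>a\<in>UNIV. \<Sum>b\<in>UNIV. \<Sum>c\<in>UNIV. v $ c * T c a b * (v $ b * v $ a))"
  have cond: "Om_cond j $ b $ a = Om $ b $ a - r * (v $ b * v $ a)" for a b
    using r Om_sym[of j a] by (simp add: Om_cond_def v_def r_def w_component)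
  have beta: "beta j = (A - r * B) / 2"
    unfolding beta_def A_def B_def cond v_def[symmetric]
    by (simp add: sum_distrib_right sum_distrib_left right_diff_distrib sum_subtractf mult_ac)
  have p: "p j = B / 2"
  proof -
    have "(\<Sum>i\<in>UNIV. v $ i * Q i v) = (\<Sum>i\<in>UNIV. \<Sum>k\<in>UNIV. \<Sum>l\<in>UNIV. v $ l * T l k i * (v $ i * v $ k))"
      by (simp add: Q_def sum_distrib_left mult_ac)
    also have "\<dots> = B"
      unfolding B_def by (rule sum.swap)
    finally show ?thesis by (simp add: p_def v_def[symmetric])
  qed
  \<comment> \<open>The volume slope has the direction in the first index of \<open>T\<close>, while
    \<open>tau\<close> has its free index last; \<open>T_rotate\<close> reconciles the two.\<close>
  have "(Om *v tau) $ j = (\<Sum>c\<in>UNIV. r * v $ c * (\<Sum>k\<in>UNIV. \<Sum>l\<in>UNIV. T c l k * Om $ k $ l))"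
  proof -
    have "Om $ j $ c = r * v $ c" for c
      using r Om_sym[of j c] by (simp add: v_def r_def w_component)
    then show ?thesis
      by (simp add: matrix_vector_mult_def tau_def T_rotate[of _ _ c for c])
  qed
  also have "\<dots> = r * (\<Sum>c\<in>UNIV. \<Sum>b\<in>UNIV. \<Sum>a\<in>UNIV. v $ c * T c a b * Om $ b $ a)"
    by (simp add: sum_distrib_left mult_ac)
  also have "(\<Sum>c\<in>UNIV. \<Sum>b\<in>UNIV. \<Sum>a\<in>UNIV. v $ c * T c a b * Om $ b $ a) = A"
    unfolding A_def by (subst sum.swap, subst (2) sum.swap, subst sum.swap) (rule refl)
  finally have "dstar $ j = r * A / 2"
    by (simp add: dstar_def)
  then show ?thesis
    unfolding beta p r_def[symmetric] using r by (simp add: field_simps power2_eq_square)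
qed

end

section \<open>Asymptotics\<close>

context gaussian_weight
begin

lemma Om_mult_H: "Om ** H = mat 1"
  unfolding Om_def by (rule matrix_inv_mult(2)[OF invertible_H])

lemma det_Om_pos: "0 < det Om"
proof (rule pos_def_det_pos)
  fix u :: "real^'m" assume "u \<noteq> 0"
  then have "Om *v u \<noteq> 0"
    using H_Om[of u] by (metis matrix_vector_mult_0_right)
  then have "0 < c * ((Om *v u) \<bullet> (Om *v u))"
    using c_pos by simp
  also have "\<dots> \<le> (Om *v u) \<bullet> u"
    using coercive[of "Om *v u"] by (simp add: H_Om)
  finally show "0 < u \<bullet> (Om *v u)"
    by (simp add: inner_commute)
qed

definition norm_const :: real where "norm_const = sqrt ((2 * pi) ^ CARD('m) * det Om)"

lemma norm_const_pos: "0 < norm_const"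
  using det_Om_pos by (simp add: norm_const_def)

lemma mvn_density_eq: "mvn_density \<nu> Om x = psi (x - \<nu>) / norm_const"
  by (simp add: mvn_density_def psi_def norm_const_def matrix_inv_unique[OF Om_mult_H])

text \<open>The normalising constant does not depend on the centre, so maximising the variational
  objective over the shift amounts to maximising an integral against \<open>psi\<close>.\<close>

lemma mvn_expectation:
  assumes [measurable]: "g \<in> borel_measurable borel"
  shows "integrable (mvn \<nu> Om) g \<longleftrightarrow> integrable lborel (\<lambda>z. psi z * g (\<nu> + z))"
    and "(\<integral>x. g x \<partial>mvn \<nu> Om) = (\<integral>z. psi z * g (\<nu> + z) \<partial>lborel) / norm_const"
proof -
  have psi_m [measurable]: "(\<lambda>x. psi (x - \<nu>)) \<in> borel_measurable borel"
    by (rule measurable_compose[OF _ measurable_psi]) simp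
  have dens: "mvn_density \<nu> Om = (\<lambda>x. psi (x - \<nu>) / norm_const)"
    using mvn_density_eq by blast
  have "integrable (mvn \<nu> Om) g \<longleftrightarrow> integrable lborel (\<lambda>x. psi (x - \<nu>) / norm_const * g x)"
    unfolding mvn_def dens using psi_pos norm_const_pos
    by (subst integrable_density) (auto simp: less_imp_le)
  also have "\<dots> \<longleftrightarrow> integrable lborel (\<lambda>x. psi (x - \<nu>) * g x)"
  proof -
    have "(\<lambda>x. psi (x - \<nu>) / norm_const * g x) = (\<lambda>x. 1 / norm_const * (psi (x - \<nu>) * g x))"
      by auto
    then show ?thesis
      using norm_const_pos by (simp only: integrable_mult_left_iff) simp
  qed
  also have "\<dots> \<longleftrightarrow> integrable lborel (\<lambda>z. psi z * g (\<nu> + z))"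
    using integrable_lborel_translate[of "\<lambda>x. psi (x - \<nu>) * g x" \<nu>]
      integrable_lborel_translate[of "\<lambda>z. psi z * g (\<nu> + z)" "- \<nu>"] by auto
  finally show "integrable (mvn \<nu> Om) g \<longleftrightarrow> integrable lborel (\<lambda>z. psi z * g (\<nu> + z))" .
  have "(\<integral>x. g x \<partial>mvn \<nu> Om) = (\<integral>x. psi (x - \<nu>) / norm_const * g x \<partial>lborel)"
    unfolding mvn_def dens using psi_pos norm_const_pos
    by (subst integral_density) (auto simp: less_imp_le)
  also have "\<dots> = (\<integral>x. psi (x - \<nu>) * g x \<partial>lborel) / norm_const"
    by simp
  also have "(\<integral>x. psi (x - \<nu>) * g x \<partial>lborel) = (\<integral>z. psi z * g (\<nu> + z) \<partial>lborel)"
    using integral_lborel_translate[of "\<lambda>x. psi (x - \<nu>) * g x" \<nu>] by simp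
  finally show "(\<integral>x. g x \<partial>mvn \<nu> Om) = (\<integral>z. psi z * g (\<nu> + z) \<partial>lborel) / norm_const" .
qed

text \<open>Tail decay is measured relative to the density at its centre, where \<open>psi\<close>
  is 1. The ratio is thus exactly \<open>psi\<close>, and a translation moves the centre to
  0.\<close>

lemma mvn_tail:
  assumes [measurable]: "g \<in> borel_measurable borel"
    and int: "set_integrable lborel (- ball \<nu> \<rho>) (\<lambda>x. \<bar>g x\<bar> * (mvn_density \<nu> Om x / mvn_density \<nu> Om \<nu>))"
  shows "integrable lborel (\<lambda>z. indicator (- ball 0 \<rho>) z * (psi z * \<bar>g (\<nu> + z)\<bar>))"
    and "(LINT x:- ball \<nu> \<rho>|lborel. \<bar>g x\<bar> * (mvn_density \<nu> Om x / mvn_density \<nu> Om \<nu>))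
      = (\<integral>z. indicator (- ball 0 \<rho>) z * (psi z * \<bar>g (\<nu> + z)\<bar>) \<partial>lborel)"
proof -
  have psi_m [measurable]: "(\<lambda>x. psi (x - \<nu>)) \<in> borel_measurable borel"
    by (rule measurable_compose[OF _ measurable_psi]) simp
  define F where "F x = indicator (- ball \<nu> \<rho>) x * (\<bar>g x\<bar> * psi (x - \<nu>))" for x
  have psi_0: "psi 0 = 1"
    by (simp add: psi_def)
  have ratio: "mvn_density \<nu> Om x / mvn_density \<nu> Om \<nu> = psi (x - \<nu>)" for x
    using norm_const_pos by (simp add: mvn_density_eq psi_0)
  have shift: "F (\<nu> + z) = indicator (- ball 0 \<rho>) z * (psi z * \<bar>g (\<nu> + z)\<bar>)" for z
    by (simp add: F_def indicator_def dist_norm)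
  have "integrable lborel F"
    using int unfolding set_integrable_def ratio F_def by simp
  from integrable_lborel_translate[OF this, of \<nu>]
  show "integrable lborel (\<lambda>z. indicator (- ball 0 \<rho>) z * (psi z * \<bar>g (\<nu> + z)\<bar>))"
    unfolding shift .
  have "F \<in> borel_measurable borel"
    unfolding F_def by measurable
  from integral_lborel_translate[OF this, of \<nu>]
  show "(LINT x:- ball \<nu> \<rho>|lborel. \<bar>g x\<bar> * (mvn_density \<nu> Om x / mvn_density \<nu> Om \<nu>))
      = (\<integral>z. indicator (- ball 0 \<rho>) z * (psi z * \<bar>g (\<nu> + z)\<bar>) \<partial>lborel)"
    unfolding shift unfolding set_lebesgue_integral_def ratio F_def by simp
qed

end

text \<open>With \<open>e = x / N\<^sup>2\<close> all three terms become multiples of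
  \<open>1 / N ^ 3\<close>, which is why the tails are needed at that rate. What remains is
  \<open>\<kappa> * x\<^sup>2 / 8 \<le> A * x + B\<close>, and for \<open>x > 1\<close> the constant
  \<open>B\<close> is at most \<open>B * x\<close>.\<close>

lemma quadratic_bound:
  fixes e :: real
  assumes "0 < \<kappa>" "1 \<le> N" "0 \<le> A" "0 \<le> B" "0 \<le> e"
    and le: "\<kappa> * N / 8 * e\<^sup>2 \<le> A * e / N + B / N ^ 3"
  shows "e \<le> (8 * (A + B) / \<kappa> + 1) / N\<^sup>2"
proof -
  define x where "x = e * N\<^sup>2"
  have x: "0 \<le> x" "e = x / N\<^sup>2"
    using assms by (auto simp: x_def)
  have scaled: "\<kappa> * x\<^sup>2 / 8 / N ^ 3 \<le> (A * x + B) / N ^ 3"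
    using le assms(2) unfolding x(2)
    by (simp add: add_divide_distrib power_divide eval_nat_numeral)
  have "0 < N ^ 3" using assms(2) by simp
  then have q: "\<kappa> * x\<^sup>2 / 8 \<le> A * x + B"
    using scaled[unfolded divide_le_cancel[of _ "N ^ 3"]] by blast
  have "x \<le> 8 * (A + B) / \<kappa> + 1"
  proof (cases "x \<le> 1")
    case True
    moreover have "0 \<le> 8 * (A + B) / \<kappa>" using assms by simp
    ultimately show ?thesis by linarith
  next
    case False
    have "B * 1 \<le> B * x" using False assms by (intro mult_left_mono) auto
    then have "\<kappa> * x * x \<le> 8 * (A + B) * x"
      using q by (simp add: power2_eq_square algebra_simps)
    then have "\<kappa> * x \<le> 8 * (A + B)"
      using False by (subst (asm) mult_le_cancel_right) auto
    then show ?thesis using assms(1) by (simp add: field_simps)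
  qed
  then show ?thesis
    unfolding x(2) by (rule divide_right_mono) simp
qed

context peaked
begin

text \<open>The lower bound on the mass consumes \<open>CARD('m)\<close> powers of \<open>N\<close>,
  and three more are left for \<open>quadratic_bound\<close>; hence the exponent
  \<open>CARD('m) + 3\<close>.\<close>

definition tail_const :: "real \<Rightarrow> real \<Rightarrow> real" where
  "tail_const A c = A * fact (CARD('m) + 3) / c ^ (CARD('m) + 3) * exp (M * (real CARD('m)) ^ 4)"

lemma tail_const_nonneg: "0 \<le> A \<Longrightarrow> 0 < c \<Longrightarrow> 0 \<le> tail_const A c"
  by (simp add: tail_const_def)

lemma tail_le_mass:
  assumes "0 \<le> A" "0 < c"
  shows "A * exp (- c * N) \<le> tail_const A c / N ^ 3 * mass"
proof -
  let ?k = "CARD('m) + 3"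
  have "A * exp (- (c * N)) \<le> A * (fact ?k / (c * N) ^ ?k)"
    using assms N by (intro mult_left_mono exp_minus_le_power) auto
  also have "\<dots> = A * fact ?k / c ^ ?k / N ^ 3 * (1 / N ^ CARD('m))"
    by (simp add: power_mult_distrib power_add)
  also have "\<dots> \<le> A * fact ?k / c ^ ?k / N ^ 3 * (exp (M * (real CARD('m)) ^ 4) * mass)"
  proof (rule mult_left_mono)
    have "exp (M * (real CARD('m)) ^ 4) * (exp (- (M * (real CARD('m)) ^ 4)) / N ^ CARD('m)) \<le> exp (M * (real CARD('m)) ^ 4) * mass"
      by (intro mult_left_mono mass_lower) simp
    then show "1 / N ^ CARD('m) \<le> exp (M * (real CARD('m)) ^ 4) * mass"
      by (simp add: exp_minus)
  qed (use assms N in auto)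
  finally show ?thesis by (simp add: tail_const_def)
qed

lemma vb_expansion:
  assumes \<rho>: "0 < \<rho>" "norm dstar + \<rho> \<le> rad" "norm \<delta> + \<rho> \<le> rad" "16 * real CARD('m) / (\<kappa> * \<rho>\<^sup>2) \<le> N"
    and int: "integrable lborel (\<lambda>z. psi z * f (\<mu> + (\<delta> + z)))" "integrable lborel (\<lambda>z. psi z * f (\<mu> + (dstar + z)))"
    and opt: "(\<integral>z. psi z * f (\<mu> + (dstar + z)) \<partial>lborel) \<le> (\<integral>z. psi z * f (\<mu> + (\<delta> + z)) \<partial>lborel)"
    and C: "0 \<le> C1" "0 < c1" "0 \<le> C2" "0 < c2"
    and tail: "outside \<rho> (\<lambda>z. psi z * \<bar>f (\<mu> + (\<delta> + z))\<bar>) \<le> C1 * exp (- c1 * N)"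
      "outside \<rho> (\<lambda>z. psi z * \<bar>f (\<mu> + (dstar + z))\<bar>) \<le> C2 * exp (- c2 * N)"
  shows "norm (\<delta> - dstar) \<le> (8 * (real CARD('m) * KG \<rho> + (tail_const C1 c1 + tail_const C2 c2)) / \<kappa> + 1) / N\<^sup>2"
proof -
  define e where "e = norm (\<delta> - dstar)"
  have "\<kappa> * N / 8 * e\<^sup>2 * mass \<le> real CARD('m) * e * (KG \<rho> / N * mass) + C1 * exp (- c1 * N) + C2 * exp (- c2 * N)"
    unfolding e_def by (rule vb_compare[OF \<rho> int opt tail])
  also have "\<dots> \<le> real CARD('m) * e * (KG \<rho> / N * mass) + tail_const C1 c1 / N ^ 3 * mass + tail_const C2 c2 / N ^ 3 * mass"
    by (intro add_mono order_refl tail_le_mass C)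
  also have "\<dots> = (real CARD('m) * KG \<rho> * e / N + (tail_const C1 c1 + tail_const C2 c2) / N ^ 3) * mass"
    by (simp add: algebra_simps add_divide_distrib)
  finally have le: "\<kappa> * N / 8 * e\<^sup>2 \<le> real CARD('m) * KG \<rho> * e / N + (tail_const C1 c1 + tail_const C2 c2) / N ^ 3"
    using mass_pos by (subst (asm) mult_le_cancel_right) auto
  show ?thesis
    unfolding e_def[symmetric]
    by (rule quadratic_bound[OF \<kappa> N _ _ _ le])
      (use KG_nonneg[OF \<rho>(1)] C in \<open>auto simp: e_def intro!: add_nonneg_nonneg tail_const_nonneg\<close>)
qed

text \<open>Relative to the mass, the left side of \<open>vb_far\<close> grows linearly in
  \<open>N\<close> while the right side stays bounded, so a far correction is impossible for large
  \<open>N\<close>.\<close>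

lemma vb_near:
  assumes far: "0 < \<eta>" "0 < c" "\<And>x. \<eta> / 2 \<le> dist x \<mu> \<Longrightarrow> f x \<le> f \<mu> - c * N"
    and large: "64 * real CARD('m) / (\<kappa> * \<eta>\<^sup>2) \<le> N"
      "2 * (far_const B \<rho> + tail_const Ct ct) / c < N"
    and \<rho>: "0 < \<rho>" "\<rho> \<le> rad" and B: "0 \<le> B" "f \<mu> \<le> B * N"
    and int: "integrable lborel (\<lambda>z. psi z * f (\<mu> + (\<delta> + z)))" "integrable lborel (\<lambda>z. psi z * f (\<mu> + z))"
    and opt: "(\<integral>z. psi z * f (\<mu> + z) \<partial>lborel) \<le> (\<integral>z. psi z * f (\<mu> + (\<delta> + z)) \<partial>lborel)"
    and C: "0 \<le> Ct" "0 < ct"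
    and tail: "outside \<rho> (\<lambda>z. psi z * \<bar>f (\<mu> + z)\<bar>) \<le> Ct * exp (- ct * N)"
  shows "norm \<delta> < \<eta>"
proof (rule ccontr)
  assume "\<not> norm \<delta> < \<eta>"
  then have "\<eta> \<le> norm \<delta>" by simp
  have N3: "1 \<le> N ^ 3" using N by (rule one_le_power)
  have "c * N / 2 * mass \<le> far_const B \<rho> * mass + Ct * exp (- ct * N)"
    by (rule vb_far[OF far \<open>\<eta> \<le> norm \<delta>\<close> large(1) \<rho> B int opt tail])
  also have "\<dots> \<le> far_const B \<rho> * mass + tail_const Ct ct / N ^ 3 * mass"
    by (intro add_mono order_refl tail_le_mass C)
  also have "\<dots> \<le> far_const B \<rho> * mass + tail_const Ct ct / 1 * mass"
    using tail_const_nonneg[OF C] N N3 mass_pos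
    by (intro add_mono order_refl mult_right_mono divide_left_mono) auto
  also have "\<dots> = (far_const B \<rho> + tail_const Ct ct) * mass"
    by (simp add: distrib_right)
  finally have "c * N / 2 \<le> far_const B \<rho> + tail_const Ct ct"
    using mass_pos by (subst (asm) mult_le_cancel_right) auto
  then have "N \<le> 2 * (far_const B \<rho> + tail_const Ct ct) / c"
    using far(2) by (simp add: field_simps)
  then show False
    using large(2) by simp
qed

end

text \<open>The same \<open>\<kappa>\<close>, \<open>M\<close> and \<open>\<epsilon>\<close> serve
  all large \<open>n\<close>, so the constants of \<open>peaked\<close> become constants of the
  whole sequence.\<close>

locale posterior_sequence =
  fixes post :: "nat \<Rightarrow> real^'m \<Rightarrow> real" and mode :: "nat \<Rightarrow> real^'m" and \<kappa> M \<epsilon> :: real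
  assumes peaked_ev: "\<forall>\<^sub>F n in sequentially.
      peaked (neg_log_hessian (post n) (mode n)) \<kappa> (real n) (\<lambda>x. ln (post n x)) (mode n) M \<epsilon>"
    and meas_ev: "\<forall>\<^sub>F n in sequentially. (\<lambda>x. ln (post n x)) \<in> borel_measurable borel"
    and regular: "laplace_regular post mode"
begin

abbreviation H :: "nat \<Rightarrow> real^'m^'m" where "H n \<equiv> neg_log_hessian (post n) (mode n)"
abbreviation f :: "nat \<Rightarrow> real^'m \<Rightarrow> real" where "f n \<equiv> \<lambda>x. ln (post n x)"

definition shift :: "nat \<Rightarrow> real^'m" where
  "shift n = peaked.dstar (H n) (f n) (mode n)"

lemma consts_pos: "0 < \<kappa>" "0 \<le> M" "0 < \<epsilon>"
proof -
  obtain n where "peaked (H n) \<kappa> (real n) (f n) (mode n) M \<epsilon>"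
    using peaked_ev eventually_happens'[OF sequentially_bot] by blast
  then interpret peaked "H n" \<kappa> "real n" "f n" "mode n" M \<epsilon> .
  show "0 < \<kappa>" "0 \<le> M" "0 < \<epsilon>" by (rule \<kappa> M_nonneg \<epsilon>)+
qed

lemma scan_mean_expansion:
  "(\<lambda>n. scan_marginal_mean (post n) (mode n) j - (mode n $ j + shift n $ j)) \<in> O(\<lambda>n. 1 / real n ^ 2)"
proof -
  define lc where "lc n = laplace_cov (post n) (mode n)" for n
  \<comment> \<open>\<open>wb\<close> is the bound \<open>W\<close>, named here without reference to
    \<open>n\<close>. \<open>K\<close> adds up the bounds for all coefficients and for the
    remainder, so that one constant dominates each of them.\<close>
  define wb where "wb = peaked.W \<kappa> M"
  define e0 where "e0 = \<epsilon> / (2 * (wb + 1))"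
  define m where "m = real CARD('m)"
  define K where "K = M + m ^ 3 * wb * M * (1 + wb\<^sup>2) / \<kappa> + M * m ^ 3 * wb ^ 3 + M * m ^ 4 * wb ^ 4 + M * m ^ 5 * wb ^ 5"
  define h where "h n x = scan_log_marginal (post n) (mode n) j (x / sqrt (lc n $ j $ j))" for n x
  define a where "a n = 1 / lc n $ j $ j" for n
  define b where "b n = peaked.beta (H n) (f n) (mode n) j" for n
  define pc where "pc n = peaked.p (H n) (f n) (mode n) j" for n
  define qc where "qc n = peaked.q (H n) (f n) (mode n) j" for n
  define h' where "h' n x = (\<Sum>i\<in>UNIV. peaked.w (H n) j $ i * partial i (f n) (mode n + x *\<^sub>R peaked.w (H n) j)) + b n" for n x
  have wb: "0 \<le> wb"
  proof -
    obtain n where "peaked (H n) \<kappa> (real n) (f n) (mode n) M \<epsilon>"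
      using peaked_ev eventually_happens'[OF sequentially_bot] by blast
    then show ?thesis unfolding wb_def by (rule peaked.W_nonneg)
  qed
  have nonneg: "0 \<le> m ^ 3 * wb * M * (1 + wb\<^sup>2) / \<kappa>" "0 \<le> M * m ^ 3 * wb ^ 3" "0 \<le> M * m ^ 4 * wb ^ 4" "0 \<le> M * m ^ 5 * wb ^ 5"
    using wb consts_pos by (auto simp: m_def)
  have e0: "0 < e0" "e0 * wb < \<epsilon>"
  proof -
    show "0 < e0" using wb consts_pos by (simp add: e0_def)
    have "e0 * wb \<le> \<epsilon> / (2 * (wb + 1)) * (wb + 1)"
      unfolding e0_def using wb consts_pos by (intro mult_left_mono) auto
    also have "\<dots> = \<epsilon> / 2" using wb by (simp add: field_simps)
    also have "\<dots> < \<epsilon>" using consts_pos by simp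
    finally show "e0 * wb < \<epsilon>" .
  qed
  have h_eq: "\<forall>\<^sub>F n in sequentially. 0 < lc n $ j $ j \<and> (\<forall>x. h n x = f n (mode n + x *\<^sub>R peaked.w (H n) j) + x * b n)"
    using peaked_ev
  proof eventually_elim
    case (elim n)
    interpret peaked "H n" \<kappa> "real n" "f n" "mode n" M \<epsilon> by (rule elim)
    have lc: "lc n = local.Om"
      by (simp add: lc_def local.Om_def laplace_cov_def)
    define s where "s = sqrt (local.Om $ j $ j)"
    have s: "0 < s" "s * s = local.Om $ j $ j"
      using Om_diag_pos[of j] by (auto simp: s_def)
    \<comment> \<open>The scan direction is \<open>s\<close> times \<open>w j\<close>, so the volume
      slope carries the factor \<open>s\<close> as well; in the variable \<open>x = s * t\<close>
      both factors disappear.\<close>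
    have dir: "scan_direction (post n) (mode n) j = s *\<^sub>R local.w j"
      using s unfolding scan_direction_def local.w_def lc_def[symmetric] lc s_def[symmetric] s(2)[symmetric] by simp
    have "(log_volume (post n) (mode n) j has_real_derivative
        (\<Sum>a\<in>UNIV. \<Sum>b\<in>UNIV. (\<Sum>c\<in>UNIV. (s *\<^sub>R local.w j) $ c * T c a b) * Om_cond j $ b $ a) / 2) (at 0)"
      using log_volume_derivative[of "s *\<^sub>R local.w j" j]
      unfolding log_volume_def[abs_def] dir neg_log_hessian_def .
    moreover have "(\<Sum>a\<in>UNIV. \<Sum>b\<in>UNIV. (\<Sum>c\<in>UNIV. (s *\<^sub>R local.w j) $ c * T c a b) * Om_cond j $ b $ a) / 2 = s * beta j"
      by (simp add: beta_def mult.assoc flip: sum_distrib_left)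
    ultimately have slope: "volume_slope (post n) (mode n) j = s * b n"
      unfolding volume_slope_def b_def by (simp add: DERIV_imp_deriv)
    have "h n x = f n (mode n + x *\<^sub>R local.w j) + x * b n" for x
      unfolding h_def lc scan_log_marginal_def dir slope s_def[symmetric] using s by simp
    then show ?case
      unfolding lc using Om_diag_pos[of j] by blast
  qed
  have main: "(\<lambda>n. (\<integral>x. x * exp (h n x) \<partial>lborel) / (\<integral>x. exp (h n x) \<partial>lborel)
      - (b n / a n + pc n / (a n)\<^sup>2)) \<in> O(\<lambda>n. 1 / real n ^ 2)"
  proof (rule laplace_mean[where h' = h' and q = qc and K = K, OF e0(1) consts_pos(1)])
    show "0 \<le> K"
      using nonneg consts_pos by (simp add: K_def)
    show "\<forall>\<^sub>F n in sequentially. \<forall>x. \<bar>x\<bar> \<le> e0 \<longrightarrow> (h n has_real_derivative h' n x) (at x) \<and> isCont (h' n) x \<and>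
        \<bar>h' n x - (- a n * x + b n + pc n * x\<^sup>2 + qc n * x ^ 3)\<bar> \<le> K * real n * x ^ 4"
      using peaked_ev h_eq
    proof eventually_elim
      case (elim n)
      interpret peaked "H n" \<kappa> "real n" "f n" "mode n" M \<epsilon> by (rule elim)
      have lc: "lc n = local.Om"
        by (simp add: lc_def local.Om_def laplace_cov_def)
      have h: "h n = (\<lambda>x. f n (mode n + x *\<^sub>R local.w j) + x * beta j)"
        using elim(2) by (auto simp: b_def)
      have h'_eq: "h' n = (\<lambda>x. (\<Sum>i\<in>UNIV. local.w j $ i * partial i (f n) (mode n + x *\<^sub>R local.w j)) + beta j)"
        by (auto simp: h'_def b_def)
      show ?case
      proof (intro allI impI)
        fix x assume "\<bar>x\<bar> \<le> e0"
        then have "\<bar>x\<bar> * local.W < \<epsilon>"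
          using e0(2) mult_right_mono[of "\<bar>x\<bar>" e0 wb] wb by (simp add: wb_def)
        note exp = scan_expansion[OF this, of j]
        have "(M * (real CARD('m)) ^ 5 * local.W ^ 5) * real n * x ^ 4 \<le> K * real n * x ^ 4"
          using nonneg consts_pos by (intro mult_right_mono) (auto simp: K_def wb_def[symmetric] m_def[symmetric])
        then show "(h n has_real_derivative h' n x) (at x) \<and> isCont (h' n) x \<and>
            \<bar>h' n x - (- a n * x + b n + pc n * x\<^sup>2 + qc n * x ^ 3)\<bar> \<le> K * real n * x ^ 4"
          using exp unfolding h h'_eq a_def b_def pc_def qc_def lc by auto
      qed
    qed
    show "\<forall>\<^sub>F n in sequentially. \<kappa> * real n \<le> a n \<and> \<bar>a n\<bar> \<le> K * real n \<and> \<bar>b n\<bar> \<le> K \<and>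
        \<bar>pc n\<bar> \<le> K * real n \<and> \<bar>qc n\<bar> \<le> K * real n"
      using peaked_ev
    proof eventually_elim
      case (elim n)
      interpret peaked "H n" \<kappa> "real n" "f n" "mode n" M \<epsilon> by (rule elim)
      have lc: "lc n = local.Om"
        by (simp add: lc_def local.Om_def laplace_cov_def)
      have le: "c * real n \<le> K * real n" if "c \<le> K" for c
        using that by (rule mult_right_mono) simp
      have "M * real n \<le> K * real n" "M * m ^ 3 * wb ^ 3 * real n \<le> K * real n" "M * m ^ 4 * wb ^ 4 * real n \<le> K * real n"
        by (rule le; use nonneg consts_pos in \<open>simp add: K_def\<close>)+
      moreover have "m ^ 3 * wb * M * (1 + wb\<^sup>2) / \<kappa> \<le> K"
        using nonneg consts_pos by (simp add: K_def)
      moreover note curvature_lower[of j] curvature_upper[of j] beta_bound[of j] p_bound[of j] q_bound[of j] Om_diag_pos[of j]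
      ultimately show ?case
        unfolding a_def b_def pc_def qc_def lc wb_def m_def by (auto intro: order.trans)
    qed
    show "\<forall>\<^sub>F n in sequentially. h n \<in> borel_measurable borel"
      using h_eq meas_ev
    proof eventually_elim
      case (elim n)
      have "(\<lambda>x. mode n + x *\<^sub>R peaked.w (H n) j) \<in> borel_measurable borel"
        by (intro borel_measurable_continuous_onI continuous_intros)
      from measurable_compose[OF this elim(2)]
      have "(\<lambda>x. f n (mode n + x *\<^sub>R peaked.w (H n) j)) \<in> borel_measurable borel" .
      then have "(\<lambda>x. f n (mode n + x *\<^sub>R peaked.w (H n) j) + x * b n) \<in> borel_measurable borel"
        by measurable
      moreover have "h n = (\<lambda>x. f n (mode n + x *\<^sub>R peaked.w (H n) j) + x * b n)"
        using elim(1) by auto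
      ultimately show ?case by simp
    qed
    show "\<forall>k\<in>{0, 1}. tail_decay_cond (\<lambda>n x. x ^ k) (\<lambda>n x. exp (h n x)) (\<lambda>n. 0)"
      using regular unfolding laplace_regular_def h_def[abs_def] lc_def by blast
  qed
  have "\<forall>\<^sub>F n in sequentially. scan_marginal_mean (post n) (mode n) j - (mode n $ j + shift n $ j)
      = (\<integral>x. x * exp (h n x) \<partial>lborel) / (\<integral>x. exp (h n x) \<partial>lborel) - (b n / a n + pc n / (a n)\<^sup>2)"
    using peaked_ev h_eq
  proof eventually_elim
    case (elim n)
    interpret peaked "H n" \<kappa> "real n" "f n" "mode n" M \<epsilon> by (rule elim)
    have lc: "lc n = local.Om"
      by (simp add: lc_def local.Om_def laplace_cov_def)
    define s where "s = sqrt (lc n $ j $ j)"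
    have s: "0 < s" using elim(2) by (simp add: s_def)
    let ?g = "scan_log_marginal (post n) (mode n) j"
    have h: "h n x = ?g (x / s)" for x
      by (simp add: h_def s_def)
    \<comment> \<open>Substituting \<open>t = x / s\<close> puts \<open>1 / s\<close> twice into the
      numerator and once into the denominator; the surplus cancels the \<open>sqrt\<close> in
      \<open>scan_marginal_mean\<close>.\<close>
    have "(\<integral>t. t * exp (?g t) \<partial>lborel) = (1 / s) * (\<integral>x. x / s * exp (h n x) \<partial>lborel)"
      using lborel_integral_real_affine[of "1 / s" "\<lambda>t. t * exp (?g t)" 0] s by (simp add: h)
    also have "\<dots> = (1 / s) * ((1 / s) * (\<integral>x. x * exp (h n x) \<partial>lborel))"
      by (subst integral_mult_right_zero[symmetric]) simp
    finally have num: "(\<integral>t. t * exp (?g t) \<partial>lborel) = (1 / s) * ((1 / s) * (\<integral>x. x * exp (h n x) \<partial>lborel))" .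
    have den: "(\<integral>t. exp (?g t) \<partial>lborel) = (1 / s) * (\<integral>x. exp (h n x) \<partial>lborel)"
      using lborel_integral_real_affine[of "1 / s" "\<lambda>t. exp (?g t)" 0] s by (simp add: h)
    have "scan_marginal_mean (post n) (mode n) j = mode n $ j + (\<integral>x. x * exp (h n x) \<partial>lborel) / (\<integral>x. exp (h n x) \<partial>lborel)"
      unfolding scan_marginal_mean_def num den lc_def[symmetric] s_def[symmetric] using s by simp
    moreover have "b n / a n + pc n / (a n)\<^sup>2 = shift n $ j"
      using scan_shift_eq_dstar[of j] by (simp add: a_def b_def pc_def shift_def lc)
    ultimately show ?case by simp
  qed
  from landau_o.big.in_cong[OF this] main show ?thesis by simp
qed

abbreviation weight :: "nat \<Rightarrow> real^'m \<Rightarrow> real" where "weight n \<equiv> gaussian_weight.psi (H n)"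

definition tail :: "(nat \<Rightarrow> real^'m) \<Rightarrow> real \<Rightarrow> nat \<Rightarrow> real^'m \<Rightarrow> real" where
  "tail d \<rho> n z = indicator (- ball 0 \<rho>) z * (weight n z * \<bar>f n (mode n + (d n + z))\<bar>)"

lemma tail_ev:
  assumes "d \<longlonglongrightarrow> 0" "0 < \<rho>"
  obtains C c where "0 < C" "0 < c" "\<forall>\<^sub>F n in sequentially.
    integrable lborel (tail d \<rho> n) \<and> (\<integral>z. tail d \<rho> n z \<partial>lborel) \<le> C * exp (- c * real n)"
proof -
  have "tail_decay_cond (\<lambda>n x. ln (post n x))
      (\<lambda>n. mvn_density (mode n + d n) (laplace_cov (post n) (mode n))) (\<lambda>n. mode n + d n)"
    using regular assms(1) unfolding laplace_regular_def by blast
  then obtain C c where C: "0 < C" "0 < c" and ev: "\<forall>\<^sub>F n in sequentially.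
      set_integrable lborel (- ball (mode n + d n) \<rho>) (\<lambda>x. \<bar>f n x\<bar> *
        (mvn_density (mode n + d n) (laplace_cov (post n) (mode n)) x
          / mvn_density (mode n + d n) (laplace_cov (post n) (mode n)) (mode n + d n))) \<and>
      (LINT x:- ball (mode n + d n) \<rho>|lborel. \<bar>f n x\<bar> *
        (mvn_density (mode n + d n) (laplace_cov (post n) (mode n)) x
          / mvn_density (mode n + d n) (laplace_cov (post n) (mode n)) (mode n + d n))) \<le> C * exp (- c * real n)"
    using assms(2) unfolding tail_decay_cond_def by blast
  from ev peaked_ev meas_ev have "\<forall>\<^sub>F n in sequentially.
    integrable lborel (tail d \<rho> n) \<and> (\<integral>z. tail d \<rho> n z \<partial>lborel) \<le> C * exp (- c * real n)"
  proof eventually_elim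
    case (elim n)
    interpret peaked "H n" \<kappa> "real n" "f n" "mode n" M \<epsilon> by (rule elim)
    have lc: "laplace_cov (post n) (mode n) = Om"
      by (simp add: Om_def laplace_cov_def)
    show ?case
      using elim(1) mvn_tail[OF elim(3), of "mode n + d n" \<rho>] unfolding lc tail_def[abs_def] by (simp add: add.assoc)
  qed
  with C show thesis by (rule that)
qed

lemma rad_pos: "0 < peaked.rad TYPE('m) \<kappa> M \<epsilon>"
proof -
  obtain n where "peaked (H n) \<kappa> (real n) (f n) (mode n) M \<epsilon>"
    using peaked_ev eventually_happens'[OF sequentially_bot] by blast
  then show ?thesis by (rule peaked.rad)
qed

text \<open>Maximality in \<open>is_vb_correction\<close> is only against shifts with an integrable
  log posterior; this admits 0 and \<open>shift\<close> as competitors. Near the mode smoothness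
  gives integrability, far away the tail condition.\<close>

lemma integrable_ev:
  assumes d: "d \<longlonglongrightarrow> 0"
  shows "\<forall>\<^sub>F n in sequentially. integrable lborel (\<lambda>z. weight n z * f n (mode n + (d n + z)))"
proof -
  define r0 where "r0 = peaked.rad TYPE('m) \<kappa> M \<epsilon>"
  have half: "0 < r0 / 2" using rad_pos by (simp add: r0_def)
  obtain C c where "\<forall>\<^sub>F n in sequentially.
    integrable lborel (tail d (r0 / 2) n) \<and> (\<integral>z. tail d (r0 / 2) n z \<partial>lborel) \<le> C * exp (- c * real n)"
    using tail_ev[OF d half] .
  moreover have "\<forall>\<^sub>F n in sequentially. norm (d n) < r0 / 2"
    using tendstoD[OF d half] by (simp add: dist_norm)
  ultimately show ?thesis
    using peaked_ev meas_ev
  proof eventually_elim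
    case (elim n)
    interpret peaked "H n" \<kappa> "real n" "f n" "mode n" M \<epsilon> by (rule elim)
    let ?F = "\<lambda>z. psi z * f n (mode n + (d n + z))"
    have "(\<lambda>z. mode n + (d n + z)) \<in> borel_measurable borel"
      by (intro borel_measurable_continuous_onI continuous_intros)
    from measurable_compose[OF this elim(4)]
    have [measurable]: "(\<lambda>z. f n (mode n + (d n + z))) \<in> borel_measurable borel" .
    have "integrable lborel (\<lambda>z. indicator (ball 0 (r0 / 2)) z * ?F z)"
      using elim(2) by (intro f_local_integrable) (simp add: r0_def)
    moreover have "integrable lborel (\<lambda>z. indicator (- ball 0 (r0 / 2)) z * ?F z)"
      by (rule Bochner_Integration.integrable_bound[OF conjunct1[OF elim(1)]])
        (use psi_pos in \<open>auto simp: tail_def abs_mult less_imp_le\<close>)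
    ultimately have "integrable lborel (\<lambda>z. indicator (ball 0 (r0 / 2)) z * ?F z + indicator (- ball 0 (r0 / 2)) z * ?F z)"
      by (rule Bochner_Integration.integrable_add)
    moreover have "indicator (ball 0 (r0 / 2)) z * ?F z + indicator (- ball 0 (r0 / 2)) z * ?F z = ?F z" for z
      by (simp add: indicator_def)
    ultimately show ?case by simp
  qed
qed

lemma shift_tendsto: "shift \<longlonglongrightarrow> 0"
proof (rule Lim_null_comparison)
  show "\<forall>\<^sub>F n in sequentially. norm (shift n) \<le> peaked.D TYPE('m) \<kappa> M / real n"
    using peaked_ev by eventually_elim (auto simp: shift_def intro: peaked.dstar_bound)
  show "(\<lambda>n. peaked.D TYPE('m) \<kappa> M / real n) \<longlonglongrightarrow> 0"
    by (rule lim_const_over_n)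
qed

context
  fixes \<delta> :: "nat \<Rightarrow> real^'m"
  assumes vb: "\<forall>\<^sub>F n in sequentially. is_vb_correction (post n) (mode n) (\<delta> n)"
    and prob: "\<forall>\<^sub>F n in sequentially. (\<forall>x. 0 < post n x) \<and> integrable lborel (post n) \<and> (\<integral>x. post n x \<partial>lborel) = 1"
begin

lemma vb_optimal:
  "\<forall>\<^sub>F n in sequentially. integrable lborel (\<lambda>z. weight n z * f n (mode n + (\<delta> n + z))) \<and>
    (\<forall>d. integrable lborel (\<lambda>z. weight n z * f n (mode n + (d + z))) \<longrightarrow>
      (\<integral>z. weight n z * f n (mode n + (d + z)) \<partial>lborel) \<le> (\<integral>z. weight n z * f n (mode n + (\<delta> n + z)) \<partial>lborel))"
  using vb peaked_ev meas_ev
proof eventually_elim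
  case (elim n)
  interpret peaked "H n" \<kappa> "real n" "f n" "mode n" M \<epsilon> by (rule elim)
  have lc: "laplace_cov (post n) (mode n) = Om"
    by (simp add: Om_def laplace_cov_def)
  note exps = mvn_expectation[OF elim(3), of "mode n + d" for d, unfolded add.assoc]
  have max: "integrable (mvn (mode n + \<delta> n) Om) (f n)"
    "\<And>d. integrable (mvn (mode n + d) Om) (f n) \<Longrightarrow>
      (\<integral>\<theta>. f n \<theta> \<partial>mvn (mode n + d) Om) \<le> (\<integral>\<theta>. f n \<theta> \<partial>mvn (mode n + \<delta> n) Om)"
    using elim(1) unfolding is_vb_correction_def is_arg_max_def vb_objective_def lc by (auto simp: not_less)
  show ?case
    using max norm_const_pos unfolding exps by (simp add: divide_le_cancel)
qed

text \<open>Has to precede any use of \<open>tail_ev\<close> at \<open>\<delta>\<close>, which is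
  granted only along shifts tending to 0. There is no circularity: \<open>vb_near\<close> asks of
  \<open>\<delta>\<close> only integrability and optimality, and takes its tail bound at the zero
  shift.\<close>

lemma vb_correction_tendsto: "\<delta> \<longlonglongrightarrow> 0"
proof (rule tendstoI)
  fix \<eta> :: real assume \<eta>: "0 < \<eta>"
  define r0 where "r0 = peaked.rad TYPE('m) \<kappa> M \<epsilon>"
  have r0: "0 < r0" using rad_pos by (simp add: r0_def)
  have zero: "(\<lambda>n. 0 :: real^'m) \<longlonglongrightarrow> 0" by simp
  obtain c where c: "0 < c" and far: "\<forall>\<^sub>F n in sequentially. \<forall>x. \<eta> / 2 \<le> dist x (mode n) \<longrightarrow>
      avg_log post n x \<le> avg_log post n (mode n) - c"
    using regular \<eta> unfolding laplace_regular_def unique_mode_cond_def by (meson half_gt_zero)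
  obtain Ct ct where Ct: "0 < Ct" "0 < ct" and tail: "\<forall>\<^sub>F n in sequentially.
      integrable lborel (tail (\<lambda>n. 0) r0 n) \<and> (\<integral>z. tail (\<lambda>n. 0) r0 n z \<partial>lborel) \<le> Ct * exp (- ct * real n)"
    using tail_ev[OF zero r0] .
  define B where "B = M * (real CARD('m)) ^ 4 + CARD('m)"
  have large: "\<forall>\<^sub>F n in sequentially. b < real n" for b
    using filterlim_real_sequentially unfolding filterlim_at_top_dense by blast
  show "\<forall>\<^sub>F n in sequentially. dist (\<delta> n) 0 < \<eta>"
    using far tail integrable_ev[OF zero] vb_optimal prob peaked_ev
      large[of "real CARD('m) / \<epsilon>"] large[of "64 * real CARD('m) / (\<kappa> * \<eta>\<^sup>2)"]
      large[of "2 * (peaked.far_const TYPE('m) \<kappa> M B r0 + peaked.tail_const TYPE('m) M Ct ct) / c"]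
  proof eventually_elim
    case (elim n)
    interpret peaked "H n" \<kappa> "real n" "f n" "mode n" M \<epsilon> by (rule elim)
    have n: "0 < real n" using N by simp
    have "norm (\<delta> n) < \<eta>"
    proof (rule vb_near[OF \<eta> c, where B = B and \<rho> = r0 and Ct = Ct and ct = ct])
      show "f n x \<le> f n (mode n) - c * real n" if "\<eta> / 2 \<le> dist x (mode n)" for x
      proof -
        have "avg_log post n x \<le> avg_log post n (mode n) - c"
          using elim(1) that by blast
        from mult_right_mono[OF this, of "real n"] show ?thesis
          using n by (simp add: avg_log_def left_diff_distrib)
      qed
      show "0 \<le> B"
        using M_nonneg by (simp add: B_def)
      show "f n (mode n) \<le> B * real n"
        unfolding B_def
      proof (rule log_max_bound)
        show "integrable lborel (\<lambda>x. exp (f n x))" "(\<integral>x. exp (f n x) \<partial>lborel) = 1"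
          using elim(5) by simp_all
        show "real CARD('m) / real n < \<epsilon>"
          using elim(7) n \<epsilon> by (simp add: field_simps)
      qed
      show "(\<integral>z. psi z * f n (mode n + z) \<partial>lborel) \<le> (\<integral>z. psi z * f n (mode n + (\<delta> n + z)) \<partial>lborel)"
        using conjunct2[OF elim(4), rule_format, of 0] elim(3) by simp
    qed (use elim Ct r0 in \<open>simp_all add: less_imp_le r0_def tail_def\<close>)
    then show ?case by simp
  qed
qed

lemma vb_correction_expansion: "(\<lambda>n. \<delta> n $ j - shift n $ j) \<in> O(\<lambda>n. 1 / real n ^ 2)"
proof -
  define r0 where "r0 = peaked.rad TYPE('m) \<kappa> M \<epsilon>"
  \<comment> \<open>One half of \<open>rad\<close> is for the shift and one for the ball around it,
    so that \<open>norm d + \<rho> \<le> rad\<close> holds eventually.\<close>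
  have half: "0 < r0 / 2" using rad_pos by (simp add: r0_def)
  obtain C1 c1 where C1: "0 < C1" "0 < c1" and tail1: "\<forall>\<^sub>F n in sequentially.
      integrable lborel (tail \<delta> (r0 / 2) n) \<and> (\<integral>z. tail \<delta> (r0 / 2) n z \<partial>lborel) \<le> C1 * exp (- c1 * real n)"
    using tail_ev[OF vb_correction_tendsto half] .
  obtain C2 c2 where C2: "0 < C2" "0 < c2" and tail2: "\<forall>\<^sub>F n in sequentially.
      integrable lborel (tail shift (r0 / 2) n) \<and> (\<integral>z. tail shift (r0 / 2) n z \<partial>lborel) \<le> C2 * exp (- c2 * real n)"
    using tail_ev[OF shift_tendsto half] .
  define K where "K = 8 * (real CARD('m) * peaked.KG TYPE('m) \<kappa> M (r0 / 2)
      + (peaked.tail_const TYPE('m) M C1 c1 + peaked.tail_const TYPE('m) M C2 c2)) / \<kappa> + 1"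
  have small: "\<forall>\<^sub>F n in sequentially. norm (d n) < r0 / 2" if "d \<longlonglongrightarrow> 0" for d :: "nat \<Rightarrow> real^'m"
    using tendstoD[OF that half] by (simp add: dist_norm)
  have large: "\<forall>\<^sub>F n in sequentially. b < real n" for b
    using filterlim_real_sequentially unfolding filterlim_at_top_dense by blast
  have "\<forall>\<^sub>F n in sequentially. norm (\<delta> n $ j - shift n $ j) \<le> K * norm (1 / real n ^ 2)"
    using tail1 tail2 integrable_ev[OF shift_tendsto] vb_optimal peaked_ev
      small[OF vb_correction_tendsto] small[OF shift_tendsto]
      large[of "16 * real CARD('m) / (\<kappa> * (r0 / 2)\<^sup>2)"]
  proof eventually_elim
    case (elim n)
    interpret peaked "H n" \<kappa> "real n" "f n" "mode n" M \<epsilon> by (rule elim)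
    have shift: "shift n = dstar"
      by (simp add: shift_def)
    have "norm (\<delta> n - dstar) \<le> K / (real n)\<^sup>2"
      unfolding K_def
      by (rule vb_expansion) (use elim half C1 C2 in \<open>auto simp: shift less_imp_le r0_def tail_def\<close>)
    moreover have "\<bar>(\<delta> n - dstar) $ j\<bar> \<le> norm (\<delta> n - dstar)"
      by (rule component_le_norm_cart)
    ultimately show ?case
      by (simp add: shift)
  qed
  then show ?thesis
    by (rule bigoI)
qed

lemma scan_mean_vb:
  "(\<lambda>n. scan_marginal_mean (post n) (mode n) j - (mode n $ j + \<delta> n $ j)) \<in> O(\<lambda>n. 1 / real n ^ 2)"
  using sum_in_bigo(2)[OF scan_mean_expansion vb_correction_expansion, of j j]
  by (simp add: algebra_simps)

end

end

section \<open>The posterior of the structural equation model\<close>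

lemma mvn_density_pos: "pos_def \<Sigma> \<Longrightarrow> 0 < mvn_density \<nu> \<Sigma> x"
  using pos_def_det_pos[of \<Sigma>] by (simp add: mvn_density_def pos_def_def)

lemma sem_likelihood_pos: "valid_sem S \<Longrightarrow> 0 < sem_likelihood S y n \<theta>"
  unfolding sem_likelihood_def valid_sem_def by (intro prod_pos ballI mvn_density_pos) simp

text \<open>The normalising constant is the integral of a positive function; were it 0, that
  function would vanish almost everywhere. Total mass 1 is what \<open>log_max_bound\<close>
  needs.\<close>

lemma sem_posterior_density:
  assumes "valid_sem S" "\<And>\<theta>. 0 < prior \<theta>" "integrable lborel (\<lambda>\<theta>. sem_likelihood S y n \<theta> * prior \<theta>)"
  shows "0 < sem_posterior S prior y n \<theta>" "integrable lborel (sem_posterior S prior y n)"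
    "(\<integral>\<theta>. sem_posterior S prior y n \<theta> \<partial>lborel) = 1"
proof -
  let ?F = "\<lambda>\<theta>. sem_likelihood S y n \<theta> * prior \<theta>"
  have pos: "0 < ?F \<theta>" for \<theta>
    using sem_likelihood_pos[OF assms(1)] assms(2) by simp
  have Z: "0 < (\<integral>\<theta>. ?F \<theta> \<partial>lborel)"
  proof (rule ccontr)
    assume "\<not> ?thesis"
    moreover have "0 \<le> (\<integral>\<theta>. ?F \<theta> \<partial>lborel)"
      using pos by (intro integral_nonneg_AE AE_I2) (simp add: less_imp_le)
    ultimately have "(\<integral>\<theta>. ?F \<theta> \<partial>lborel) = 0" by simp
    then have "AE \<theta> in lborel. ?F \<theta> = 0"
      using pos by (subst (asm) integral_nonneg_eq_0_iff_AE[OF assms(3)]) (auto simp: less_imp_le)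
    then have "AE \<theta> in (lborel :: (real^'a) measure). False"
      using pos by (auto elim!: eventually_mono simp: less_le)
    then have "ae_filter (lborel :: (real^'a) measure) = bot"
      by (simp add: trivial_limit_def)
    then show False
      by (simp add: ae_filter_eq_bot_iff)
  qed
  have eq: "sem_posterior S prior y n = (\<lambda>\<theta>. ?F \<theta> / (\<integral>t. ?F t \<partial>lborel))"
    by (rule ext) (simp add: sem_posterior_def)
  show "0 < sem_posterior S prior y n \<theta>"
    unfolding eq by (intro divide_pos_pos pos Z)
  show "integrable lborel (sem_posterior S prior y n)"
    unfolding eq using assms(3) by (rule integrable_divide)
  show "(\<integral>\<theta>. sem_posterior S prior y n \<theta> \<partial>lborel) = 1"
    unfolding eq using Z by simp
qed

theorem proposition3p4:
  fixes S :: "('m::finite, 'p::finite, 'q::finite) sem"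
    and prior :: "real^'m \<Rightarrow> real"
    and y :: "nat \<Rightarrow> real^'p"
    and post :: "nat \<Rightarrow> real^'m \<Rightarrow> real"
    and mode \<delta> :: "nat \<Rightarrow> real^'m"
  defines "post \<equiv> sem_posterior S prior y"
  assumes model: "valid_sem S"
    and prior: "prior \<in> borel_measurable borel" "\<And>\<theta>. 0 < prior \<theta>"
    and proper: "\<forall>\<^sub>F n in sequentially. integrable lborel (\<lambda>\<theta>. sem_likelihood S y n \<theta> * prior \<theta>)"
    and mode: "\<forall>\<^sub>F n in sequentially. is_arg_max (post n) (\<lambda>\<theta>. True) (mode n)"
    and hessian: "\<forall>\<^sub>F n in sequentially. pos_def (neg_log_hessian (post n) (mode n))"
    and vb: "\<forall>\<^sub>F n in sequentially. is_vb_correction (post n) (mode n) (\<delta> n)"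
    and regular: "laplace_regular post mode"
  shows "\<forall>j. (\<lambda>n. scan_marginal_mean (post n) (mode n) j - (mode n $ j + \<delta> n $ j))
           \<in> O(\<lambda>n. 1 / real n ^ 2)"
proof -
  have prob: "\<forall>\<^sub>F n in sequentially. (\<forall>x. 0 < post n x) \<and> integrable lborel (post n) \<and> (\<integral>x. post n x \<partial>lborel) = 1"
    using proper by eventually_elim (simp add: post_def sem_posterior_density[OF model prior(2)])
  obtain \<kappa> where \<kappa>: "0 < \<kappa>" and curvature: "\<forall>\<^sub>F n in sequentially. \<forall>u.
      \<kappa> * (u \<bullet> u) \<le> u \<bullet> (- Defs.hessian (avg_log post n) (mode n) *v u)"
    using regular unfolding laplace_regular_def unique_mode_cond_def by blast
  obtain \<epsilon> M where \<epsilon>: "0 < \<epsilon>" and smooth: "\<forall>\<^sub>F n in sequentially.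
      bounded_derivs_on 5 M (ball (mode n) \<epsilon>) (avg_log post n)"
    using regular unfolding laplace_regular_def local_smoothness_cond_def by blast
  \<comment> \<open>The regularity conditions concern the average \<open>avg_log\<close>;
    multiplication by \<open>n\<close> turns the bounds \<open>\<kappa>\<close> and \<open>M\<close>
    into \<open>\<kappa> * n\<close> and \<open>M * n\<close>.\<close>
  have peaked: "\<forall>\<^sub>F n in sequentially.
      peaked (neg_log_hessian (post n) (mode n)) \<kappa> (real n) (\<lambda>x. ln (post n x)) (mode n) M \<epsilon>"
    using prob curvature smooth mode hessian eventually_gt_at_top[of 0]
  proof eventually_elim
    case (elim n)
    let ?H = "neg_log_hessian (post n) (mode n)"
    have n: "0 < real n" using elim by simp
    have f: "(\<lambda>x. ln (post n x)) = (\<lambda>x. real n * avg_log post n x)"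
      using n by (simp add: avg_log_def)
    have H: "?H = real n *\<^sub>R (- Defs.hessian (avg_log post n) (mode n))"
    proof -
      have "partials [i, j] (\<lambda>x. real n * avg_log post n x) (mode n) = real n * partials [i, j] (avg_log post n) (mode n)" for i j
        by (rule partials_cmult[OF elim(3) open_ball]) (use \<epsilon> in auto)
      then show ?thesis
        unfolding neg_log_hessian_def f by (simp add: Defs.hessian_def vec_eq_iff)
    qed
    show ?case
    proof unfold_locales
      show "transpose ?H = ?H"
        using elim(5) by (simp add: pos_def_def)
      show "0 < \<kappa> * real n" using \<kappa> n by simp
      show "\<kappa> * real n * (u \<bullet> u) \<le> u \<bullet> (?H *v u)" for u
        using mult_left_mono[OF spec[OF elim(2), of u], of "real n"]
        unfolding H by (simp add: scaleR_matrix_vector_assoc[symmetric] mult_ac del: scaleR_minus_right)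
      show "1 \<le> real n" "0 < \<epsilon>" using elim \<epsilon> by auto
      show "?H = - Defs.hessian (\<lambda>x. ln (post n x)) (mode n)"
        by (simp add: neg_log_hessian_def)
      show "bounded_derivs_on 5 (M * real n) (ball (mode n) \<epsilon>) (\<lambda>x. ln (post n x))"
        using bounded_derivs_on_cmult[OF elim(3) open_ball, of "real n"] unfolding f by (simp add: mult.commute)
      show "ln (post n x) \<le> ln (post n (mode n))" for x
        using elim(1) elim(4) by (simp add: is_arg_max_def not_less)
    qed
  qed
  have meas: "\<forall>\<^sub>F n in sequentially. (\<lambda>x. ln (post n x)) \<in> borel_measurable borel"
    using prob by eventually_elim (auto intro!: borel_measurable_ln)
  interpret posterior_sequence post mode \<kappa> M \<epsilon>
    by unfold_locales (rule peaked meas regular)+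
  show ?thesis
    using scan_mean_vb[OF vb prob] by blast
qed

end
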